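(* Let $R$ be a ring and let $$0\to A_i\to B_i\to C_i\to 0,\quad i=1,2,\dots,n,\qquad\text{and}\qquad 0\to A'_j\to B'_j\to C'_j\to 0,\quad j=1,2,\dots,m,$$ be $n+m$ non-zero objects of the category $\mathcal{E}$ with all the modules $A_i,C_i,A'_j,C'_j$ uniserial. Set $$X_l:=\{i\mid i=1,\dots,n,\ A_i\neq 0\},\quad X_u:=\{i\mid i=1,\dots,n,\ C_i\neq 0\},$$ $$X'_l:=\{j\mid j=1,\dots,m,\ A'_j\neq 0\},\quad X'_u:=\{j\mid j=1,\dots,m,\ C'_j\neq 0\}.$$ Then $\bigoplus_{i=1}^n B_i\cong\bigoplus_{j=1}^m B'_j$ in the category $\mathcal{E}$ if and only if there exist four bijections $\varphi_{a,b}\colon X_b\to X'_b$, $a=m,e$ and $b=l,u$, such that $[B_i]_{a,b}=[B'_{\varphi_{a,b}(i)}]_{a,b}$ for every $a=m,e$, every $b=l,u$ and every $i\in X_b$. (Here an object of $\mathcal E$ is denoted by its middle term.)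
   Context: Rings are associative with identity and modules are unitary right modules. A module is uniserial if its lattice of submodules is linearly ordered under inclusion. The category $\mathcal{E}$ has as objects the short exact sequences $0\to A\xrightarrow{\alpha} B\xrightarrow{\beta} C\to 0$ of right $R$-modules; a morphism from such a sequence to $0\to A'\xrightarrow{\alpha'} B'\xrightarrow{\beta'} C'\to 0$ is an $R$-module morphism $f\colon B\to B'$ with $f(\alpha(A))\subseteq\alpha'(A')$. Such an $f$ induces morphisms $f|\colon A\to A'$ and $\overline f\colon C\to C'$. An object of $\mathcal{E}$ is denoted simply by its middle term $B$. $\mathcal{E}$ is additive, direct sums being taken termwise, and its zero object is the sequence with all terms zero. For two objects $B,B'$ of $\mathcal{E}$: $[B]_{m,l}=[B']_{m,l}$ (resp. $[B]_{e,l}=[B']_{e,l}$) means that there exist morphisms $f\colon B\to B'$ and $g\colon B'\to B$ in $\mathcal{E}$ such that $f|\colon A\to A'$ and $g|\colon A'\to A$ are both injective (resp. both surjective); $[B]_{m,u}=[B']_{m,u}$ (resp. $[B]_{e,u}=[B']_{e,u}$) means that there exist morphisms $f\colon B\to B'$ and $g\colon B'\to B$ in $\mathcal{E}$ such that $\overline f\colon C\to C'$ and $\overline g\colon C'\to C$ are both injective (resp. both surjective). (The index letters $m,e,l,u$ are formal symbols.) *)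

theory Defs
  imports "HOL-Algebra.AbelCoset"
begin

text \<open>
  The locale \<open>module\<close> of HOL-Algebra is restricted to commutative base rings, so right modules
  over an arbitrary (associative, unital) \<open>ring\<close> are introduced here in the same style. As there,
  extending \<open>ring\<close> serves only to inherit the additive structure: the fields \<open>mult\<close> and
  \<open>one\<close> of a module record are never used.
\<close>

record ('r, 'm) rmodule = "'m ring" +
  rsmult :: "'m \<Rightarrow> 'r \<Rightarrow> 'm" (infixl \<open>\<star>\<index>\<close> 70)

locale right_module = R?: ring R + M?: abelian_group M
  for R :: "('r, 'q) ring_scheme" (structure) and M :: "('r, 'm) rmodule" (structure) +
  assumes rsmult_closed [simp, intro]:
      "\<lbrakk>x \<in> carrier M; r \<in> carrier R\<rbrakk> \<Longrightarrow> x \<star>\<^bsub>M\<^esub> r \<in> carrier M"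
    and rsmult_l_distr:
      "\<lbrakk>x \<in> carrier M; y \<in> carrier M; r \<in> carrier R\<rbrakk> \<Longrightarrow>
        (x \<oplus>\<^bsub>M\<^esub> y) \<star>\<^bsub>M\<^esub> r = x \<star>\<^bsub>M\<^esub> r \<oplus>\<^bsub>M\<^esub> y \<star>\<^bsub>M\<^esub> r"
    and rsmult_r_distr:
      "\<lbrakk>x \<in> carrier M; r \<in> carrier R; s \<in> carrier R\<rbrakk> \<Longrightarrow>
        x \<star>\<^bsub>M\<^esub> (r \<oplus>\<^bsub>R\<^esub> s) = x \<star>\<^bsub>M\<^esub> r \<oplus>\<^bsub>M\<^esub> x \<star>\<^bsub>M\<^esub> s"
    and rsmult_assoc:
      "\<lbrakk>x \<in> carrier M; r \<in> carrier R; s \<in> carrier R\<rbrakk> \<Longrightarrow>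
        x \<star>\<^bsub>M\<^esub> (r \<otimes>\<^bsub>R\<^esub> s) = (x \<star>\<^bsub>M\<^esub> r) \<star>\<^bsub>M\<^esub> s"
    and rsmult_one [simp]:
      "x \<in> carrier M \<Longrightarrow> x \<star>\<^bsub>M\<^esub> \<one>\<^bsub>R\<^esub> = x"

definition rsubmodule :: "'m set \<Rightarrow> ('r, 'q) ring_scheme \<Rightarrow> ('r, 'm) rmodule \<Rightarrow> bool" where
  "rsubmodule N R M \<longleftrightarrow>
     additive_subgroup N M \<and> (\<forall>x\<in>N. \<forall>r\<in>carrier R. x \<star>\<^bsub>M\<^esub> r \<in> N)"

definition uniserial :: "('r, 'q) ring_scheme \<Rightarrow> ('r, 'm) rmodule \<Rightarrow> bool" where
  "uniserial R M \<longleftrightarrow>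
     (\<forall>N P. rsubmodule N R M \<longrightarrow> rsubmodule P R M \<longrightarrow> N \<subseteq> P \<or> P \<subseteq> N)"

definition zero_module :: "('r, 'm) rmodule \<Rightarrow> bool" where
  "zero_module M \<longleftrightarrow> carrier M = {\<zero>\<^bsub>M\<^esub>}"

definition rmod_hom ::
    "('r, 'q) ring_scheme \<Rightarrow> ('r, 'm) rmodule \<Rightarrow> ('r, 'n) rmodule \<Rightarrow> ('m \<Rightarrow> 'n) set" where
  "rmod_hom R M N =
     {f \<in> hom (add_monoid M) (add_monoid N).
        \<forall>x\<in>carrier M. \<forall>r\<in>carrier R. f (x \<star>\<^bsub>M\<^esub> r) = f x \<star>\<^bsub>N\<^esub> r}"

text \<open>
  The index set is finite in all applications below, so that the product is the direct sum.
\<close>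

definition rmod_sum :: "'i set \<Rightarrow> ('i \<Rightarrow> ('r, 'm) rmodule) \<Rightarrow> ('r, 'i \<Rightarrow> 'm) rmodule" where
  "rmod_sum I M =
     \<lparr>carrier = (\<Pi>\<^sub>E i\<in>I. carrier (M i)),
      monoid.mult = (\<lambda>x y. undefined),
      monoid.one = undefined,
      ring.zero = (\<lambda>i\<in>I. \<zero>\<^bsub>M i\<^esub>),
      ring.add = (\<lambda>x y. \<lambda>i\<in>I. x i \<oplus>\<^bsub>M i\<^esub> y i),
      rsmult = (\<lambda>x r. \<lambda>i\<in>I. x i \<star>\<^bsub>M i\<^esub> r)\<rparr>"

record ('r, 'a, 'b, 'c) ses =
  ses_A :: "('r, 'a) rmodule"
  ses_B :: "('r, 'b) rmodule"
  ses_C :: "('r, 'c) rmodule"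
  ses_alpha :: "'a \<Rightarrow> 'b"
  ses_beta :: "'b \<Rightarrow> 'c"

definition ses_obj :: "('r, 'q) ring_scheme \<Rightarrow> ('r, 'a, 'b, 'c) ses \<Rightarrow> bool" where
  "ses_obj R S \<longleftrightarrow>
     right_module R (ses_A S) \<and> right_module R (ses_B S) \<and> right_module R (ses_C S) \<and>
     ses_alpha S \<in> rmod_hom R (ses_A S) (ses_B S) \<and>
     ses_beta S \<in> rmod_hom R (ses_B S) (ses_C S) \<and>
     inj_on (ses_alpha S) (carrier (ses_A S)) \<and>
     ses_alpha S ` carrier (ses_A S) = {b \<in> carrier (ses_B S). ses_beta S b = \<zero>\<^bsub>ses_C S\<^esub>} \<and>
     ses_beta S ` carrier (ses_B S) = carrier (ses_C S)"

definition ses_zero :: "('r, 'a, 'b, 'c) ses \<Rightarrow> bool" where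
  "ses_zero S \<longleftrightarrow> zero_module (ses_A S) \<and> zero_module (ses_B S) \<and> zero_module (ses_C S)"

definition ses_hom ::
    "('r, 'q) ring_scheme \<Rightarrow> ('r, 'a, 'b, 'c) ses \<Rightarrow> ('r, 'd, 'e, 'f) ses \<Rightarrow> ('b \<Rightarrow> 'e) set" where
  "ses_hom R S S' =
     {f \<in> rmod_hom R (ses_B S) (ses_B S').
        f ` (ses_alpha S ` carrier (ses_A S)) \<subseteq> ses_alpha S' ` carrier (ses_A S')}"

text \<open>
  Morphisms are functions on the whole type that matter only on the carrier of the middle term;
  hence two of them are equal as morphisms iff they agree on that carrier.
\<close>

definition ses_iso ::
    "('r, 'q) ring_scheme \<Rightarrow> ('r, 'a, 'b, 'c) ses \<Rightarrow> ('r, 'd, 'e, 'f) ses \<Rightarrow> bool" where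
  "ses_iso R S S' \<longleftrightarrow>
     (\<exists>f\<in>ses_hom R S S'. \<exists>g\<in>ses_hom R S' S.
        (\<forall>x\<in>carrier (ses_B S). g (f x) = x) \<and> (\<forall>y\<in>carrier (ses_B S'). f (g y) = y))"

definition ses_sum ::
    "'i set \<Rightarrow> ('i \<Rightarrow> ('r, 'a, 'b, 'c) ses) \<Rightarrow> ('r, 'i \<Rightarrow> 'a, 'i \<Rightarrow> 'b, 'i \<Rightarrow> 'c) ses" where
  "ses_sum I S =
     \<lparr>ses_A = rmod_sum I (\<lambda>i. ses_A (S i)),
      ses_B = rmod_sum I (\<lambda>i. ses_B (S i)),
      ses_C = rmod_sum I (\<lambda>i. ses_C (S i)),
      ses_alpha = (\<lambda>x. \<lambda>i\<in>I. ses_alpha (S i) (x i)),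
      ses_beta = (\<lambda>x. \<lambda>i\<in>I. ses_beta (S i) (x i))\<rparr>"

text \<open>
  The morphisms \<open>A \<rightarrow> A'\<close> and \<open>C \<rightarrow> C'\<close> induced by a morphism \<open>f\<close>. They are characterised by
  the commuting squares in \<open>lower_map_commutes\<close> and \<open>upper_map_commutes\<close> below; in particular
  the second one does not depend on the preimages chosen by \<^const>\<open>inv_into\<close>.
\<close>

definition lower_map ::
    "('r, 'a, 'b, 'c) ses \<Rightarrow> ('r, 'd, 'e, 'f) ses \<Rightarrow> ('b \<Rightarrow> 'e) \<Rightarrow> 'a \<Rightarrow> 'd" where
  "lower_map S S' f = (\<lambda>a. inv_into (carrier (ses_A S')) (ses_alpha S') (f (ses_alpha S a)))"

definition upper_map ::
    "('r, 'a, 'b, 'c) ses \<Rightarrow> ('r, 'd, 'e, 'f) ses \<Rightarrow> ('b \<Rightarrow> 'e) \<Rightarrow> 'c \<Rightarrow> 'f" where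
  "upper_map S S' f = (\<lambda>c. ses_beta S' (f (inv_into (carrier (ses_B S)) (ses_beta S) c)))"

datatype me_index = Idx_m | Idx_e
datatype lu_index = Idx_l | Idx_u

definition injsurj ::
    "me_index \<Rightarrow> ('r, 'm) rmodule \<Rightarrow> ('r, 'n) rmodule \<Rightarrow> ('m \<Rightarrow> 'n) \<Rightarrow> bool" where
  "injsurj a M N h \<longleftrightarrow>
     (case a of
        Idx_m \<Rightarrow> inj_on h (carrier M)
      | Idx_e \<Rightarrow> h ` carrier M = carrier N)"

definition induced_injsurj ::
    "me_index \<Rightarrow> lu_index \<Rightarrow> ('r, 'a, 'b, 'c) ses \<Rightarrow> ('r, 'd, 'e, 'f) ses \<Rightarrow> ('b \<Rightarrow> 'e) \<Rightarrow> bool" where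
  "induced_injsurj a b S S' f \<longleftrightarrow>
     (case b of
        Idx_l \<Rightarrow> injsurj a (ses_A S) (ses_A S') (lower_map S S' f)
      | Idx_u \<Rightarrow> injsurj a (ses_C S) (ses_C S') (upper_map S S' f))"

definition same_class ::
    "('r, 'q) ring_scheme \<Rightarrow> me_index \<Rightarrow> lu_index \<Rightarrow>
     ('r, 'a, 'b, 'c) ses \<Rightarrow> ('r, 'd, 'e, 'f) ses \<Rightarrow> bool" where
  "same_class R a b S S' \<longleftrightarrow>
     (\<exists>f\<in>ses_hom R S S'. \<exists>g\<in>ses_hom R S' S.
        induced_injsurj a b S S' f \<and> induced_injsurj a b S' S g)"

definition end_nonzero :: "lu_index \<Rightarrow> ('r, 'a, 'b, 'c) ses \<Rightarrow> bool" where
  "end_nonzero b S \<longleftrightarrow>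
     (case b of
        Idx_l \<Rightarrow> \<not> zero_module (ses_A S)
      | Idx_u \<Rightarrow> \<not> zero_module (ses_C S))"

lemma rmod_hom_closed: "f \<in> rmod_hom R M N \<Longrightarrow> x \<in> carrier M \<Longrightarrow> f x \<in> carrier N"
  by (auto simp: rmod_hom_def hom_def)

lemma rmod_hom_add:
  "f \<in> rmod_hom R M N \<Longrightarrow> x \<in> carrier M \<Longrightarrow> y \<in> carrier M \<Longrightarrow> f (x \<oplus>\<^bsub>M\<^esub> y) = f x \<oplus>\<^bsub>N\<^esub> f y"
  by (auto simp: rmod_hom_def hom_def)

lemma rmod_hom_rsmult:
  "f \<in> rmod_hom R M N \<Longrightarrow> x \<in> carrier M \<Longrightarrow> r \<in> carrier R \<Longrightarrow> f (x \<star>\<^bsub>M\<^esub> r) = f x \<star>\<^bsub>N\<^esub> r"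
  by (auto simp: rmod_hom_def)

lemma rmod_homI:
  assumes "\<And>x. x \<in> carrier M \<Longrightarrow> f x \<in> carrier N"
    and "\<And>x y. x \<in> carrier M \<Longrightarrow> y \<in> carrier M \<Longrightarrow> f (x \<oplus>\<^bsub>M\<^esub> y) = f x \<oplus>\<^bsub>N\<^esub> f y"
    and "\<And>x r. x \<in> carrier M \<Longrightarrow> r \<in> carrier R \<Longrightarrow> f (x \<star>\<^bsub>M\<^esub> r) = f x \<star>\<^bsub>N\<^esub> r"
  shows "f \<in> rmod_hom R M N"
  using assms by (auto simp: rmod_hom_def hom_def)

lemma rmod_hom_group_hom:
  assumes "right_module R M" "right_module R N" "f \<in> rmod_hom R M N"
  shows "abelian_group_hom M N f"
proof -
  interpret M: right_module R M by fact
  interpret N: right_module R N by fact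
  show ?thesis
    using assms(3) M.a_group N.a_group
    by (intro abelian_group_homI M.abelian_group_axioms N.abelian_group_axioms)
       (auto simp: rmod_hom_def group_hom_def group_hom_axioms_def)
qed

lemma lower_map_commutes:
  assumes "f \<in> ses_hom R S S'" "a \<in> carrier (ses_A S)"
  shows "lower_map S S' f a \<in> carrier (ses_A S')"
    and "ses_alpha S' (lower_map S S' f a) = f (ses_alpha S a)"
proof -
  have "f (ses_alpha S a) \<in> ses_alpha S' ` carrier (ses_A S')"
    using assms by (auto simp: ses_hom_def)
  then show "lower_map S S' f a \<in> carrier (ses_A S')"
    and "ses_alpha S' (lower_map S S' f a) = f (ses_alpha S a)"
    unfolding lower_map_def by (auto simp: inv_into_into f_inv_into_f)
qed

lemma upper_map_commutes:
  assumes S: "ses_obj R S" and S': "ses_obj R S'" and f: "f \<in> ses_hom R S S'"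
    and b: "b \<in> carrier (ses_B S)"
  shows "upper_map S S' f (ses_beta S b) = ses_beta S' (f b)"
proof -
  interpret B: right_module R "ses_B S" using S by (simp add: ses_obj_def)
  interpret B': right_module R "ses_B S'" using S' by (simp add: ses_obj_def)
  interpret C': right_module R "ses_C S'" using S' by (simp add: ses_obj_def)
  have fh: "f \<in> rmod_hom R (ses_B S) (ses_B S')"
    using f by (simp add: ses_hom_def)
  interpret F: abelian_group_hom "ses_B S" "ses_B S'" f
    using rmod_hom_group_hom S S' fh by (auto simp: ses_obj_def)
  interpret G: abelian_group_hom "ses_B S" "ses_C S" "ses_beta S"
    using rmod_hom_group_hom S by (auto simp: ses_obj_def)
  interpret G': abelian_group_hom "ses_B S'" "ses_C S'" "ses_beta S'"
    using rmod_hom_group_hom S' by (auto simp: ses_obj_def)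
  define d where "d = inv_into (carrier (ses_B S)) (ses_beta S) (ses_beta S b)"
  have d: "d \<in> carrier (ses_B S)" "ses_beta S d = ses_beta S b"
    using b by (auto simp: d_def inv_into_into f_inv_into_f)
  have "ses_beta S (d \<ominus>\<^bsub>ses_B S\<^esub> b) = \<zero>\<^bsub>ses_C S\<^esub>"
    using b d by (simp add: a_minus_def G.H.r_neg)
  then have "d \<ominus>\<^bsub>ses_B S\<^esub> b \<in> ses_alpha S ` carrier (ses_A S)"
    using S b d by (auto simp: ses_obj_def)
  then have "f (d \<ominus>\<^bsub>ses_B S\<^esub> b) \<in> ses_alpha S' ` carrier (ses_A S')"
    using f by (auto simp: ses_hom_def)
  then have "ses_beta S' (f (d \<ominus>\<^bsub>ses_B S\<^esub> b)) = \<zero>\<^bsub>ses_C S'\<^esub>"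
    using S' by (auto simp: ses_obj_def)
  then have "ses_beta S' (f d) \<ominus>\<^bsub>ses_C S'\<^esub> ses_beta S' (f b) = \<zero>\<^bsub>ses_C S'\<^esub>"
    using b d by (simp add: a_minus_def)
  then have "ses_beta S' (f d) = ses_beta S' (f b)"
    using b d by (metis C'.M.minus_equality C'.M.minus_minus C'.M.a_inv_closed a_minus_def
        F.hom_closed G'.hom_closed)
  then show ?thesis
    by (simp add: upper_map_def d_def)
qed

lemma right_module_rmod_sum:
  assumes "ring R" "\<And>i. i \<in> I \<Longrightarrow> right_module R (M i)"
  shows "right_module R (rmod_sum I M)"
proof -
  have ag: "abelian_group (M i)" if "i \<in> I" for i
    using assms(2)[OF that] by (simp add: right_module_def)
  have "abelian_group (rmod_sum I M)"
  proof (rule abelian_groupI)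
    fix x y z
    assume x: "x \<in> carrier (rmod_sum I M)" and y: "y \<in> carrier (rmod_sum I M)"
      and z: "z \<in> carrier (rmod_sum I M)"
    show "x \<oplus>\<^bsub>rmod_sum I M\<^esub> y \<oplus>\<^bsub>rmod_sum I M\<^esub> z = x \<oplus>\<^bsub>rmod_sum I M\<^esub> (y \<oplus>\<^bsub>rmod_sum I M\<^esub> z)"
      using x y z
      by (auto simp: rmod_sum_def PiE_iff abelian_group.axioms(1)[OF ag] abelian_monoid.a_assoc
               intro!: restrict_ext)
  next
    fix x y
    assume x: "x \<in> carrier (rmod_sum I M)" and y: "y \<in> carrier (rmod_sum I M)"
    show "x \<oplus>\<^bsub>rmod_sum I M\<^esub> y \<in> carrier (rmod_sum I M)"
      using x y
      by (auto simp: rmod_sum_def PiE_iff abelian_group.axioms(1)[OF ag] abelian_monoid.a_closed)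
    show "x \<oplus>\<^bsub>rmod_sum I M\<^esub> y = y \<oplus>\<^bsub>rmod_sum I M\<^esub> x"
      using x y
      by (auto simp: rmod_sum_def PiE_iff abelian_group.axioms(1)[OF ag] abelian_monoid.a_comm
               intro!: restrict_ext)
  next
    show "\<zero>\<^bsub>rmod_sum I M\<^esub> \<in> carrier (rmod_sum I M)"
      by (auto simp: rmod_sum_def abelian_group.axioms(1)[OF ag] abelian_monoid.zero_closed)
  next
    fix x assume x: "x \<in> carrier (rmod_sum I M)"
    show "\<zero>\<^bsub>rmod_sum I M\<^esub> \<oplus>\<^bsub>rmod_sum I M\<^esub> x = x"
      using x
      by (auto simp: rmod_sum_def PiE_iff abelian_group.axioms(1)[OF ag] abelian_monoid.l_zero
               extensional_def fun_eq_iff)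
    show "\<exists>y\<in>carrier (rmod_sum I M). y \<oplus>\<^bsub>rmod_sum I M\<^esub> x = \<zero>\<^bsub>rmod_sum I M\<^esub>"
      using x
      by (intro bexI[of _ "\<lambda>i\<in>I. \<ominus>\<^bsub>M i\<^esub> x i"])
         (auto simp: rmod_sum_def PiE_iff abelian_group.l_neg[OF ag]
               abelian_group.a_inv_closed[OF ag] intro!: restrict_ext)
  qed
  then show ?thesis
    using assms(1)
    by (intro right_module.intro right_module_axioms.intro)
       (auto simp: rmod_sum_def PiE_iff right_module.rsmult_closed[OF assms(2)]
             right_module.rsmult_l_distr[OF assms(2)] right_module.rsmult_r_distr[OF assms(2)]
             right_module.rsmult_assoc[OF assms(2)] right_module.rsmult_one[OF assms(2)]
             extensional_def fun_eq_iff)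
qed

lemma rmod_sum_hom:
  assumes "\<And>i. i \<in> I \<Longrightarrow> f i \<in> rmod_hom R (M i) (N i)"
  shows "(\<lambda>x. \<lambda>i\<in>I. f i (x i)) \<in> rmod_hom R (rmod_sum I M) (rmod_sum I N)"
  by (intro rmod_homI)
     (auto simp: rmod_sum_def PiE_iff rmod_hom_closed[OF assms] rmod_hom_add[OF assms]
           rmod_hom_rsmult[OF assms] intro!: restrict_ext)

lemma ses_obj_ses_sum:
  assumes R: "ring R" and S: "\<And>i. i \<in> I \<Longrightarrow> ses_obj R (S i)"
  shows "ses_obj R (ses_sum I S)"
proof -
  let ?A = "\<Pi>\<^sub>E i\<in>I. carrier (ses_A (S i))" and ?B = "\<Pi>\<^sub>E i\<in>I. carrier (ses_B (S i))"
    and ?C = "\<Pi>\<^sub>E i\<in>I. carrier (ses_C (S i))"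
  let ?al = "\<lambda>x. \<lambda>i\<in>I. ses_alpha (S i) (x i)" and ?be = "\<lambda>x. \<lambda>i\<in>I. ses_beta (S i) (x i)"
  have al: "ses_alpha (S i) \<in> rmod_hom R (ses_A (S i)) (ses_B (S i))"
    and be: "ses_beta (S i) \<in> rmod_hom R (ses_B (S i)) (ses_C (S i))"
    and inj: "inj_on (ses_alpha (S i)) (carrier (ses_A (S i)))"
    and ex: "ses_alpha (S i) ` carrier (ses_A (S i)) =
               {b \<in> carrier (ses_B (S i)). ses_beta (S i) b = \<zero>\<^bsub>ses_C (S i)\<^esub>}"
    and sur: "ses_beta (S i) ` carrier (ses_B (S i)) = carrier (ses_C (S i))"
    if "i \<in> I" for i
    using S[OF that] by (auto simp: ses_obj_def)
  have 1: "inj_on ?al ?A"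
  proof (rule inj_onI)
    fix x y assume x: "x \<in> ?A" and y: "y \<in> ?A" and eq: "?al x = ?al y"
    show "x = y"
    proof (rule PiE_ext[OF x y])
      fix i assume i: "i \<in> I"
      have "ses_alpha (S i) (x i) = ses_alpha (S i) (y i)"
        using fun_cong[OF eq, of i] i by simp
      then show "x i = y i"
        using inj_onD[OF inj[OF i]] PiE_mem[OF x i] PiE_mem[OF y i] by blast
    qed
  qed
  have 2: "?al ` ?A = {b \<in> ?B. ?be b = (\<lambda>i\<in>I. \<zero>\<^bsub>ses_C (S i)\<^esub>)}"
  proof (intro equalityI subsetI)
    fix b assume "b \<in> ?al ` ?A"
    then obtain x where x: "x \<in> ?A" "b = ?al x" by blast
    have "ses_alpha (S i) (x i) \<in> carrier (ses_B (S i)) \<and>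
          ses_beta (S i) (ses_alpha (S i) (x i)) = \<zero>\<^bsub>ses_C (S i)\<^esub>" if "i \<in> I" for i
      using ex[OF that] PiE_mem[OF x(1) that] by blast
    then show "b \<in> {b \<in> ?B. ?be b = (\<lambda>i\<in>I. \<zero>\<^bsub>ses_C (S i)\<^esub>)}"
      using x(2) by (auto intro!: restrict_ext)
  next
    fix b assume b: "b \<in> {b \<in> ?B. ?be b = (\<lambda>i\<in>I. \<zero>\<^bsub>ses_C (S i)\<^esub>)}"
    have "\<exists>a. a \<in> carrier (ses_A (S i)) \<and> b i = ses_alpha (S i) a" if i: "i \<in> I" for i
    proof -
      have "?be b i = \<zero>\<^bsub>ses_C (S i)\<^esub>" using b i by simp
      then have "b i \<in> {b \<in> carrier (ses_B (S i)). ses_beta (S i) b = \<zero>\<^bsub>ses_C (S i)\<^esub>}"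
        using b i by auto
      then show ?thesis using ex[OF i] by blast
    qed
    then obtain a where a: "\<And>i. i \<in> I \<Longrightarrow> a i \<in> carrier (ses_A (S i)) \<and> b i = ses_alpha (S i) (a i)"
      by metis
    have "b = ?al (\<lambda>i\<in>I. a i)"
      using a b by (auto simp: PiE_iff extensional_def fun_eq_iff)
    moreover have "(\<lambda>i\<in>I. a i) \<in> ?A" using a by auto
    ultimately show "b \<in> ?al ` ?A" by blast
  qed
  have 3: "?be ` ?B = ?C"
  proof (intro equalityI subsetI)
    fix c assume "c \<in> ?be ` ?B"
    then show "c \<in> ?C" using be by (fastforce dest: rmod_hom_closed)
  next
    fix c assume c: "c \<in> ?C"
    have "\<exists>b. b \<in> carrier (ses_B (S i)) \<and> c i = ses_beta (S i) b" if i: "i \<in> I" for i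
      using sur[OF i] PiE_mem[OF c i] by blast
    then obtain b where b: "\<And>i. i \<in> I \<Longrightarrow> b i \<in> carrier (ses_B (S i)) \<and> c i = ses_beta (S i) (b i)"
      by metis
    have "c = ?be (\<lambda>i\<in>I. b i)"
      using b c by (auto simp: PiE_iff extensional_def fun_eq_iff)
    moreover have "(\<lambda>i\<in>I. b i) \<in> ?B" using b by auto
    ultimately show "c \<in> ?be ` ?B" by blast
  qed
  have "right_module R (rmod_sum I (\<lambda>i. ses_A (S i)))"
       "right_module R (rmod_sum I (\<lambda>i. ses_B (S i)))"
       "right_module R (rmod_sum I (\<lambda>i. ses_C (S i)))"
    using R S by (auto intro!: right_module_rmod_sum simp: ses_obj_def)
  moreover have "?al \<in> rmod_hom R (rmod_sum I (\<lambda>i. ses_A (S i))) (rmod_sum I (\<lambda>i. ses_B (S i)))"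
    using al by (rule rmod_sum_hom)
  moreover have "?be \<in> rmod_hom R (rmod_sum I (\<lambda>i. ses_B (S i))) (rmod_sum I (\<lambda>i. ses_C (S i)))"
    using be by (rule rmod_sum_hom)
  ultimately show ?thesis
    using 1 2 3 by (simp add: ses_obj_def ses_sum_def rmod_sum_def)
qed

end

theory Submission
  imports Defs
begin

text \<open>
  Both sums are placed inside one filtered module \<open>F \<subseteq> Z\<close> with projections onto the given objects.
  For each of the four types, the entries of endomorphisms that are not injective (surjective) on the
  lower (upper) factor form a completely prime ideal, because the factors are uniserial; and an
  endomorphism of one object outside all four ideals is an automorphism, by the five lemma.

  From an isomorphism \<open>f\<close> with inverse \<open>g\<close>, restrict to the objects of one class of one type: there
  \<open>g f\<close> differs from the identity by a matrix all of whose entries lie in the ideal, and a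
  dimension count in the modular lattice of submodules (or its dual) shows that the class
  is at least as large on the other side.

  Conversely, call a type at an object maximal if its ideal of endomorphisms is maximal among the
  four.  The given bijections combine to an involution on the objects for every type, and one can
  glue an endomorphism \<open>h\<close> of \<open>Z\<close> whose entries avoid the ideals of the maximal types
  exactly along these involutions. Then \<open>h\<^sup>2\<close> is invertible on the diagonal and in the radical
  off it, hence invertible.
\<close>

section \<open>Modular lattices\<close>

text \<open>The glued matrix follows, at each maximal type, the partner belonging to that type.
  Involutions are used because \<open>h\<close> itself exchanges the two sides, whereas at every
  maximal type its square leads back to the starting object. Two obstacles shape this. The second
  factor of the square is under control only if maximality of a type belongs to the class and not to
  the single object (\<open>top_transfer\<close>). And types with the same ideal at an object may
  come with different partners, only one of which can be followed (\<open>ex_matrix_along\<close>).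
  In the forward direction there is no composition length to count with; what remains is that a
  uniserial module has uniform dimension at most one, for injectivity, and dual uniform dimension at
  most one, for surjectivity.\<close>

locale modular_lattice =
  fixes L :: "'l set" and le :: "'l \<Rightarrow> 'l \<Rightarrow> bool"
    and meet join :: "'l \<Rightarrow> 'l \<Rightarrow> 'l" and bot :: 'l
  assumes refl: "a \<in> L \<Longrightarrow> le a a"
    and trans: "\<lbrakk>le a b; le b c; a \<in> L; b \<in> L; c \<in> L\<rbrakk> \<Longrightarrow> le a c"
    and antisym: "\<lbrakk>le a b; le b a; a \<in> L; b \<in> L\<rbrakk> \<Longrightarrow> a = b"
    and meet_closed: "\<lbrakk>a \<in> L; b \<in> L\<rbrakk> \<Longrightarrow> meet a b \<in> L"
    and join_closed: "\<lbrakk>a \<in> L; b \<in> L\<rbrakk> \<Longrightarrow> join a b \<in> L"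
    and meet_le1: "\<lbrakk>a \<in> L; b \<in> L\<rbrakk> \<Longrightarrow> le (meet a b) a"
    and meet_le2: "\<lbrakk>a \<in> L; b \<in> L\<rbrakk> \<Longrightarrow> le (meet a b) b"
    and meet_greatest: "\<lbrakk>le c a; le c b; a \<in> L; b \<in> L; c \<in> L\<rbrakk> \<Longrightarrow> le c (meet a b)"
    and join_ge1: "\<lbrakk>a \<in> L; b \<in> L\<rbrakk> \<Longrightarrow> le a (join a b)"
    and join_ge2: "\<lbrakk>a \<in> L; b \<in> L\<rbrakk> \<Longrightarrow> le b (join a b)"
    and join_least: "\<lbrakk>le a c; le b c; a \<in> L; b \<in> L; c \<in> L\<rbrakk> \<Longrightarrow> le (join a b) c"
    and bot_closed: "bot \<in> L"
    and bot_least: "a \<in> L \<Longrightarrow> le bot a"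
    and modular: "\<lbrakk>le a c; a \<in> L; b \<in> L; c \<in> L\<rbrakk> \<Longrightarrow> le (meet (join a b) c) (join a (meet b c))"
begin

lemma le_bot: "\<lbrakk>le a bot; a \<in> L\<rbrakk> \<Longrightarrow> a = bot"
  using antisym bot_closed bot_least by blast

lemma meet_mono:
  "\<lbrakk>le a c; le b d; a \<in> L; b \<in> L; c \<in> L; d \<in> L\<rbrakk> \<Longrightarrow> le (meet a b) (meet c d)"
  by (meson meet_closed meet_greatest meet_le1 meet_le2 trans)

lemma meet_meet_distrib:
  assumes "a \<in> L" "b \<in> L" "X \<in> L"
  shows "meet (meet a X) (meet b X) = meet (meet a b) X"
  using assms by (intro antisym) (meson meet_closed meet_greatest meet_le1 meet_le2 trans)+

text \<open>The model is the sum of those members of an independent family that are indexed by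
  \<open>T\<close>. Only meets are axiomatised: cutting the whole family with a fixed element
  respects these conditions apart from nontriviality, whereas it would in general destroy any
  formula for joins.\<close>

definition independent :: "('i set \<Rightarrow> 'l) \<Rightarrow> 'i set \<Rightarrow> bool" where
  "independent J S \<longleftrightarrow>
     (\<forall>T\<subseteq>S. J T \<in> L) \<and>
     (\<forall>T\<subseteq>S. \<forall>U\<subseteq>S. meet (J T) (J U) = J (T \<inter> U)) \<and>
     J {} = bot \<and> (\<forall>i\<in>S. J {i} \<noteq> bot)"

lemma independentD:
  assumes "independent J S"
  shows "T \<subseteq> S \<Longrightarrow> J T \<in> L"
    and "T \<subseteq> S \<Longrightarrow> U \<subseteq> S \<Longrightarrow> meet (J T) (J U) = J (T \<inter> U)"
    and "J {} = bot"
    and "i \<in> S \<Longrightarrow> J {i} \<noteq> bot"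
  using assms by (auto simp: independent_def)

lemma independent_mono:
  assumes J: "independent J S" and "T \<subseteq> U" "U \<subseteq> S"
  shows "le (J T) (J U)"
proof -
  have "T \<subseteq> S" "T \<inter> U = T" using assms by auto
  then have "meet (J T) (J U) = J T"
    using independentD(2)[OF J, of T U] assms by simp
  then show ?thesis
    using meet_le2[of "J T" "J U"] independentD(1)[OF J] assms \<open>T \<subseteq> S\<close> by simp
qed

lemma chain_maximal:
  assumes "finite A" "A \<noteq> {}" "\<And>i. i \<in> A \<Longrightarrow> f i \<in> L"
    and "\<And>i j. i \<in> A \<Longrightarrow> j \<in> A \<Longrightarrow> le (f i) (f j) \<or> le (f j) (f i)"
  shows "\<exists>i\<in>A. \<forall>j\<in>A. le (f j) (f i)"
  using assms
proof (induction rule: finite_ne_induct)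
  case (singleton x)
  then show ?case using refl by auto
next
  case (insert x A)
  then obtain i where i: "i \<in> A" "\<forall>j\<in>A. le (f j) (f i)" by blast
  consider "le (f x) (f i)" | "le (f i) (f x)" using insert.prems(2) i by blast
  then show ?case
  proof cases
    case 1
    then show ?thesis using i by blast
  next
    case 2
    then have "\<forall>j\<in>A. le (f j) (f x)"
      using i insert.prems(1) trans by (meson insertCI)
    then show ?thesis using refl insert.prems(1) by blast
  qed
qed

text \<open>
  One step of Gaussian elimination: the pivot \<open>i\<close> is chosen so that \<open>J {i}\<close> meets \<open>X\<close> trivially and
  covers as much as possible modulo \<open>X\<close>; each other \<open>J {k}\<close> is replaced by its part inside \<open>X\<close>
  modulo \<open>J {i}\<close>.
\<close>

lemma independent_step:
  assumes J: "independent J S" and S: "finite S" "S \<noteq> {}" and X: "X \<in> L"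
    and chain: "\<And>a b. \<lbrakk>a \<in> L; b \<in> L; le X a; le X b\<rbrakk> \<Longrightarrow> le a b \<or> le b a"
  shows "\<exists>i\<in>S. \<exists>J'. independent J' (S - {i}) \<and> le (J' (S - {i})) (meet (J S) X)"
proof (cases "\<exists>i\<in>S. meet (J {i}) X = bot")
  case False
  \<comment> \<open>Every \<open>J {k}\<close> meets \<open>X\<close> nontrivially, so cutting with
    \<open>X\<close> keeps all members nonzero and an arbitrary index can be given up.\<close>
  obtain i where i: "i \<in> S" using S by blast
  define J' where "J' = (\<lambda>T. meet (J T) X)"
  have "independent J' (S - {i})"
    unfolding independent_def
  proof (intro conjI allI impI ballI)
    fix T assume "T \<subseteq> S - {i}"
    then have "J T \<in> L" by (intro independentD(1)[OF J]) auto
    then show "J' T \<in> L" using X by (auto simp: J'_def intro!: meet_closed)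
  next
    fix T U assume "T \<subseteq> S - {i}" "U \<subseteq> S - {i}"
    then have "T \<subseteq> S" "U \<subseteq> S" by auto
    then show "meet (J' T) (J' U) = J' (T \<inter> U)"
      using meet_meet_distrib X independentD[OF J] by (simp add: J'_def)
  next
    show "J' {} = bot"
      using independentD(3)[OF J] X by (simp add: J'_def bot_closed le_bot meet_closed meet_le1)
  next
    fix k assume "k \<in> S - {i}"
    then show "J' {k} \<noteq> bot" using False by (auto simp: J'_def)
  qed
  moreover have "le (J' (S - {i})) (meet (J S) X)"
    unfolding J'_def using J X
    by (intro meet_mono independent_mono[OF J]) (auto simp: refl independentD(1)[OF J])
  ultimately show ?thesis using i by blast
next
  case True
  define A where "A = {i \<in> S. meet (J {i}) X = bot}"
  have JL: "J T \<in> L" if "T \<subseteq> S" for T using J that by (rule independentD)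
  have "\<exists>i\<in>A. \<forall>j\<in>A. le (join (J {j}) X) (join (J {i}) X)"
  proof (rule chain_maximal)
    show "finite A" "A \<noteq> {}" using S True by (auto simp: A_def)
    show "join (J {i}) X \<in> L" if "i \<in> A" for i
      using that X JL by (auto simp: A_def intro!: join_closed)
    show "le (join (J {i}) X) (join (J {j}) X) \<or> le (join (J {j}) X) (join (J {i}) X)"
      if "i \<in> A" "j \<in> A" for i j
      using that X JL by (intro chain) (auto simp: A_def intro!: join_closed join_ge2)
  qed
  then obtain i where i: "i \<in> S" "meet (J {i}) X = bot"
    and mx: "\<And>j. \<lbrakk>j \<in> S; meet (J {j}) X = bot\<rbrakk> \<Longrightarrow> le (join (J {j}) X) (join (J {i}) X)"
    by (auto simp: A_def)
  \<comment> \<open>Adjoining \<open>i\<close> before cutting leaves room to clear the part of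
    \<open>J {k}\<close> outside \<open>X\<close>; the value at \<open>{}\<close> is
    \<open>bot\<close> because the pivot meets \<open>X\<close> trivially.\<close>
  define J' where "J' = (\<lambda>T. meet (J (insert i T)) X)"
  have "independent J' (S - {i})"
    unfolding independent_def
  proof (intro conjI allI impI ballI)
    fix T assume "T \<subseteq> S - {i}"
    then have "J (insert i T) \<in> L" using i by (intro JL) auto
    then show "J' T \<in> L" using X by (auto simp: J'_def intro!: meet_closed)
  next
    fix T U assume "T \<subseteq> S - {i}" "U \<subseteq> S - {i}"
    then have "insert i T \<subseteq> S" "insert i U \<subseteq> S" "insert i T \<inter> insert i U = insert i (T \<inter> U)"
      using i by auto
    then show "meet (J' T) (J' U) = J' (T \<inter> U)"
      using meet_meet_distrib[OF JL JL X, of "insert i T" "insert i U"]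
        independentD(2)[OF J, of "insert i T" "insert i U"]
      by (simp add: J'_def)
  next
    show "J' {} = bot" using i by (simp add: J'_def)
  next
    fix k assume k: "k \<in> S - {i}"
    show "J' {k} \<noteq> bot"
    proof
      \<comment> \<open>If nothing of \<open>J {i,k}\<close> lay in \<open>X\<close>, then
        \<open>J {k}\<close> would meet \<open>X\<close> trivially, and by the choice of
        \<open>i\<close> it would lie in \<open>join (J {i}) X\<close>. The modular law inside
        \<open>J {i,k}\<close> pushes it into \<open>J {i}\<close>, against independence.\<close>
      assume 0: "J' {k} = bot"
      have L: "J {k} \<in> L" "J {i} \<in> L" "J {i,k} \<in> L" using JL k i by auto
      have sub: "le (J {k}) (J {i,k})" "le (J {i}) (J {i,k})"
        using independent_mono[OF J] k i by auto
      have "le (meet (J {k}) X) (J' {k})"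
        unfolding J'_def using L X by (intro meet_mono sub) (auto simp: refl)
      then have "meet (J {k}) X = bot" using 0 L X le_bot meet_closed by simp
      then have "le (join (J {k}) X) (join (J {i}) X)" using mx k by simp
      then have "le (J {k}) (join (J {i}) X)"
        using L X join_ge1 join_closed trans by meson
      then have "le (J {k}) (meet (join (J {i}) X) (J {i,k}))"
        using L X sub by (intro meet_greatest join_closed) auto
      moreover have "le (meet (join (J {i}) X) (J {i,k})) (join (J {i}) (meet X (J {i,k})))"
        using L X sub by (intro modular) auto
      moreover have "meet X (J {i,k}) = bot"
      proof -
        have "le (meet X (J {i,k})) (J' {k})"
          unfolding J'_def using L X by (intro meet_greatest meet_le1 meet_le2 meet_closed) auto
        then show ?thesis using 0 L X le_bot meet_closed by simp
      qed
      moreover have "le (join (J {i}) bot) (J {i})"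
        using L by (intro join_least) (auto simp: refl bot_least bot_closed)
      ultimately have "le (J {k}) (J {i})"
        using L X by (metis bot_closed join_closed meet_closed trans)
      then have "le (J {k}) (meet (J {k}) (J {i}))"
        using L by (intro meet_greatest) (auto simp: refl)
      moreover have "meet (J {k}) (J {i}) = J ({k} \<inter> {i})"
        using k i by (intro independentD(2)[OF J]) auto
      moreover have "J ({k} \<inter> {i}) = bot" using k independentD(3)[OF J] by auto
      ultimately have "J {k} = bot" using L le_bot by simp
      then show False using independentD(4)[OF J] k by blast
    qed
  qed
  moreover have "le (J' (S - {i})) (meet (J S) X)"
    unfolding J'_def using X i JL[of S]
    by (simp add: insert_absorb refl meet_closed)
  ultimately show ?thesis using i by blast
qed

text \<open>Uniform dimension is bounded by the number of coordinates. One may think of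
  \<open>M T\<close> as the elements whose coordinates in \<open>T\<close> vanish and of
  \<open>X j\<close> as the kernel of coordinate \<open>j\<close>. The chain above
  \<open>X j\<close> says that this coordinate takes values in a uniserial module, so imposing its
  vanishing costs at most one member of the family, by \<open>independent_step\<close>. When all
  coordinates vanish nothing is left.\<close>

lemma card_independent_le:
  assumes "finite K" "finite S" "independent J S"
    and "\<And>T. T \<subseteq> K \<Longrightarrow> M T \<in> L" and "\<And>j. j \<in> K \<Longrightarrow> X j \<in> L"
    and "\<And>j a b. \<lbrakk>j \<in> K; a \<in> L; b \<in> L; le (X j) a; le (X j) b\<rbrakk> \<Longrightarrow> le a b \<or> le b a"
    and "\<And>j T. \<lbrakk>j \<in> K; T \<subseteq> K\<rbrakk> \<Longrightarrow> le (meet (M T) (X j)) (M (insert j T))"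
    and "le (J S) (M {})" and "meet (J S) (M K) = bot"
  shows "card S \<le> card K"
  using assms
proof (induction K arbitrary: S J rule: finite_induct)
  case empty
  have JL: "J S \<in> L" using empty.prems(2) by (auto dest: independentD(1))
  then have "le (J S) (meet (J S) (M {}))"
    using empty.prems by (intro meet_greatest) (auto simp: refl)
  then have "J S = bot" using empty.prems(8) JL le_bot by simp
  have "S = {}"
  proof (rule ccontr)
    assume "S \<noteq> {}"
    then obtain i where i: "i \<in> S" by blast
    then have "le (J {i}) bot"
      using independent_mono[OF empty.prems(2), of "{i}" S] \<open>J S = bot\<close> by simp
    then show False
      using independentD(1,4)[OF empty.prems(2)] i le_bot by (metis empty_subsetI insert_subset)
  qed
  then show ?case by simp
next
  case (insert k K)
  show ?case
  proof (cases "S = {}")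
    case False
    have Xk: "X k \<in> L" using insert.prems by simp
    have JL: "J S \<in> L" using insert.prems(2) by (auto dest: independentD(1))
    obtain i J' where i: "i \<in> S" and J': "independent J' (S - {i})"
      and le: "le (J' (S - {i})) (meet (J S) (X k))"
      using independent_step[OF insert.prems(2,1) False Xk insert.prems(5)[of k]] by blast
    have J'L: "J' (S - {i}) \<in> L" using J' by (auto dest: independentD(1))
    have MK: "M K \<in> L" "M {} \<in> L" "M (insert k K) \<in> L" using insert.prems(3) by auto
    have mL: "meet (J S) (X k) \<in> L" using JL Xk by (rule meet_closed)
    have a: "le (J' (S - {i})) (M {})"
      using le insert.prems(7) meet_le1[OF JL Xk] mL JL J'L MK trans by meson
    have "le (meet (J' (S - {i})) (M K)) (meet (meet (J S) (X k)) (M K))"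
      using le mL J'L MK refl by (intro meet_mono) auto
    moreover have "le (meet (meet (J S) (X k)) (M K)) (meet (J S) (M (insert k K)))"
    proof (intro meet_greatest)
      show "le (meet (meet (J S) (X k)) (M K)) (J S)"
        using mL MK JL Xk meet_le1 trans meet_closed by meson
      have "le (meet (meet (J S) (X k)) (M K)) (meet (M K) (X k))"
        using mL MK JL Xk meet_le1 meet_le2 meet_greatest trans meet_closed by meson
      moreover have "le (meet (M K) (X k)) (M (insert k K))" using insert.prems(6) by auto
      ultimately show "le (meet (meet (J S) (X k)) (M K)) (M (insert k K))"
        using mL MK Xk trans meet_closed by meson
    qed (use mL MK JL meet_closed in auto)
    ultimately have "le (meet (J' (S - {i})) (M K)) bot"
      using insert.prems(8) mL MK JL J'L meet_closed trans by metis
    then have b: "meet (J' (S - {i})) (M K) = bot"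
      using le_bot J'L MK meet_closed by simp
    have "card (S - {i}) \<le> card K"
    proof (rule insert.IH[OF _ J' _ _ _ _ a b])
      show "\<And>j a b. \<lbrakk>j \<in> K; a \<in> L; b \<in> L; le (X j) a; le (X j) b\<rbrakk> \<Longrightarrow> le a b \<or> le b a"
        by (rule insert.prems(5)) auto
      show "\<And>j T. \<lbrakk>j \<in> K; T \<subseteq> K\<rbrakk> \<Longrightarrow> le (meet (M T) (X j)) (M (insert j T))"
        by (rule insert.prems(6)) auto
      show "M T \<in> L" if "T \<subseteq> K" for T using that by (intro insert.prems(3)) auto
    qed (use insert.prems in auto)
    then show ?thesis using i insert.prems(1) insert.hyps by simp
  qed simp
qed

end

section \<open>Completely prime ideals of endomorphisms\<close>

locale orthogonal_idempotents = ring E for E (structure) +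
  fixes e :: "'x set \<Rightarrow> 'e" and X :: "'x set"
  assumes finite_X: "finite X"
    and e_closed [simp, intro]: "e S \<in> carrier E"
    and e_mult: "e S \<otimes> e T = e (S \<inter> T)"
    and e_union: "S \<inter> T = {} \<Longrightarrow> e (S \<union> T) = e S \<oplus> e T"
    and e_X: "e X = \<one>"
begin

lemma e_empty: "e {} = \<zero>"
  using e_union[of "{}" "{}"] by (simp add: add.r_cancel_one')

lemma e_mult_left: "r \<in> carrier E \<Longrightarrow> e S \<otimes> (e T \<otimes> r) = e (S \<inter> T) \<otimes> r"
  using m_assoc[of "e S" "e T" r] by (simp add: e_mult)

text \<open>The matrix is assembled by adding one entry at a time; orthogonality keeps the new
  summand away from all other positions.\<close>

lemma matrix_entries:
  assumes H: "\<And>x y. x \<in> X \<Longrightarrow> y \<in> X \<Longrightarrow> H x y \<in> carrier E"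
  shows "\<exists>h\<in>carrier E. \<forall>x\<in>X. \<forall>y\<in>X. e {y} \<otimes> (h \<otimes> e {x}) = e {y} \<otimes> (H x y \<otimes> e {x})"
proof -
  have "\<exists>h\<in>carrier E. \<forall>x\<in>X. \<forall>y\<in>X. e {y} \<otimes> (h \<otimes> e {x}) =
      (if (x, y) \<in> W then e {y} \<otimes> (H x y \<otimes> e {x}) else \<zero>)"
    if "finite W" "W \<subseteq> X \<times> X" for W
    using that
  proof (induction W rule: finite_induct)
    case empty
    show ?case by (intro bexI[of _ \<zero>]) auto
  next
    case (insert p W)
    obtain x0 y0 where p: "p = (x0, y0)" and xy: "x0 \<in> X" "y0 \<in> X"
      using insert.prems by auto
    obtain h where h: "h \<in> carrier E"
      and hW: "\<And>x y. \<lbrakk>x \<in> X; y \<in> X\<rbrakk> \<Longrightarrow> e {y} \<otimes> (h \<otimes> e {x}) =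
        (if (x, y) \<in> W then e {y} \<otimes> (H x y \<otimes> e {x}) else \<zero>)"
      using insert by auto
    define k where "k = h \<oplus> e {y0} \<otimes> (H x0 y0 \<otimes> e {x0})"
    have "e {y} \<otimes> (k \<otimes> e {x}) = (if (x, y) \<in> insert p W then e {y} \<otimes> (H x y \<otimes> e {x}) else \<zero>)"
      if "x \<in> X" "y \<in> X" for x y
    proof -
      have "e {y} \<otimes> (k \<otimes> e {x}) = e {y} \<otimes> (h \<otimes> e {x}) \<oplus>
          (e {y} \<otimes> e {y0}) \<otimes> (H x0 y0 \<otimes> (e {x0} \<otimes> e {x}))"
        using h H[OF xy] by (simp add: k_def l_distr r_distr m_assoc)
      also have "(e {y} \<otimes> e {y0}) \<otimes> (H x0 y0 \<otimes> (e {x0} \<otimes> e {x})) =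
          (if (x, y) = p then e {y} \<otimes> (H x y \<otimes> e {x}) else \<zero>)"
        using H[OF xy] by (auto simp: e_mult e_empty p)
      finally show ?thesis
        using hW[OF that] insert.hyps H[OF that] p by auto
    qed
    moreover have "k \<in> carrier E" using h H[OF xy] by (simp add: k_def)
    ultimately show ?case by blast
  qed
  from this[of "X \<times> X"] finite_X show ?thesis by auto
qed

end

text \<open>
  An element \<open>r\<close> of \<open>E\<close> is read as a matrix with entries \<open>e {y} \<otimes> r \<otimes> e {x}\<close>, viewed as maps from
  \<open>x\<close> to \<open>y\<close>, and \<open>good t x y r\<close> says that this entry is good for the type \<open>t\<close>.  The axioms say that
  the bad endomorphisms of each type form a completely prime ideal, and that together these ideals
  contain all non-units.
\<close>

locale good_maps = orthogonal_idempotents E e X for E (structure) and e :: "'x set \<Rightarrow> 'e" and X +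
  fixes supp :: "'t \<Rightarrow> 'x \<Rightarrow> bool" and good :: "'t \<Rightarrow> 'x \<Rightarrow> 'x \<Rightarrow> 'e \<Rightarrow> bool"
  assumes finite_types: "finite (UNIV :: 't set)"
    and good_supp: "good t x y r \<Longrightarrow> supp t x \<and> supp t y"
    and good_entry: "\<lbrakk>r \<in> carrier E; x \<in> X; y \<in> X\<rbrakk> \<Longrightarrow>
      good t x y (e {y} \<otimes> (r \<otimes> e {x})) \<longleftrightarrow> good t x y r"
    and good_add: "\<lbrakk>good t x y (r \<oplus> s); r \<in> carrier E; s \<in> carrier E; x \<in> X; y \<in> X\<rbrakk> \<Longrightarrow>
      good t x y r \<or> good t x y s"
    and good_mult: "\<lbrakk>r \<in> carrier E; s \<in> carrier E; x \<in> X; y \<in> X; z \<in> X\<rbrakk> \<Longrightarrow>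
      good t x z (s \<otimes> (e {y} \<otimes> r)) \<longleftrightarrow> good t x y r \<and> good t y z s"
    and good_zero: "\<lbrakk>x \<in> X; y \<in> X\<rbrakk> \<Longrightarrow> \<not> good t x y \<zero>"
    and good_one: "\<lbrakk>supp t x; x \<in> X\<rbrakk> \<Longrightarrow> good t x x \<one>"
    and good_unit: "\<lbrakk>r \<in> carrier E; x \<in> X; \<And>t. supp t x \<Longrightarrow> good t x x r\<rbrakk> \<Longrightarrow>
      \<exists>u\<in>carrier E. e {x} \<otimes> (u \<otimes> e {x}) = u \<and> u \<otimes> (r \<otimes> e {x}) = e {x}"
begin

text \<open>Negation is multiplication by \<open>\<ominus> \<one>\<close> through the object
  \<open>y\<close>, and a good product has good factors.\<close>

lemma good_neg:
  assumes "r \<in> carrier E" "x \<in> X" "y \<in> X" "good t x y (\<ominus> r)"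
  shows "good t x y r"
proof -
  have "good t x y (e {y} \<otimes> (\<ominus> r \<otimes> e {x}))" using assms by (simp add: good_entry)
  also have "e {y} \<otimes> (\<ominus> r \<otimes> e {x}) = \<ominus> \<one> \<otimes> (e {y} \<otimes> (r \<otimes> e {x}))"
    using assms by (simp add: l_minus r_minus)
  finally have "good t x y (r \<otimes> e {x})"
    using assms good_mult[of "r \<otimes> e {x}" "\<ominus> \<one>" x y y t] by simp
  then have "good t x y (e {y} \<otimes> ((r \<otimes> e {x}) \<otimes> e {x}))"
    using assms by (simp add: good_entry)
  then show ?thesis using assms by (simp add: m_assoc e_mult good_entry)
qed

lemma good_neg_iff: "\<lbrakk>r \<in> carrier E; x \<in> X; y \<in> X\<rbrakk> \<Longrightarrow> good t x y (\<ominus> r) \<longleftrightarrow> good t x y r"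
  using good_neg[of r x y t] good_neg[of "\<ominus> r" x y t] by auto

text \<open>Subtracting the bad summand again recovers \<open>r\<close>, so goodness is neither
  gained nor lost.\<close>

lemma good_add_iff:
  assumes "r \<in> carrier E" "s \<in> carrier E" "x \<in> X" "y \<in> X" "\<not> good t x y s"
  shows "good t x y (r \<oplus> s) \<longleftrightarrow> good t x y r"
proof
  assume "good t x y r"
  moreover have "r = (r \<oplus> s) \<oplus> \<ominus> s" using assms by (simp add: a_assoc r_neg)
  ultimately show "good t x y (r \<oplus> s)"
    using good_add[of t x y "r \<oplus> s" "\<ominus> s"] assms good_neg_iff[of s x y t] by auto
qed (use good_add assms in blast)

lemma good_minus_iff:
  assumes "r \<in> carrier E" "s \<in> carrier E" "x \<in> X" "y \<in> X" "\<not> good t x y s"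
  shows "good t x y (r \<ominus> s) \<longleftrightarrow> good t x y r"
  unfolding a_minus_def using assms by (intro good_add_iff) (auto simp: good_neg_iff)

text \<open>A product passing through the block \<open>S\<close> is the sum of the products through
  its single objects, and a good sum has a good summand. Hence a good composite always follows a
  path of two good entries.\<close>

lemma good_mult_ex:
  assumes "r \<in> carrier E" "s \<in> carrier E" "x \<in> X" "z \<in> X" "S \<subseteq> X"
    and "good t x z (s \<otimes> (e S \<otimes> r))"
  shows "\<exists>y\<in>S. good t x y r \<and> good t y z s"
proof -
  have "finite S" using assms(5) finite_X by (rule finite_subset)
  then show ?thesis
    using assms(5,6)
  proof (induction S rule: finite_induct)
    case empty
    then show ?case using assms(1-4) good_zero by (simp add: e_empty)
  next
    case (insert y S)
    have "e (insert y S) = e {y} \<oplus> e S" using e_union[of "{y}" S] insert.hyps by simp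
    then have "good t x z (s \<otimes> (e {y} \<otimes> r) \<oplus> s \<otimes> (e S \<otimes> r))"
      using insert.prems assms by (simp add: l_distr r_distr)
    then have "good t x z (s \<otimes> (e {y} \<otimes> r)) \<or> good t x z (s \<otimes> (e S \<otimes> r))"
      by (rule good_add) (use assms in auto)
    then show ?case
      using insert good_mult assms(1-4) by auto
  qed
qed

lemma good_mult_unique:
  assumes "r \<in> carrier E" "s \<in> carrier E" "x \<in> X" "y \<in> X" "z \<in> X"
    and "\<And>y'. \<lbrakk>y' \<in> X; y' \<noteq> y\<rbrakk> \<Longrightarrow> \<not> (good t x y' r \<and> good t y' z s)"
  shows "good t x z (s \<otimes> r) \<longleftrightarrow> good t x y r \<and> good t y z s"
proof -
  have "e X = e {y} \<oplus> e (X - {y})"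
    using e_union[of "{y}" "X - {y}"] assms(4) by (simp add: insert_absorb)
  moreover have "s \<otimes> r = s \<otimes> (e X \<otimes> r)" using assms by (simp add: e_X)
  ultimately have "s \<otimes> r = s \<otimes> ((e {y} \<oplus> e (X - {y})) \<otimes> r)" by (simp only:)
  then have "s \<otimes> r = s \<otimes> (e {y} \<otimes> r) \<oplus> s \<otimes> (e (X - {y}) \<otimes> r)"
    using assms by (simp add: l_distr r_distr)
  moreover have "\<not> good t x z (s \<otimes> (e (X - {y}) \<otimes> r))"
    using good_mult_ex[of r s x z "X - {y}" t] assms by auto
  ultimately show ?thesis
    using good_add_iff[of "s \<otimes> (e {y} \<otimes> r)" "s \<otimes> (e (X - {y}) \<otimes> r)" x z t] good_mult assms by simp
qed

section \<open>Classes of objects for one type, and comparison of the ideals of the types at one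
  object\<close>

definition sim :: "'t \<Rightarrow> 'x \<Rightarrow> 'x \<Rightarrow> bool" where
  "sim t x y \<longleftrightarrow> (\<exists>r\<in>carrier E. \<exists>s\<in>carrier E. good t x y r \<and> good t y x s)"

lemma sim_sym: "sim t x y \<Longrightarrow> sim t y x"
  unfolding sim_def by blast

lemma sim_refl: "\<lbrakk>supp t x; x \<in> X\<rbrakk> \<Longrightarrow> sim t x x"
  unfolding sim_def using good_one by blast

lemma sim_supp: "sim t x y \<Longrightarrow> supp t x \<and> supp t y"
  unfolding sim_def using good_supp by blast

lemma good_comp:
  assumes "good t x y r" "good t y z s" "r \<in> carrier E" "s \<in> carrier E" "x \<in> X" "y \<in> X" "z \<in> X"
  shows "\<exists>q\<in>carrier E. good t x z q"
  using assms good_mult by (intro bexI[of _ "s \<otimes> (e {y} \<otimes> r)"]) auto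

lemma sim_trans: "\<lbrakk>sim t x y; sim t y z; x \<in> X; y \<in> X; z \<in> X\<rbrakk> \<Longrightarrow> sim t x z"
  unfolding sim_def using good_comp[of t x y _ z] good_comp[of t z y _ x] by blast

text \<open>The way back from \<open>y\<close> to \<open>x\<close> goes through \<open>z\<close>.
  Consequently a good path whose ends lie in one class never leaves that class, which is why
  counting and elimination can be done class by class.\<close>

lemma sim_back:
  assumes "good t x y r" "good t y z s" "sim t x z" "r \<in> carrier E" "s \<in> carrier E"
    "x \<in> X" "y \<in> X" "z \<in> X"
  shows "sim t x y"
  using assms good_comp[of t y z s x] unfolding sim_def by blast

text \<open>As goodness means lying outside the ideal, this is containment of the completely prime
  ideal of \<open>s\<close> at \<open>x\<close> in that of \<open>t\<close>. The support condition
  excludes a type \<open>t\<close> for which no endomorphism of \<open>x\<close> is good, where the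
  implication would hold vacuously.\<close>

definition below :: "'t \<Rightarrow> 't \<Rightarrow> 'x \<Rightarrow> bool" where
  "below s t x \<longleftrightarrow> supp t x \<and> (\<forall>r\<in>carrier E. good t x x r \<longrightarrow> good s x x r)"

definition eqv :: "'t \<Rightarrow> 't \<Rightarrow> 'x \<Rightarrow> bool" where
  "eqv s t x \<longleftrightarrow> below s t x \<and> below t s x"

definition maximal :: "'t \<Rightarrow> 'x \<Rightarrow> bool" where
  "maximal t x \<longleftrightarrow> supp t x \<and> (\<forall>s. below t s x \<longrightarrow> below s t x)"

lemma below_refl: "supp t x \<Longrightarrow> below t t x"
  by (simp add: below_def)

lemma below_trans: "below s t x \<Longrightarrow> below t u x \<Longrightarrow> below s u x"
  by (auto simp: below_def)

lemma below_good: "\<lbrakk>below s t x; good t x x r; r \<in> carrier E\<rbrakk> \<Longrightarrow> good s x x r"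
  by (simp add: below_def)

lemma eqv_trans: "eqv s t x \<Longrightarrow> eqv t u x \<Longrightarrow> eqv s u x"
  using below_trans unfolding eqv_def by blast

lemma eqv_sym: "eqv s t x \<longleftrightarrow> eqv t s x"
  by (auto simp: eqv_def)

lemma top_below_iff: "maximal s x \<Longrightarrow> below s t x \<longleftrightarrow> eqv s t x"
  by (auto simp: maximal_def eqv_def)

lemma ex_top_above:
  assumes "supp s x"
  shows "\<exists>t. maximal t x \<and> below s t x"
proof -
  \<comment> \<open>A maximal type above \<open>s\<close> is found as one with the fewest types
    above it.\<close>
  obtain t where t: "below s t x"
    and mn: "\<And>u. below s u x \<Longrightarrow> card {v. below t v x} \<le> card {v. below u v x}"
    using ex_has_least_nat[of "\<lambda>t. below s t x" s "\<lambda>t. card {v. below t v x}"] below_refl[OF assms]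
    by blast
  have "below u t x" if "below t u x" for u
  proof -
    have fin: "finite {v. below t v x}" using finite_types finite_subset subset_UNIV by blast
    have sub: "{v. below u v x} \<subseteq> {v. below t v x}" using that below_trans by blast
    have "card {v. below t v x} \<le> card {v. below u v x}" using mn t that below_trans by blast
    then have "{v. below u v x} = {v. below t v x}" using card_seteq[OF fin sub] by blast
    then show ?thesis using t by (auto simp: below_def)
  qed
  moreover have "supp t x" using t by (simp add: below_def)
  ultimately have "maximal t x" unfolding maximal_def by blast
  then show ?thesis using t by blast
qed

text \<open>Prime avoidance by a product: each type \<open>s\<close> that is not below
  \<open>t\<close> contributes a factor good for \<open>t\<close> but bad for \<open>s\<close>. The
  product stays good for \<open>t\<close>, whose ideal is completely prime, and becomes bad for
  every such \<open>s\<close>.\<close>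

lemma ex_exactly_below:
  assumes "x \<in> X" "supp t x"
  shows "\<exists>r\<in>carrier E. \<forall>s. good s x x r \<longleftrightarrow> below s t x"
proof -
  have "\<exists>r\<in>carrier E. good t x x r \<and> (\<forall>s\<in>U. \<not> below s t x \<longrightarrow> \<not> good s x x r)" if "finite U" for U
    using that
  proof (induction U rule: finite_induct)
    case empty
    then show ?case using assms good_one by (intro bexI[of _ \<one>]) auto
  next
    case (insert s U)
    then obtain r where r: "r \<in> carrier E" "good t x x r" "\<forall>s\<in>U. \<not> below s t x \<longrightarrow> \<not> good s x x r"
      by blast
    show ?case
    proof (cases "below s t x")
      case False
      then obtain q where "q \<in> carrier E" "good t x x q" "\<not> good s x x q"
        using assms by (auto simp: below_def)
      then show ?thesis
        using r assms good_mult[of q r x x x]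
        by (intro bexI[of _ "r \<otimes> (e {x} \<otimes> q)"]) auto
    qed (use r in auto)
  qed
  from this[of UNIV] finite_types show ?thesis
    using below_good by (metis UNIV_I)
qed

text \<open>Every supported type lies below a maximal one, so avoiding the maximal ideals means
  avoiding all of them.\<close>

lemma good_top_unit:
  assumes "r \<in> carrier E" "x \<in> X" "\<And>t. maximal t x \<Longrightarrow> good t x x r"
  shows "\<exists>u\<in>carrier E. e {x} \<otimes> (u \<otimes> e {x}) = u \<and> u \<otimes> (r \<otimes> e {x}) = e {x}"
  using assms ex_top_above below_good by (intro good_unit) blast+

text \<open>A pair of good maps for \<open>c\<close> composes to an endomorphism of
  \<open>x\<close>, where the ideals can be compared: the composite is good for \<open>t\<close>,
  and then so are its factors.\<close>

lemma sim_below: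
  assumes "sim c x y" "below t c x" "x \<in> X" "y \<in> X"
  shows "sim t x y"
proof -
  obtain r s where rs: "r \<in> carrier E" "s \<in> carrier E" "good c x y r" "good c y x s"
    using assms by (auto simp: sim_def)
  then have "good c x x (s \<otimes> (e {y} \<otimes> r))" using good_mult assms by simp
  then have "good t x x (s \<otimes> (e {y} \<otimes> r))" using below_good assms rs by simp
  then show ?thesis using good_mult assms rs unfolding sim_def by blast
qed

text \<open>The sandwich \<open>g r f\<close> turns an endomorphism \<open>r\<close> of
  \<open>y\<close> that is good for \<open>t\<close> into such an endomorphism of \<open>x\<close>.
  There it is good for \<open>s\<close>, and so is its factor \<open>r\<close>.\<close>

lemma below_transfer:
  assumes "sim t x y" "below s t x" "x \<in> X" "y \<in> X"
  shows "below s t y"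
proof -
  obtain f g where fg: "f \<in> carrier E" "g \<in> carrier E" "good t x y f" "good t y x g"
    using assms by (auto simp: sim_def)
  have "good s y y r" if r: "r \<in> carrier E" "good t y y r" for r
  proof -
    have "good t x x (g \<otimes> (e {y} \<otimes> (r \<otimes> (e {y} \<otimes> f))))"
      using good_mult fg r assms by simp
    then have "good s x x (g \<otimes> (e {y} \<otimes> (r \<otimes> (e {y} \<otimes> f))))"
      using below_good[OF assms(2)] fg r by simp
    then show ?thesis using good_mult fg r assms by simp
  qed
  then show ?thesis using assms(1) sim_supp by (auto simp: below_def)
qed

lemma eqv_transfer:
  assumes "sim t x y" "eqv s t x" "x \<in> X" "y \<in> X"
  shows "eqv s t y"
  using assms below_transfer sim_below unfolding eqv_def by blast

text \<open>A Chinese remainder argument. For a single \<open>c\<close>, take a good map from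
  \<open>x\<close> to \<open>y\<close> preceded by an endomorphism of \<open>x\<close> that is good
  exactly below \<open>c\<close>: among the maximal types it is good only for those equivalent to
  \<open>c\<close>. Such maps for inequivalent \<open>c\<close> are added, and each maximal type
  sees at most one good summand.\<close>

lemma ex_glued:
  assumes "x \<in> X" "y \<in> X" "\<And>c. c \<in> C \<Longrightarrow> maximal c x \<and> sim c x y"
  shows "\<exists>h\<in>carrier E. \<forall>t. maximal t x \<longrightarrow> (good t x y h \<longleftrightarrow> (\<exists>c\<in>C. eqv t c x))"
proof -
  have "finite C" using finite_types finite_subset subset_UNIV by blast
  then show ?thesis
    using assms(3)
  proof (induction C rule: finite_induct)
    case empty
    then show ?case using assms good_zero by (intro bexI[of _ \<zero>]) auto
  next
    case (insert c C)
    then obtain h where h: "h \<in> carrier E"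
      and hg: "\<And>t. maximal t x \<Longrightarrow> good t x y h \<longleftrightarrow> (\<exists>c\<in>C. eqv t c x)" by auto
    have c: "maximal c x" "sim c x y" using insert.prems by auto
    show ?case
    proof (cases "\<exists>c'\<in>C. eqv c c' x")
      case True
      then show ?thesis using h hg eqv_trans by (intro bexI[of _ h]) blast+
    next
      case False
      obtain f g where fg: "f \<in> carrier E" "g \<in> carrier E" "good c x y f" "good c y x g"
        using c by (auto simp: sim_def)
      obtain r where r: "r \<in> carrier E" "\<And>s. good s x x r \<longleftrightarrow> below s c x"
        using ex_exactly_below[of x c] assms c by (auto simp: maximal_def)
      define k where "k = f \<otimes> (e {x} \<otimes> r)"
      have k: "k \<in> carrier E" using fg r by (simp add: k_def)
      have kg: "good t x y k \<longleftrightarrow> eqv t c x" if "maximal t x" for t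
      proof
        assume "good t x y k"
        then have "below t c x" using good_mult fg r assms by (simp add: k_def)
        then show "eqv t c x" using that top_below_iff by simp
      next
        assume "eqv t c x"
        then have t: "below t c x" by (simp add: eqv_def)
        \<comment> \<open>The map \<open>f\<close> is known to be good for \<open>c\<close> only.
          That \<open>k\<close> is good for the equivalent \<open>t\<close> is seen by returning to
          \<open>x\<close> along \<open>g\<close>, where the two ideals can be compared.\<close>
        have "good c x x (g \<otimes> (e {y} \<otimes> k))"
          using good_mult fg r assms c below_refl by (simp add: k_def maximal_def)
        then have "good t x x (g \<otimes> (e {y} \<otimes> k))" using t below_good fg k by simp
        then show "good t x y k" using good_mult fg k assms by simp
      qed
      have "good t x y (h \<oplus> k) \<longleftrightarrow> (\<exists>c\<in>insert c C. eqv t c x)" if t: "maximal t x" for t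
      proof (cases "eqv t c x")
        case True
        then have "\<not> good t x y h"
          using False hg[OF t] eqv_trans eqv_sym by blast
        then have "good t x y (k \<oplus> h)" using True kg[OF t] good_add_iff h k assms by simp
        then show ?thesis using True h k a_comm by simp
      next
        case ne: False
        then show ?thesis using kg[OF t] hg[OF t] good_add_iff h k assms by simp
      qed
      then show ?thesis using h k by (intro bexI[of _ "h \<oplus> k"]) auto
    qed
  qed
qed

lemma corner_absorb:
  assumes "a \<in> carrier E" "e {x} \<otimes> (a \<otimes> e {x}) = a"
  shows "a \<otimes> e {x} = a" "e {x} \<otimes> a = a"
proof -
  have "a \<otimes> e {x} = e {x} \<otimes> (a \<otimes> (e {x} \<otimes> e {x}))"
    using assms(1) by (subst assms(2)[symmetric]) (simp add: m_assoc)
  then show "a \<otimes> e {x} = a" using assms by (simp add: e_mult)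
  have "e {x} \<otimes> a = (e {x} \<otimes> e {x}) \<otimes> (a \<otimes> e {x})"
    using assms(1) by (subst assms(2)[symmetric]) (simp add: m_assoc)
  then show "e {x} \<otimes> a = a" using assms by (simp add: e_mult)
qed

text \<open>Modulo the maximal ideal of a maximal type, the endomorphisms form a division ring.\<close>

lemma top_division:
  assumes "x \<in> X" "maximal t x" "a \<in> carrier E" "good t x x a"
  shows "\<exists>b\<in>carrier E. \<not> good t x x (\<one> \<ominus> b \<otimes> (e {x} \<otimes> a))"
proof -
  have supp: "supp t x" using assms by (simp add: maximal_def)
  obtain r where r: "r \<in> carrier E" "\<And>s. good s x x r \<longleftrightarrow> below s t x"
    using ex_exactly_below[OF assms(1) supp] by blast
  \<comment> \<open>The complement of \<open>r\<close>: good at exactly those maximal types that are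
    not equivalent to \<open>t\<close>. With it, \<open>k \<oplus> m\<close> avoids every maximal
    ideal, although \<open>a\<close> itself need not.\<close>
  obtain m where m: "m \<in> carrier E"
    and mg: "\<And>s. maximal s x \<Longrightarrow> good s x x m \<longleftrightarrow> (\<exists>c\<in>{c. maximal c x \<and> \<not> eqv c t x}. eqv s c x)"
  proof -
    have "maximal c x \<and> sim c x x" if "c \<in> {c. maximal c x \<and> \<not> eqv c t x}" for c
      using that sim_refl[OF _ assms(1)] by (simp add: maximal_def)
    from ex_glued[OF assms(1,1) this] show ?thesis using that by blast
  qed
  have mg': "good s x x m \<longleftrightarrow> \<not> eqv s t x" if "maximal s x" for s
  proof -
    have "eqv s s x" using that below_refl by (simp add: eqv_def maximal_def)
    then show ?thesis using mg[OF that] that eqv_sym eqv_trans by blast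
  qed
  define k where "k = r \<otimes> (e {x} \<otimes> a)"
  have k: "k \<in> carrier E" using r assms by (simp add: k_def)
  have kg: "good s x x k \<longleftrightarrow> eqv s t x" if "maximal s x" for s
    using that good_mult r assms top_below_iff below_good by (auto simp: k_def)
  have "good s x x (k \<oplus> m)" if s: "maximal s x" for s
  proof (cases "eqv s t x")
    case True
    then show ?thesis using kg[OF s] mg'[OF s] good_add_iff k m assms by simp
  next
    case False
    then have "good s x x (m \<oplus> k)" using kg[OF s] mg'[OF s] good_add_iff k m assms by simp
    then show ?thesis using k m a_comm by simp
  qed
  then obtain u where u: "u \<in> carrier E" "e {x} \<otimes> (u \<otimes> e {x}) = u"
    "u \<otimes> ((k \<oplus> m) \<otimes> e {x}) = e {x}"
    using good_top_unit[of "k \<oplus> m" x] k m assms by auto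
  define b where "b = u \<otimes> r"
  note ue = corner_absorb[OF u(1,2)]
  have bk: "b \<otimes> (e {x} \<otimes> a) = u \<otimes> k" using u r assms by (simp add: b_def k_def m_assoc)
  \<comment> \<open>In the corner at \<open>x\<close> the difference turns out to be
    \<open>u m\<close>, and \<open>m\<close> lies in the ideal of \<open>t\<close>.\<close>
  have "e {x} \<otimes> ((\<one> \<ominus> u \<otimes> k) \<otimes> e {x}) = e {x} \<ominus> u \<otimes> (k \<otimes> e {x})"
  proof -
    have "e {x} \<otimes> ((\<one> \<ominus> u \<otimes> k) \<otimes> e {x}) = e {x} \<otimes> e {x} \<ominus> (e {x} \<otimes> u) \<otimes> (k \<otimes> e {x})"
      using u(1) k by (simp add: a_minus_def l_distr r_distr l_minus r_minus m_assoc)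
    then show ?thesis using ue u k by (simp add: e_mult)
  qed
  also have "\<dots> = u \<otimes> (m \<otimes> e {x})"
  proof -
    have "e {x} = u \<otimes> (k \<otimes> e {x}) \<oplus> u \<otimes> (m \<otimes> e {x})"
      using u k m by (simp add: l_distr r_distr)
    then have "e {x} \<ominus> u \<otimes> (k \<otimes> e {x}) =
        (u \<otimes> (k \<otimes> e {x}) \<oplus> u \<otimes> (m \<otimes> e {x})) \<ominus> u \<otimes> (k \<otimes> e {x})" by simp
    also have "\<dots> = (u \<otimes> (m \<otimes> e {x}) \<oplus> u \<otimes> (k \<otimes> e {x})) \<ominus> u \<otimes> (k \<otimes> e {x})"
      using u k m by (simp add: a_comm)
    also have "\<dots> = u \<otimes> (m \<otimes> e {x})"
      using u k m by (simp add: a_minus_def a_assoc r_neg)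
    finally show ?thesis .
  qed
  also have "\<dots> = e {x} \<otimes> ((u \<otimes> (e {x} \<otimes> m)) \<otimes> e {x})"
  proof -
    have "e {x} \<otimes> ((u \<otimes> (e {x} \<otimes> m)) \<otimes> e {x}) = ((e {x} \<otimes> u) \<otimes> e {x}) \<otimes> (m \<otimes> e {x})"
      using u(1) m by (simp add: m_assoc)
    then show ?thesis by (simp add: ue)
  qed
  finally have "good t x x (\<one> \<ominus> u \<otimes> k) \<longleftrightarrow> good t x x (u \<otimes> (e {x} \<otimes> m))"
    using good_entry[of "\<one> \<ominus> u \<otimes> k" x x t] good_entry[of "u \<otimes> (e {x} \<otimes> m)" x x t] u k m assms
    by simp
  then have "\<not> good t x x (\<one> \<ominus> u \<otimes> k)"
    using good_mult mg'[OF assms(2)] u m assms below_refl[OF supp] by (simp add: eqv_def)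
  moreover have "b \<in> carrier E" using u r by (simp add: b_def)
  ultimately show ?thesis using bk by (intro bexI[of _ b]) simp_all
qed

text \<open>Suppose the ideal of \<open>t\<close> at \<open>y\<close> is properly contained in that
  of \<open>s\<close>, and take \<open>r\<close> bad for \<open>s\<close> but good for
  \<open>t\<close>. Carried to \<open>x\<close> as \<open>a = g r f\<close>, it has a left inverse
  \<open>b\<close> modulo the ideal of \<open>t\<close>, by maximality there. At \<open>y\<close>
  put \<open>w = f b g r\<close>. Since \<open>w\<close> is bad for \<open>s\<close>, the element
  \<open>1 - w\<close> is good for \<open>s\<close>; yet it is bad for \<open>t\<close>, because
  \<open>(1 - w) f = f (1 - b a)\<close> and \<open>f\<close> is good. This contradicts the
  containment.\<close>

lemma top_transfer:
  assumes "sim t x y" "maximal t x" "x \<in> X" "y \<in> X"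
  shows "maximal t y"
  unfolding maximal_def
proof (intro conjI allI impI)
  show "supp t y" using assms sim_supp by blast
  fix s assume ts: "below t s y"
  show "below s t y"
  proof (rule ccontr)
    assume nb: "\<not> below s t y"
    obtain r where r: "r \<in> carrier E" "\<And>s. good s y y r \<longleftrightarrow> below s t y"
      using ex_exactly_below[of y t] assms sim_supp by blast
    obtain f g where fg: "f \<in> carrier E" "g \<in> carrier E" "good t x y f" "good t y x g"
      using assms by (auto simp: sim_def)
    define a where "a = g \<otimes> (e {y} \<otimes> (r \<otimes> (e {y} \<otimes> f)))"
    have a: "a \<in> carrier E" "good t x x a"
      using fg r good_mult assms below_refl \<open>supp t y\<close> by (auto simp: a_def)
    obtain b where b: "b \<in> carrier E" "\<not> good t x x (\<one> \<ominus> b \<otimes> (e {x} \<otimes> a))"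
      using top_division[OF assms(3,2) a] by blast
    define p where "p = f \<otimes> (e {x} \<otimes> (b \<otimes> (e {x} \<otimes> g)))"
    define w where "w = p \<otimes> (e {y} \<otimes> r)"
    have pw: "p \<in> carrier E" "w \<in> carrier E" using fg b r by (auto simp: p_def w_def)
    have "\<not> good s y y w" using nb good_mult pw r assms by (simp add: w_def)
    then have sg: "good s y y (\<one> \<ominus> w)"
      using good_minus_iff[of \<one> w y y s] good_one pw assms ts by (simp add: below_def)
    have "\<not> good t y y (\<one> \<ominus> w)"
    proof
      assume "good t y y (\<one> \<ominus> w)"
      then have "good t x y ((\<one> \<ominus> w) \<otimes> (e {y} \<otimes> f))"
        using good_mult fg pw assms by simp
      moreover have "e {y} \<otimes> (((\<one> \<ominus> w) \<otimes> (e {y} \<otimes> f)) \<otimes> e {x}) =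
          e {y} \<otimes> ((f \<otimes> (e {x} \<otimes> (\<one> \<ominus> b \<otimes> (e {x} \<otimes> a)))) \<otimes> e {x})"
        using fg b r
        by (simp add: w_def p_def a_def a_minus_def l_distr r_distr l_minus r_minus m_assoc
            e_mult e_mult_left)
      moreover have "(\<one> \<ominus> w) \<otimes> (e {y} \<otimes> f) \<in> carrier E"
        "f \<otimes> (e {x} \<otimes> (\<one> \<ominus> b \<otimes> (e {x} \<otimes> a))) \<in> carrier E"
        using fg b a pw by auto
      ultimately have "good t x y (f \<otimes> (e {x} \<otimes> (\<one> \<ominus> b \<otimes> (e {x} \<otimes> a))))"
        using good_entry assms by metis
      then show False using good_mult fg b a assms by simp
    qed
    then show False using sg ts pw below_good by blast
  qed
qed


text \<open>Modulo the Jacobson radical such a matrix is diagonal with invertible diagonal entries.\<close>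

definition nearly_diagonal :: "'e \<Rightarrow> bool" where
  "nearly_diagonal h \<longleftrightarrow> h \<in> carrier E \<and>
     (\<forall>x\<in>X. \<forall>t. maximal t x \<longrightarrow>
       good t x x h \<and> (\<forall>y\<in>X. y \<noteq> x \<longrightarrow> sim t x y \<longrightarrow> \<not> good t x y h))"

lemma nearly_diagonalD:
  assumes "nearly_diagonal h"
  shows "h \<in> carrier E"
    and "\<lbrakk>x \<in> X; maximal t x\<rbrakk> \<Longrightarrow> good t x x h"
    and "\<lbrakk>x \<in> X; y \<in> X; maximal t x; sim t x y; y \<noteq> x\<rbrakk> \<Longrightarrow> \<not> good t x y h"
  using assms unfolding nearly_diagonal_def by auto

lemma maximal_sim_refl: "\<lbrakk>maximal t x; x \<in> X\<rbrakk> \<Longrightarrow> sim t x x"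
  using sim_refl by (simp add: maximal_def)

text \<open>Multiplying by \<open>1 - q\<close>, with \<open>q = (h - 1) a\<close> and
  \<open>a\<close> a left inverse of the diagonal entry at \<open>x\<close>, is a row operation that
  turns column \<open>x\<close> into a unit column. As \<open>a\<close> starts and ends at
  \<open>x\<close>, the unit columns of \<open>T\<close> are untouched. The correction of an entry
  from \<open>z\<close> to a similar \<open>y\<close> runs through \<open>x\<close>: if it were
  good, \<open>sim_back\<close> would make \<open>z\<close> and \<open>x\<close> similar, but then
  the entry of \<open>h\<close> from \<open>z\<close> to \<open>x\<close> is bad.\<close>

lemma eliminate_column:
  assumes h: "nearly_diagonal h" and x: "x \<in> X" and T: "x \<notin> T" "h \<otimes> e T = e T"
  shows "\<exists>u\<in>carrier E. nearly_diagonal (u \<otimes> h) \<and> (u \<otimes> h) \<otimes> e (insert x T) = e (insert x T)"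
proof -
  note hE = nearly_diagonalD(1)[OF h]
  obtain a where a: "a \<in> carrier E" "e {x} \<otimes> (a \<otimes> e {x}) = a" "a \<otimes> (h \<otimes> e {x}) = e {x}"
    using good_top_unit[OF hE x] nearly_diagonalD(2)[OF h x] by blast
  note ae = corner_absorb[OF a(1,2)]
  define q where "q = (h \<ominus> \<one>) \<otimes> a"
  have q: "q \<in> carrier E" using hE a by (simp add: q_def)
  define k where "k = (\<one> \<ominus> q) \<otimes> h"
  have k: "k \<in> carrier E" using q hE by (simp add: k_def)
  have k_eq: "k = h \<ominus> q \<otimes> (e {x} \<otimes> h)"
  proof -
    have "q \<otimes> e {x} = q" using ae a(1) hE by (simp add: q_def m_assoc)
    then have "q \<otimes> (e {x} \<otimes> h) = q \<otimes> h" using q hE m_assoc[of q "e {x}" h] by simp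
    then show ?thesis using q hE by (simp add: k_def a_minus_def l_distr l_minus)
  qed
  have kx: "k \<otimes> e {x} = e {x}"
  proof -
    have "q \<otimes> (h \<otimes> e {x}) = (h \<ominus> \<one>) \<otimes> e {x}"
      using a hE by (simp add: q_def m_assoc)
    then have "k \<otimes> e {x} = h \<otimes> e {x} \<ominus> (h \<ominus> \<one>) \<otimes> e {x}"
      using q hE by (simp add: k_def a_minus_def l_distr l_minus m_assoc)
    also have "\<dots> = e {x}"
      using hE by (simp add: a_minus_def l_distr l_minus minus_add r_neg a_assoc[symmetric])
    finally show ?thesis .
  qed
  have kT: "k \<otimes> e T = e T"
  proof -
    have "a \<otimes> e T = a \<otimes> (e {x} \<otimes> e T)" using ae a(1) m_assoc[of a "e {x}" "e T"] by simp
    also have "\<dots> = \<zero>" using T a(1) by (simp add: e_mult e_empty)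
    finally have "q \<otimes> e T = \<zero>" using a hE by (simp add: q_def m_assoc)
    then show ?thesis
      using T q hE by (simp add: k_def a_minus_def l_distr l_minus m_assoc)
  qed
  have "e (insert x T) = e {x} \<oplus> e T" using e_union[of "{x}" T] T by simp
  then have kI: "k \<otimes> e (insert x T) = e (insert x T)" using kx kT k by (simp add: r_distr)
  have colx: "good t x y k \<longleftrightarrow> y = x \<and> supp t x" if "y \<in> X" for t y
  proof -
    have "good t x y k \<longleftrightarrow> good t x y (e {y} \<otimes> (k \<otimes> e {x}))" using k x that by (simp add: good_entry)
    also have "e {y} \<otimes> (k \<otimes> e {x}) = e {y} \<otimes> (\<one> \<otimes> e {x})" by (simp add: kx)
    also have "good t x y \<dots> \<longleftrightarrow> y = x \<and> supp t x"
      using that x good_zero good_entry[of \<one> x x t] good_one good_supp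
      by (cases "y = x") (auto simp: e_mult e_empty)
    finally show ?thesis .
  qed
  have colz: "good t z y k \<longleftrightarrow> good t z y h"
    if "z \<in> X" "y \<in> X" "z \<noteq> x" "maximal t z" "sim t z y" for t z y
  proof -
    have "\<not> good t z y (q \<otimes> (e {x} \<otimes> h))"
    proof
      assume "good t z y (q \<otimes> (e {x} \<otimes> h))"
      then have g: "good t z x h" "good t x y q" using good_mult q hE that x by auto
      then have "sim t z x" using sim_back that q hE x by blast
      then show False using nearly_diagonalD(3)[OF h that(1) x that(4)] that g by blast
    qed
    then show ?thesis using k_eq good_minus_iff q hE that by simp
  qed
  have "nearly_diagonal k"
    unfolding nearly_diagonal_def
  proof (intro conjI ballI allI impI)
    fix z t assume z: "z \<in> X" "maximal t z"
    show "good t z z k"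
    proof (cases "z = x")
      case True
      then show ?thesis using colx[OF x] z by (simp add: maximal_def)
    next
      case False
      then show ?thesis
        using colz[OF z(1,1) False z(2)] maximal_sim_refl z nearly_diagonalD(2)[OF h] by blast
    qed
    fix y assume y: "y \<in> X" "y \<noteq> z" "sim t z y"
    show "\<not> good t z y k"
    proof (cases "z = x")
      case True
      then show ?thesis using colx[OF y(1)] y by simp
    next
      case False
      then show ?thesis
        using colz[OF z(1) y(1) False z(2) y(3)] nearly_diagonalD(3)[OF h z(1) y(1) z(2) y(3,2)]
        by blast
    qed
  qed (rule k)
  then show ?thesis using kI q hE unfolding k_def by (intro bexI[of _ "\<one> \<ominus> q"]) auto
qed

lemma nearly_diagonal_left_inverse:
  assumes "nearly_diagonal h"
  shows "\<exists>w\<in>carrier E. w \<otimes> h = \<one>"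
proof -
  have "\<exists>u\<in>carrier E. nearly_diagonal (u \<otimes> h) \<and> (u \<otimes> h) \<otimes> e S = e S" if "finite S" "S \<subseteq> X" for S
    using that
  proof (induction S rule: finite_induct)
    case empty
    then show ?case
      using assms nearly_diagonalD(1)[OF assms] by (intro bexI[of _ \<one>]) (auto simp: e_empty)
  next
    case (insert x S)
    then obtain u where u: "u \<in> carrier E" "nearly_diagonal (u \<otimes> h)" "(u \<otimes> h) \<otimes> e S = e S"
      by auto
    obtain v where v: "v \<in> carrier E" "nearly_diagonal (v \<otimes> (u \<otimes> h))"
      "(v \<otimes> (u \<otimes> h)) \<otimes> e (insert x S) = e (insert x S)"
      using eliminate_column[OF u(2) _ insert.hyps(2) u(3)] insert.prems by auto
    have "v \<otimes> u \<otimes> h = v \<otimes> (u \<otimes> h)"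
      using u v nearly_diagonalD(1)[OF assms] by (simp add: m_assoc)
    then show ?case using u v by (intro bexI[of _ "v \<otimes> u"]) auto
  qed
  from this[OF finite_X] obtain u where "u \<in> carrier E" "nearly_diagonal (u \<otimes> h)" "(u \<otimes> h) \<otimes> e X = e X"
    by auto
  then show ?thesis using nearly_diagonalD(1) by (intro bexI[of _ u]) (auto simp: e_X)
qed

text \<open>Elimination gives only a left inverse \<open>w\<close>. Reading \<open>w h = 1\<close>
  at similar objects, where only the diagonal of \<open>h\<close> contributes, shows that
  \<open>w\<close> is nearly diagonal as well. So \<open>w\<close> has a left inverse in turn, which
  must be \<open>h\<close>.\<close>

lemma nearly_diagonal_unit:
  assumes h: "nearly_diagonal h"
  shows "\<exists>w\<in>carrier E. w \<otimes> h = \<one> \<and> h \<otimes> w = \<one>"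
proof -
  note hE = nearly_diagonalD(1)[OF h]
  obtain w where w: "w \<in> carrier E" "w \<otimes> h = \<one>" using nearly_diagonal_left_inverse[OF h] by blast
  have bad: "\<not> (good t x y h \<and> good t y z w)"
    if "x \<in> X" "y \<in> X" "z \<in> X" "maximal t x" "y \<noteq> x" "sim t x z" for t x y z
    using that nearly_diagonalD(3)[OF h, of x y t] sim_back[of t x y h z w] w hE by blast
  have key: "good t x z \<one> \<longleftrightarrow> good t x z w"
    if "x \<in> X" "z \<in> X" "maximal t x" "sim t x z" for t x z
    using good_mult_unique[OF hE w(1) that(1,1,2), of t] bad[OF that(1) _ that(2,3) _ that(4)]
      nearly_diagonalD(2)[OF h that(1,3)] w(2) by auto
  have "nearly_diagonal w"
    unfolding nearly_diagonal_def
  proof (intro conjI ballI allI impI)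
    fix x t assume x: "x \<in> X" "maximal t x"
    show "good t x x w"
      using key[OF x(1,1,2)] maximal_sim_refl x good_one by (simp add: maximal_def)
    fix y assume y: "y \<in> X" "y \<noteq> x" "sim t x y"
    have "\<not> good t x y \<one>"
      using good_entry[of \<one> x y t] good_zero x y by (simp add: e_mult e_empty)
    then show "\<not> good t x y w" using key x y by blast
  qed (rule w)
  then obtain v where v: "v \<in> carrier E" "v \<otimes> w = \<one>" using nearly_diagonal_left_inverse by blast
  have "v = v \<otimes> (w \<otimes> h)" using v w by simp
  also have "\<dots> = (v \<otimes> w) \<otimes> h" by (rule m_assoc[OF v(1) w(1) hE, symmetric])
  also have "\<dots> = h" using v hE by simp
  finally show ?thesis using v w by auto
qed

text \<open>Types with equal ideals at \<open>x\<close> cannot be separated by endomorphisms of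
  \<open>x\<close>, but \<open>\<pi>\<close> may send them to different partners. One representative
  of each class of equivalent types therefore decides which partner is followed.\<close>

lemma ex_matrix_along:
  assumes \<pi>: "\<And>t x. \<lbrakk>x \<in> X; supp t x\<rbrakk> \<Longrightarrow> \<pi> t x \<in> X \<and> sim t x (\<pi> t x) \<and> \<pi> t (\<pi> t x) = x"
  shows "\<exists>h\<in>carrier E. \<forall>x\<in>X. \<forall>y\<in>X. \<forall>t. maximal t x \<longrightarrow>
    (good t x y h \<longleftrightarrow> \<pi> (SOME s. eqv s t x) x = y)"
proof -
  define rep where "rep = (\<lambda>t x. SOME s. eqv s t x)"
  have rep: "eqv (rep t x) t x" if "maximal t x" for t x
  proof -
    have "eqv t t x" using that below_refl by (simp add: eqv_def maximal_def)
    then show ?thesis unfolding rep_def by (rule someI)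
  qed
  have rep_cong: "rep s x = rep t x" if "eqv s t x" for s t x
  proof -
    have "(\<lambda>u. eqv u s x) = (\<lambda>u. eqv u t x)" using that eqv_trans eqv_sym by blast
    then show ?thesis by (simp add: rep_def)
  qed
  have max_rep: "maximal (rep t x) x" if "maximal t x" for t x
    using rep[OF that] that below_trans unfolding maximal_def eqv_def by (meson below_def)
  define C where "C = (\<lambda>x y. {c. maximal c x \<and> rep c x = c \<and> \<pi> c x = y})"
  have "\<exists>h. h \<in> carrier E \<and> (\<forall>t. maximal t x \<longrightarrow> (good t x y h \<longleftrightarrow> (\<exists>c\<in>C x y. eqv t c x)))"
    if "x \<in> X" "y \<in> X" for x y
  proof -
    have "maximal c x \<and> sim c x y" if "c \<in> C x y" for c
      using that \<pi>[OF \<open>x \<in> X\<close>, of c] by (auto simp: C_def maximal_def)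
    from ex_glued[OF that this] show ?thesis by blast
  qed
  then obtain H where H: "\<And>x y. \<lbrakk>x \<in> X; y \<in> X\<rbrakk> \<Longrightarrow> H x y \<in> carrier E"
    and Hg: "\<And>x y t. \<lbrakk>x \<in> X; y \<in> X; maximal t x\<rbrakk> \<Longrightarrow>
      good t x y (H x y) \<longleftrightarrow> (\<exists>c\<in>C x y. eqv t c x)"
    by metis
  obtain h where h: "h \<in> carrier E"
    and hH: "\<And>x y. \<lbrakk>x \<in> X; y \<in> X\<rbrakk> \<Longrightarrow> e {y} \<otimes> (h \<otimes> e {x}) = e {y} \<otimes> (H x y \<otimes> e {x})"
    using matrix_entries[of H] H by blast
  have "good t x y h \<longleftrightarrow> \<pi> (rep t x) x = y" if "x \<in> X" "y \<in> X" "maximal t x" for t x y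
  proof -
    have "good t x y h \<longleftrightarrow> good t x y (H x y)"
      using good_entry[OF h that(1,2), of t] good_entry[OF H[OF that(1,2)] that(1,2), of t]
        hH[OF that(1,2)] by simp
    also have "\<dots> \<longleftrightarrow> (\<exists>c\<in>C x y. eqv t c x)" by (rule Hg[OF that])
    also have "\<dots> \<longleftrightarrow> \<pi> (rep t x) x = y"
    proof
      assume "\<exists>c\<in>C x y. eqv t c x"
      then obtain c where "rep c x = c" "\<pi> c x = y" "eqv t c x" by (auto simp: C_def)
      then show "\<pi> (rep t x) x = y" using rep_cong by simp
    next
      assume "\<pi> (rep t x) x = y"
      moreover have "rep (rep t x) x = rep t x" using rep_cong rep[OF that(3)] by simp
      ultimately show "\<exists>c\<in>C x y. eqv t c x"
        using max_rep[OF that(3)] rep[OF that(3)] eqv_sym by (auto simp: C_def)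
    qed
    finally show ?thesis .
  qed
  then show ?thesis using h unfolding rep_def by blast
qed

theorem ex_isomorphism:
  assumes IJ: "I \<inter> J = {}" "I \<union> J = X"
    and \<pi>: "\<And>t x. \<lbrakk>x \<in> X; supp t x\<rbrakk> \<Longrightarrow> \<pi> t x \<in> X \<and> sim t x (\<pi> t x) \<and> \<pi> t (\<pi> t x) = x"
    and swap: "\<And>t x. \<lbrakk>x \<in> X; supp t x\<rbrakk> \<Longrightarrow> \<pi> t x \<in> I \<longleftrightarrow> x \<in> J"
  shows "\<exists>f\<in>carrier E. \<exists>g\<in>carrier E. e J \<otimes> (f \<otimes> e I) = f \<and> e I \<otimes> (g \<otimes> e J) = g \<and>
    g \<otimes> f = e I \<and> f \<otimes> g = e J"
proof -
  define rep where "rep = (\<lambda>t x. SOME s. eqv s t x)"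
  have rep: "eqv (rep t x) t x" if "maximal t x" for t x
  proof -
    have "eqv t t x" using that below_refl by (simp add: eqv_def maximal_def)
    then show ?thesis unfolding rep_def by (rule someI)
  qed
  obtain h0 where h0: "h0 \<in> carrier E"
    and h0g: "\<And>x y t. \<lbrakk>x \<in> X; y \<in> X; maximal t x\<rbrakk> \<Longrightarrow> good t x y h0 \<longleftrightarrow> \<pi> (rep t x) x = y"
    using ex_matrix_along[OF \<pi>] unfolding rep_def by blast
  \<comment> \<open>Keeping only the two off-diagonal blocks makes \<open>h\<close> exchange
    \<open>I\<close> and \<open>J\<close> exactly, not just modulo the radical. Nothing good for a
    maximal type is lost, because \<open>\<pi>\<close> moves every supported object to the other
    side.\<close>
  define h where "h = e J \<otimes> (h0 \<otimes> e I) \<oplus> e I \<otimes> (h0 \<otimes> e J)"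
  have h: "h \<in> carrier E" using h0 by (simp add: h_def)
  have supp_rep: "supp (rep t x) x" if "maximal t x" for t x
    using rep[OF that] by (simp add: eqv_def below_def)
  have hg: "good t x y h \<longleftrightarrow> \<pi> (rep t x) x = y" if xy: "x \<in> X" "y \<in> X" "maximal t x" for t x y
  proof -
    have entry: "e {y} \<otimes> (h \<otimes> e {x}) = (e ({y} \<inter> J) \<otimes> h0) \<otimes> e (I \<inter> {x}) \<oplus>
        (e ({y} \<inter> I) \<otimes> h0) \<otimes> e (J \<inter> {x})"
      using h0 by (simp add: h_def l_distr r_distr m_assoc e_mult e_mult_left)
    have J_iff: "x \<in> J \<longleftrightarrow> x \<notin> I" "y \<in> J \<longleftrightarrow> y \<notin> I" using IJ xy by auto
    have Int_single: "{z} \<inter> S = (if z \<in> S then {z} else {})" "S \<inter> {z} = (if z \<in> S then {z} else {})"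
      for z :: 'x and S by auto
    show ?thesis
    proof (cases "x \<in> I \<longleftrightarrow> y \<in> I")
      case True
      then have "e {y} \<otimes> (h \<otimes> e {x}) = \<zero>"
        using h0 by (cases "x \<in> I") (simp_all add: entry Int_single J_iff e_empty)
      then have "\<not> good t x y h" using good_entry[OF h xy(1,2), of t] good_zero xy by simp
      moreover have "\<pi> (rep t x) x \<noteq> y"
        using swap[OF xy(1) supp_rep[OF xy(3)]] True IJ xy by blast
      ultimately show ?thesis by simp
    next
      case False
      then have "e {y} \<otimes> (h \<otimes> e {x}) = e {y} \<otimes> (h0 \<otimes> e {x})"
        using h0 by (cases "x \<in> I") (simp_all add: entry Int_single J_iff e_empty m_assoc)
      then show ?thesis
        using good_entry[OF h xy(1,2), of t] good_entry[OF h0 xy(1,2), of t] h0g[OF xy] by simp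
    qed
  qed
  have hh: "good t x z (h \<otimes> h) \<longleftrightarrow> z = x" if xz: "x \<in> X" "z \<in> X" "maximal t x" for t x z
  proof -
    define y where "y = \<pi> (rep t x) x"
    have y: "y \<in> X" "sim (rep t x) x y" "\<pi> (rep t x) y = x"
      using \<pi>[OF xz(1) supp_rep[OF xz(3)]] by (auto simp: y_def)
    have sim: "sim t x y" using sim_below y rep[OF xz(3)] xz by (auto simp: eqv_def)
    have maxy: "maximal t y" using top_transfer[OF sim] xz y by blast
    \<comment> \<open>The same types are equivalent to \<open>t\<close> at both ends, so the same
      representative is chosen and the second factor of the square follows the same involution as
      the first.\<close>
    have "(\<lambda>s. eqv s t x) = (\<lambda>s. eqv s t y)"
      using eqv_transfer[OF sim] eqv_transfer[OF sim_sym[OF sim]] xz y by blast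
    then have rep_y: "rep t y = rep t x" by (simp add: rep_def)
    have "good t x z (h \<otimes> h) \<longleftrightarrow> good t x y h \<and> good t y z h"
      using hg[OF xz(1) _ xz(3)] by (intro good_mult_unique[OF h h xz(1) y(1) xz(2)]) (auto simp: y_def)
    also have "\<dots> \<longleftrightarrow> z = x"
      using hg[OF xz(1) y(1) xz(3)] hg[OF y(1) xz(2) maxy] y rep_y by (auto simp: y_def)
    finally show ?thesis .
  qed
  have "nearly_diagonal (h \<otimes> h)" using hh h by (auto simp: nearly_diagonal_def)
  then obtain w where w: "w \<in> carrier E" "w \<otimes> (h \<otimes> h) = \<one>" "(h \<otimes> h) \<otimes> w = \<one>"
    using nearly_diagonal_unit by blast
  \<comment> \<open>An invertible square makes \<open>h\<close> invertible. As \<open>h\<close>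
    exchanges the idempotents of \<open>I\<close> and \<open>J\<close>, the restrictions of
    \<open>h\<close> and of its inverse to the blocks are mutually inverse.\<close>
  define v where "v = w \<otimes> h"
  have v: "v \<in> carrier E" using w h by (simp add: v_def)
  have vh: "v \<otimes> h = \<one>" using w h by (simp add: v_def m_assoc)
  have hv: "h \<otimes> v = \<one>"
  proof -
    have "h \<otimes> (h \<otimes> w) = \<one>" using w h by (simp add: m_assoc)
    then have "h \<otimes> w = v" using vh v h w by (metis inv_unique m_closed)
    then show ?thesis using \<open>h \<otimes> (h \<otimes> w) = \<one>\<close> by simp
  qed
  have JI: "J \<inter> I = {}" using IJ by auto
  have hI: "h \<otimes> e I = e J \<otimes> h" and hJ: "h \<otimes> e J = e I \<otimes> h"
    using h0 IJ JI by (simp_all add: h_def l_distr r_distr m_assoc e_mult e_mult_left e_empty)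
  have vI: "v \<otimes> e J = e I \<otimes> v"
  proof -
    have "v \<otimes> e J = v \<otimes> (e J \<otimes> (h \<otimes> v))" using hv v by simp
    also have "\<dots> = v \<otimes> ((h \<otimes> e I) \<otimes> v)" using v h by (simp add: hI m_assoc)
    also have "\<dots> = (v \<otimes> h) \<otimes> (e I \<otimes> v)" using v h by (simp add: m_assoc)
    finally show ?thesis using vh v by simp
  qed
  define f where "f = h \<otimes> e I"
  define g where "g = v \<otimes> e J"
  have "f \<otimes> e I = f" "g \<otimes> e J = g" using h v by (simp_all add: f_def g_def m_assoc e_mult)
  moreover have "e J \<otimes> f = f" "e I \<otimes> g = g"
    using h v by (simp_all add: f_def g_def hI vI e_mult_left)
  ultimately have "e J \<otimes> (f \<otimes> e I) = f" "e I \<otimes> (g \<otimes> e J) = g" by simp_all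
  moreover have "g \<otimes> f = e I"
  proof -
    have "g \<otimes> f = v \<otimes> (e J \<otimes> (h \<otimes> e I))" using v h by (simp add: g_def f_def m_assoc)
    also have "\<dots> = v \<otimes> (h \<otimes> e I)" using h by (simp add: hI e_mult_left)
    also have "\<dots> = (v \<otimes> h) \<otimes> e I" using v h by (simp add: m_assoc)
    finally show ?thesis using vh by simp
  qed
  moreover have "f \<otimes> g = e J"
  proof -
    have "f \<otimes> g = h \<otimes> (e I \<otimes> (v \<otimes> e J))" using v h by (simp add: g_def f_def m_assoc)
    also have "\<dots> = h \<otimes> (v \<otimes> e J)" using v by (simp add: vI e_mult_left)
    also have "\<dots> = (h \<otimes> v) \<otimes> e J" using v h by (simp add: m_assoc)
    finally show ?thesis using hv by simp
  qed
  moreover have "f \<in> carrier E" "g \<in> carrier E" using h v by (auto simp: f_def g_def)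
  ultimately show ?thesis by blast
qed

end

section \<open>Filtered modules and their endomorphism rings\<close>

lemma (in abelian_group) minus_eq_zero_iff:
  assumes "x \<in> carrier G" "y \<in> carrier G"
  shows "x \<ominus> y = \<zero> \<longleftrightarrow> x = y"
proof
  assume "x \<ominus> y = \<zero>"
  moreover have "x = (x \<ominus> y) \<oplus> y" using assms by (simp add: a_minus_def a_assoc l_neg)
  ultimately show "x = y" using assms by simp
qed (use assms in \<open>simp add: a_minus_def r_neg\<close>)

text \<open>Up to isomorphism an object of the category is a module with a distinguished submodule,
  the image of \<open>A\<close>, and the morphisms are the homomorphisms that respect these
  submodules.\<close>

locale filtered_module = right_module R Z
  for R :: "('r, 'q) ring_scheme" and Z :: "('r, 'z) rmodule" (structure) +
  fixes F :: "'z set"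
  assumes F_submodule: "rsubmodule F R Z"
begin

text \<open>Extensionality on the carrier makes equality in this ring the same as equality of
  morphisms; the ring axioms could not hold literally for functions with arbitrary values
  elsewhere.\<close>

definition filtered_end where
  "filtered_end =
     \<lparr>carrier = {f \<in> rmod_hom R Z Z. f \<in> extensional (carrier Z) \<and> f ` F \<subseteq> F},
      monoid.mult = (\<lambda>f g. compose (carrier Z) f g),
      monoid.one = (\<lambda>z\<in>carrier Z. z),
      ring.zero = (\<lambda>z\<in>carrier Z. \<zero>),
      ring.add = (\<lambda>f g. \<lambda>z\<in>carrier Z. f z \<oplus> g z)\<rparr>"

abbreviation "E \<equiv> filtered_end"

lemma F_sub: "z \<in> F \<Longrightarrow> z \<in> carrier Z"
  and F_zero: "\<zero> \<in> F"
  and F_add: "z \<in> F \<Longrightarrow> w \<in> F \<Longrightarrow> z \<oplus> w \<in> F"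
  and F_neg: "z \<in> F \<Longrightarrow> \<ominus> z \<in> F"
  and F_smult: "z \<in> F \<Longrightarrow> a \<in> carrier R \<Longrightarrow> z \<star> a \<in> F"
proof -
  interpret additive_subgroup F Z using F_submodule by (simp add: rsubmodule_def)
  show "z \<in> F \<Longrightarrow> z \<in> carrier Z" "\<zero> \<in> F"
    "z \<in> F \<Longrightarrow> w \<in> F \<Longrightarrow> z \<oplus> w \<in> F"
    by auto
  show "z \<in> F \<Longrightarrow> \<ominus> z \<in> F"
    using subgroup.m_inv_closed[OF a_subgroup] by (simp add: a_inv_def)
  show "z \<in> F \<Longrightarrow> a \<in> carrier R \<Longrightarrow> z \<star> a \<in> F"
    using F_submodule by (simp add: rsubmodule_def)
qed

lemma smult_zero: "a \<in> carrier R \<Longrightarrow> \<zero> \<star> a = \<zero>"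
  using rsmult_l_distr[of "\<zero>" "\<zero>" a] by (simp add: M.add.r_cancel_one')

lemma smult_neg:
  assumes "z \<in> carrier Z" "a \<in> carrier R"
  shows "(\<ominus> z) \<star> a = \<ominus> (z \<star> a)"
  using rsmult_l_distr[of "\<ominus> z" z a] assms smult_zero
  by (intro M.minus_equality[symmetric]) (auto simp: M.l_neg)

lemma EI:
  assumes "f \<in> extensional (carrier Z)"
    and "\<And>z. z \<in> carrier Z \<Longrightarrow> f z \<in> carrier Z"
    and "\<And>z w. z \<in> carrier Z \<Longrightarrow> w \<in> carrier Z \<Longrightarrow> f (z \<oplus> w) = f z \<oplus> f w"
    and "\<And>z a. z \<in> carrier Z \<Longrightarrow> a \<in> carrier R \<Longrightarrow> f (z \<star> a) = f z \<star> a"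
    and "\<And>z. z \<in> F \<Longrightarrow> f z \<in> F"
  shows "f \<in> carrier E"
  using assms by (auto simp: filtered_end_def intro!: rmod_homI)

lemma E_ext: "f \<in> carrier E \<Longrightarrow> f \<in> extensional (carrier Z)"
  and E_closed [simp, intro]: "f \<in> carrier E \<Longrightarrow> z \<in> carrier Z \<Longrightarrow> f z \<in> carrier Z"
  and E_add: "f \<in> carrier E \<Longrightarrow> z \<in> carrier Z \<Longrightarrow> w \<in> carrier Z \<Longrightarrow> f (z \<oplus> w) = f z \<oplus> f w"
  and E_smult: "f \<in> carrier E \<Longrightarrow> z \<in> carrier Z \<Longrightarrow> a \<in> carrier R \<Longrightarrow> f (z \<star> a) = f z \<star> a"
  and E_F: "f \<in> carrier E \<Longrightarrow> z \<in> F \<Longrightarrow> f z \<in> F"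
  by (auto simp: filtered_end_def dest: rmod_hom_closed rmod_hom_add rmod_hom_rsmult)

lemma E_zero: "f \<in> carrier E \<Longrightarrow> f \<zero> = \<zero>"
  using E_add[of f "\<zero>" "\<zero>"] by (simp add: M.add.r_cancel_one')

lemma E_neg:
  assumes "f \<in> carrier E" "z \<in> carrier Z"
  shows "f (\<ominus> z) = \<ominus> f z"
  using E_add[of f "\<ominus> z" z] assms E_zero[OF assms(1)]
  by (intro M.minus_equality[symmetric]) (auto simp: M.l_neg)

lemma E_minus:
  "f \<in> carrier E \<Longrightarrow> z \<in> carrier Z \<Longrightarrow> w \<in> carrier Z \<Longrightarrow> f (z \<ominus> w) = f z \<ominus> f w"
  by (simp add: a_minus_def E_add E_neg)

lemma E_mult [simp]: "z \<in> carrier Z \<Longrightarrow> (f \<otimes>\<^bsub>E\<^esub> g) z = f (g z)"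
  and E_add_apply [simp]: "z \<in> carrier Z \<Longrightarrow> (f \<oplus>\<^bsub>E\<^esub> g) z = f z \<oplus> g z"
  and E_one [simp]: "z \<in> carrier Z \<Longrightarrow> \<one>\<^bsub>E\<^esub> z = z"
  and E_zero_apply [simp]: "z \<in> carrier Z \<Longrightarrow> \<zero>\<^bsub>E\<^esub> z = \<zero>"
  by (auto simp: filtered_end_def compose_def)

lemma E_eqI:
  "\<lbrakk>f \<in> carrier E; g \<in> carrier E; \<And>z. z \<in> carrier Z \<Longrightarrow> f z = g z\<rbrakk> \<Longrightarrow> f = g"
  by (intro extensionalityI[of f "carrier Z" g] E_ext)

lemma E_mult_closed: "f \<in> carrier E \<Longrightarrow> g \<in> carrier E \<Longrightarrow> f \<otimes>\<^bsub>E\<^esub> g \<in> carrier E"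
proof (rule EI)
  show "f \<otimes>\<^bsub>E\<^esub> g \<in> extensional (carrier Z)" by (simp add: filtered_end_def)
qed (auto simp: E_add E_smult E_F F_sub)

lemma E_add_closed: "f \<in> carrier E \<Longrightarrow> g \<in> carrier E \<Longrightarrow> f \<oplus>\<^bsub>E\<^esub> g \<in> carrier E"
  by (rule EI)
    (auto simp: E_add E_smult E_F F_sub F_add rsmult_l_distr M.a_ac
      filtered_end_def[THEN arg_cong[of _ _ ring.add]])

lemma E_one_closed: "\<one>\<^bsub>E\<^esub> \<in> carrier E"
  by (rule EI) (auto simp: F_sub filtered_end_def[THEN arg_cong[of _ _ monoid.one]])

lemma E_zero_closed: "\<zero>\<^bsub>E\<^esub> \<in> carrier E"
  by (rule EI) (auto simp: F_sub F_zero smult_zero filtered_end_def[THEN arg_cong[of _ _ ring.zero]])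

lemma ring_E: "ring E"
proof (intro ringI abelian_groupI monoidI)
  fix f assume f: "f \<in> carrier E"
  let ?g = "\<lambda>z\<in>carrier Z. \<ominus> f z"
  have g: "?g \<in> carrier E"
    using f by (intro EI) (auto simp: E_add E_smult E_F F_sub F_neg smult_neg M.minus_add)
  then show "\<exists>g\<in>carrier E. g \<oplus>\<^bsub>E\<^esub> f = \<zero>\<^bsub>E\<^esub>"
    using f by (intro bexI[of _ ?g] E_eqI E_add_closed E_zero_closed) (auto simp: M.l_neg)
qed (auto intro!: E_eqI E_add_closed E_mult_closed E_zero_closed E_one_closed
      simp: E_add M.a_ac)

section \<open>Subquotients of the filtration and congruence modulo their lower part\<close>

fun upper_part where
  "upper_part Idx_l = F"
| "upper_part Idx_u = carrier Z"

fun lower_part where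
  "lower_part Idx_l = {\<zero>}"
| "lower_part Idx_u = F"

text \<open>The subquotients \<open>P b / Q b\<close> are the submodule \<open>F\<close> and the quotient \<open>Z / F\<close>.\<close>

abbreviation "P \<equiv> upper_part"
abbreviation "Q \<equiv> lower_part"

lemma P_sub: "z \<in> P b \<Longrightarrow> z \<in> carrier Z"
  and Q_P: "z \<in> Q b \<Longrightarrow> z \<in> P b"
  and P_zero: "\<zero> \<in> P b"
  and Q_zero: "\<zero> \<in> Q b"
  and P_add: "z \<in> P b \<Longrightarrow> w \<in> P b \<Longrightarrow> z \<oplus> w \<in> P b"
  and Q_add: "z \<in> Q b \<Longrightarrow> w \<in> Q b \<Longrightarrow> z \<oplus> w \<in> Q b"
  and P_neg: "z \<in> P b \<Longrightarrow> \<ominus> z \<in> P b"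
  and Q_neg: "z \<in> Q b \<Longrightarrow> \<ominus> z \<in> Q b"
  and P_smult: "z \<in> P b \<Longrightarrow> a \<in> carrier R \<Longrightarrow> z \<star> a \<in> P b"
  and Q_smult: "z \<in> Q b \<Longrightarrow> a \<in> carrier R \<Longrightarrow> z \<star> a \<in> Q b"
  and E_P: "f \<in> carrier E \<Longrightarrow> z \<in> P b \<Longrightarrow> f z \<in> P b"
  and E_Q: "f \<in> carrier E \<Longrightarrow> z \<in> Q b \<Longrightarrow> f z \<in> Q b"
  by (cases b; auto simp: F_sub F_zero F_add F_neg F_smult E_F E_zero smult_zero)+

lemma P_minus: "z \<in> P b \<Longrightarrow> w \<in> P b \<Longrightarrow> z \<ominus> w \<in> P b"
  by (simp add: a_minus_def P_add P_neg)

text \<open>Equality in the subquotient, kept as a relation on representatives: no quotient module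
  is formed, and the lower and the upper side share all later proofs.\<close>

definition cong where
  "cong b z w \<longleftrightarrow> z \<in> P b \<and> w \<in> P b \<and> z \<ominus> w \<in> Q b"

lemma cong_refl: "z \<in> P b \<Longrightarrow> cong b z z"
  by (simp add: cong_def a_minus_def P_sub M.r_neg Q_zero)

lemma cong_sym:
  assumes "cong b z w"
  shows "cong b w z"
proof -
  have c: "z \<in> carrier Z" "w \<in> carrier Z" using assms by (auto simp: cong_def P_sub)
  have "\<ominus> (z \<ominus> w) \<in> Q b" using assms by (simp add: cong_def Q_neg)
  then show ?thesis
    using assms c by (simp add: cong_def a_minus_def M.minus_add M.a_comm)
qed

lemma cong_trans:
  assumes "cong b z w" "cong b w v"
  shows "cong b z v"
proof -
  have c: "z \<in> carrier Z" "w \<in> carrier Z" "v \<in> carrier Z" using assms by (auto simp: cong_def P_sub)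
  have "(z \<ominus> w) \<oplus> (w \<ominus> v) \<in> Q b" using assms by (auto simp: cong_def intro: Q_add)
  moreover have "(z \<ominus> w) \<oplus> (w \<ominus> v) = z \<ominus> v"
    using c by (simp add: a_minus_def M.a_assoc M.r_neg1)
  ultimately show ?thesis using assms by (simp add: cong_def)
qed

lemma cong_add:
  assumes "cong b z w" "cong b z' w'"
  shows "cong b (z \<oplus> z') (w \<oplus> w')"
proof -
  have c: "z \<in> carrier Z" "w \<in> carrier Z" "z' \<in> carrier Z" "w' \<in> carrier Z"
    using assms by (auto simp: cong_def P_sub)
  have "(z \<ominus> w) \<oplus> (z' \<ominus> w') \<in> Q b" using assms by (auto simp: cong_def intro: Q_add)
  moreover have "(z \<ominus> w) \<oplus> (z' \<ominus> w') = (z \<oplus> z') \<ominus> (w \<oplus> w')"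
    using c by (simp add: a_minus_def M.minus_add M.a_ac)
  ultimately show ?thesis using assms by (simp add: cong_def P_add)
qed

lemma cong_neg:
  assumes "cong b z w"
  shows "cong b (\<ominus> z) (\<ominus> w)"
proof -
  have c: "z \<in> carrier Z" "w \<in> carrier Z" using assms by (auto simp: cong_def P_sub)
  have "\<ominus> (z \<ominus> w) \<in> Q b" using assms by (simp add: cong_def Q_neg)
  then show ?thesis
    using assms c by (simp add: cong_def a_minus_def M.minus_add P_neg)
qed

lemma cong_smult:
  assumes "cong b z w" "a \<in> carrier R"
  shows "cong b (z \<star> a) (w \<star> a)"
proof -
  have c: "z \<in> carrier Z" "w \<in> carrier Z" using assms by (auto simp: cong_def P_sub)
  have "(z \<ominus> w) \<star> a \<in> Q b" using assms by (simp add: cong_def Q_smult)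
  then show ?thesis
    using assms c by (simp add: cong_def a_minus_def rsmult_l_distr smult_neg P_smult)
qed

lemma cong_E:
  assumes "cong b z w" "f \<in> carrier E"
  shows "cong b (f z) (f w)"
proof -
  have c: "z \<in> carrier Z" "w \<in> carrier Z" using assms by (auto simp: cong_def P_sub)
  have "f (z \<ominus> w) \<in> Q b" using assms by (simp add: cong_def E_Q)
  then show ?thesis using assms c by (simp add: cong_def E_minus E_P)
qed

lemma cong_zero: "z \<in> Q b \<longleftrightarrow> cong b z \<zero>"
proof (cases "z \<in> P b")
  case True
  have "\<ominus> \<zero> = \<zero>" by (rule M.minus_equality) auto
  then have "z \<ominus> \<zero> = z" using P_sub[OF True] by (simp add: a_minus_def)
  then show ?thesis using True by (simp add: cong_def P_zero)
qed (use Q_P[of z b] in \<open>auto simp: cong_def\<close>)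

lemma cong_Q: "cong b z w \<Longrightarrow> z \<in> Q b \<longleftrightarrow> w \<in> Q b"
  unfolding cong_zero using cong_trans cong_sym by blast

end

section \<open>Split filtered modules with uniserial factors\<close>

text \<open>Uniseriality of the subquotient of \<open>e {x}\<close> enters in its elementwise form:
  of two elements, one is a multiple of the other modulo \<open>Q b\<close>.\<close>

locale split_module = filtered_module R Z F
  for R :: "('r, 'q) ring_scheme" and Z :: "('r, 'z) rmodule" (structure) and F +
  fixes e :: "'x set \<Rightarrow> 'z \<Rightarrow> 'z" and X :: "'x set"
  assumes finite_X: "finite X"
    and e_E [simp, intro]: "e S \<in> carrier E"
    and e_e: "z \<in> carrier Z \<Longrightarrow> e S (e T z) = e (S \<inter> T) z"
    and e_un: "\<lbrakk>S \<inter> T = {}; z \<in> carrier Z\<rbrakk> \<Longrightarrow> e (S \<union> T) z = e S z \<oplus> e T z"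
    and e_X: "z \<in> carrier Z \<Longrightarrow> e X z = z"
    and uniserial: "\<lbrakk>x \<in> X; z \<in> P b; w \<in> P b\<rbrakk> \<Longrightarrow>
      (\<exists>a\<in>carrier R. cong b (e {x} z \<star> a) (e {x} w)) \<or>
      (\<exists>a\<in>carrier R. cong b (e {x} w \<star> a) (e {x} z))"
begin

sublocale orthogonal_idempotents E e X
proof -
  interpret E: ring E by (rule ring_E)
  show "orthogonal_idempotents E e X"
    by unfold_locales
      (auto simp: finite_X e_e e_un e_X intro!: E_eqI E.m_closed E.a_closed E.one_closed)
qed

section \<open>Injective and surjective entries between uniserial subquotients\<close>

definition nonzero_at :: "lu_index \<Rightarrow> 'x \<Rightarrow> bool" where
  "nonzero_at b x \<longleftrightarrow> (\<exists>z\<in>P b. e {x} z \<notin> Q b)"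

definition entry_injsurj :: "me_index \<Rightarrow> lu_index \<Rightarrow> 'x \<Rightarrow> 'x \<Rightarrow> ('z \<Rightarrow> 'z) \<Rightarrow> bool" where
  "entry_injsurj a b x y r \<longleftrightarrow>
     (case a of
        Idx_m \<Rightarrow> \<forall>z\<in>P b. e {y} (r (e {x} z)) \<in> Q b \<longrightarrow> e {x} z \<in> Q b
      | Idx_e \<Rightarrow> \<forall>w\<in>P b. \<exists>z\<in>P b. cong b (e {y} (r (e {x} z))) (e {y} w))"

definition type_supp :: "me_index \<times> lu_index \<Rightarrow> 'x \<Rightarrow> bool" where
  "type_supp t x \<longleftrightarrow> nonzero_at (snd t) x"

text \<open>The conditions on \<open>x\<close> and \<open>y\<close> are needed for the bad entries
  to form an ideal: out of a zero subquotient every map is injective, the zero map included, and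
  likewise every map into one is onto.\<close>

definition type_good :: "me_index \<times> lu_index \<Rightarrow> 'x \<Rightarrow> 'x \<Rightarrow> ('z \<Rightarrow> 'z) \<Rightarrow> bool" where
  "type_good t x y r \<longleftrightarrow> nonzero_at (snd t) x \<and> nonzero_at (snd t) y \<and>
     entry_injsurj (fst t) (snd t) x y r"

lemma uniserial_cases:
  assumes "x \<in> X" "z \<in> P b" "w \<in> P b"
  obtains a where "a \<in> carrier R" "cong b (e {x} (z \<star> a)) (e {x} w)"
  | a where "a \<in> carrier R" "cong b (e {x} (w \<star> a)) (e {x} z)"
  using uniserial[OF assms] assms by (auto simp: E_smult P_sub)

text \<open>Kernels in a uniserial module are comparable. If each of \<open>r\<close> and
  \<open>s\<close> kills something nonzero at \<open>x\<close>, one of the two elements is a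
  multiple of the other and is killed by both maps, hence by their sum.\<close>

lemma entry_m_add:
  assumes rs: "r \<in> carrier E" "s \<in> carrier E" and xy: "x \<in> X" "y \<in> X"
    and g: "entry_injsurj Idx_m b x y (r \<oplus>\<^bsub>E\<^esub> s)"
  shows "entry_injsurj Idx_m b x y r \<or> entry_injsurj Idx_m b x y s"
proof (rule ccontr)
  assume "\<not> ?thesis"
  then obtain z w where z: "z \<in> P b" "e {y} (r (e {x} z)) \<in> Q b" "e {x} z \<notin> Q b"
    and w: "w \<in> P b" "e {y} (s (e {x} w)) \<in> Q b" "e {x} w \<notin> Q b"
    by (auto simp: entry_injsurj_def)
  have both: False if v: "v \<in> P b" "e {y} (r (e {x} v)) \<in> Q b" "e {y} (s (e {x} v)) \<in> Q b" "e {x} v \<notin> Q b" for v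
  proof -
    have c: "v \<in> carrier Z" using v by (simp add: P_sub)
    have "e {y} ((r \<oplus>\<^bsub>E\<^esub> s) (e {x} v)) = e {y} (r (e {x} v)) \<oplus> e {y} (s (e {x} v))"
      using c rs by (simp add: E_closed E_add)
    then have "e {y} ((r \<oplus>\<^bsub>E\<^esub> s) (e {x} v)) \<in> Q b" using v by (simp add: Q_add)
    then show False using g v by (simp add: entry_injsurj_def)
  qed
  have kill: "e {y} (q (e {x} v)) \<in> Q b"
    if "a \<in> carrier R" "cong b (e {x} (u \<star> a)) (e {x} v)" "u \<in> P b" "e {y} (q (e {x} u)) \<in> Q b"
      "q \<in> carrier E" for a u v q
  proof -
    have c: "u \<in> carrier Z" using that by (simp add: P_sub)
    have "cong b (e {y} (q (e {x} (u \<star> a)))) (e {y} (q (e {x} v)))"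
      by (rule cong_E[OF cong_E[OF that(2,5)] e_E])
    moreover have "e {y} (q (e {x} (u \<star> a))) = e {y} (q (e {x} u)) \<star> a"
      using that c by (simp add: E_smult)
    ultimately show ?thesis using that Q_smult cong_Q by metis
  qed
  show False
    using xy(1) z(1) w(1)
  proof (cases rule: uniserial_cases)
    case (1 a)
    then show False using both[OF w(1)] kill[OF 1 z(1,2) rs(1)] w by blast
  next
    case (2 a)
    then show False using both[OF z(1)] kill[OF 2 w(1,2) rs(2)] z by blast
  qed
qed

text \<open>The source is the whole of \<open>P b\<close> instead of a single object, so that the
  notion also applies to a map restricted to a block.\<close>

definition onto :: "lu_index \<Rightarrow> 'x \<Rightarrow> ('z \<Rightarrow> 'z) \<Rightarrow> bool" where
  "onto b y h \<longleftrightarrow> (\<forall>w\<in>P b. \<exists>z\<in>P b. cong b (e {y} (h z)) (e {y} w))"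

text \<open>Two elements missed by \<open>r\<close> and by \<open>s\<close> respectively are
  comparable, so some \<open>u\<close> is missed by both. If the sum takes \<open>z\<close> to
  \<open>u\<close>, then \<open>r z\<close> and \<open>s z\<close> are comparable too; if, say,
  \<open>s z\<close> is \<open>r z\<close> times \<open>a\<close>, then \<open>u\<close> is the
  image of \<open>z \<oplus> z \<star> a\<close> under \<open>r\<close> alone.\<close>

lemma onto_add:
  assumes rs: "r \<in> carrier E" "s \<in> carrier E" and y: "y \<in> X" and g: "onto b y (r \<oplus>\<^bsub>E\<^esub> s)"
  shows "onto b y r \<or> onto b y s"
proof (rule ccontr)
  assume n: "\<not> ?thesis"
  define im where "im = (\<lambda>q w. \<exists>z\<in>P b. cong b (e {y} (q z)) (e {y} w))"
  obtain w v where w: "w \<in> P b" "\<not> im r w" and v: "v \<in> P b" "\<not> im s v"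
    using n by (auto simp: onto_def im_def)
  have im_smult: "im q v" if "a \<in> carrier R" "cong b (e {y} (u \<star> a)) (e {y} v)" "u \<in> P b" "im q u"
    "q \<in> carrier E" for a u v q
  proof -
    obtain z where z: "z \<in> P b" "cong b (e {y} (q z)) (e {y} u)"
      using \<open>im q u\<close> unfolding im_def by blast
    have c: "u \<in> carrier Z" "z \<in> carrier Z" using that z by (simp_all add: P_sub)
    have "cong b (e {y} (q z) \<star> a) (e {y} u \<star> a)" using z that by (intro cong_smult)
    then have "cong b (e {y} (q (z \<star> a))) (e {y} (u \<star> a))"
      using c that by (simp add: E_smult)
    then have "cong b (e {y} (q (z \<star> a))) (e {y} v)" using that cong_trans by blast
    then show ?thesis using z that P_smult unfolding im_def by blast
  qed
  have "\<exists>u\<in>P b. \<not> im r u \<and> \<not> im s u"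
    using y w(1) v(1)
  proof (cases rule: uniserial_cases)
    case (1 a)
    then show ?thesis using im_smult[OF 1 w(1) _ rs(2)] w v by blast
  next
    case (2 a)
    then show ?thesis using im_smult[OF 2 v(1) _ rs(1)] w v by blast
  qed
  then obtain u where u: "u \<in> P b" "\<not> im r u" "\<not> im s u" by blast
  obtain z where z: "z \<in> P b" "cong b (e {y} ((r \<oplus>\<^bsub>E\<^esub> s) z)) (e {y} u)"
    using g u by (auto simp: onto_def)
  have c: "z \<in> carrier Z" using z by (simp add: P_sub)
  have sum: "e {y} ((r \<oplus>\<^bsub>E\<^esub> s) z) = e {y} (r z) \<oplus> e {y} (s z)"
    using c rs by (simp add: E_closed E_add)
  have pz: "r z \<in> P b" "s z \<in> P b" using z rs by (simp_all add: E_P)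
  have "im r u \<or> im s u"
    using y pz
  proof (cases rule: uniserial_cases)
    case (1 a)
    have za: "z \<oplus> z \<star> a \<in> P b" using z 1 by (simp add: P_add P_smult)
    have "cong b (e {y} (r z) \<oplus> e {y} (r z \<star> a)) (e {y} (r z) \<oplus> e {y} (s z))"
      using 1 pz by (intro cong_add cong_refl) (auto intro: E_P)
    then have "cong b (e {y} (r (z \<oplus> z \<star> a))) (e {y} u)"
      using z(2) sum c rs 1 cong_trans by (simp add: E_closed E_add E_smult)
    then show ?thesis using za unfolding im_def by blast
  next
    case (2 a)
    have za: "z \<star> a \<oplus> z \<in> P b" using z 2 by (simp add: P_add P_smult)
    have "cong b (e {y} (s z \<star> a) \<oplus> e {y} (s z)) (e {y} (r z) \<oplus> e {y} (s z))"
      using 2 pz by (intro cong_add cong_refl) (auto intro: E_P)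
    then have "cong b (e {y} (s (z \<star> a \<oplus> z))) (e {y} u)"
      using z(2) sum c rs 2 cong_trans by (simp add: E_closed E_add E_smult)
    then show ?thesis using za unfolding im_def by blast
  qed
  then show False using u by blast
qed

lemma onto_cong: "(\<And>z. z \<in> carrier Z \<Longrightarrow> h z = k z) \<Longrightarrow> onto b y h \<longleftrightarrow> onto b y k"
  by (simp add: onto_def P_sub)

lemma entry_e_iff_onto: "entry_injsurj Idx_e b x y r \<longleftrightarrow> onto b y (r \<otimes>\<^bsub>E\<^esub> e {x})"
  by (simp add: entry_injsurj_def onto_def P_sub)

lemma entry_e_add:
  assumes "r \<in> carrier E" "s \<in> carrier E" "y \<in> X" "entry_injsurj Idx_e b x y (r \<oplus>\<^bsub>E\<^esub> s)"
  shows "entry_injsurj Idx_e b x y r \<or> entry_injsurj Idx_e b x y s"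
  using assms onto_add[of "r \<otimes>\<^bsub>E\<^esub> e {x}" "s \<otimes>\<^bsub>E\<^esub> e {x}" y b] l_distr[of r s "e {x}"]
  by (simp add: entry_e_iff_onto)

text \<open>The point is that an injective product forces the second factor to be injective on all
  of \<open>y\<close>, not only on the image of the first. Let \<open>s\<close> kill
  \<open>w\<close>, and let \<open>q\<close> be a nonzero value of \<open>r\<close> at
  \<open>y\<close>. If \<open>w\<close> is a multiple of \<open>q\<close>, it is a value of
  \<open>r\<close> killed by \<open>s\<close>, so it vanishes by injectivity of the product. If
  \<open>q\<close> is a multiple of \<open>w\<close>, then \<open>s\<close> kills \<open>q\<close>,
  which is impossible.\<close>

lemma entry_m_mult:
  assumes rs: "r \<in> carrier E" "s \<in> carrier E" and xyz: "x \<in> X" "y \<in> X" "z \<in> X"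
  shows "nonzero_at b x \<and> nonzero_at b z \<and> entry_injsurj Idx_m b x z (s \<otimes>\<^bsub>E\<^esub> (e {y} \<otimes>\<^bsub>E\<^esub> r)) \<longleftrightarrow>
    (nonzero_at b x \<and> nonzero_at b y \<and> entry_injsurj Idx_m b x y r) \<and>
    (nonzero_at b y \<and> nonzero_at b z \<and> entry_injsurj Idx_m b y z s)" (is "?L \<longleftrightarrow> ?R")
proof
  have prod: "(s \<otimes>\<^bsub>E\<^esub> (e {y} \<otimes>\<^bsub>E\<^esub> r)) (e {x} p) = s (e {y} (r (e {x} p)))" if "p \<in> P b" for p
    using that rs P_sub[OF that] by simp
  show ?R if L: ?L
  proof -
    have inj: "e {x} p \<in> Q b" if "p \<in> P b" "e {z} (s (e {y} (r (e {x} p)))) \<in> Q b" for p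
      using L that prod by (auto simp: entry_injsurj_def)
    obtain p where p: "p \<in> P b" "e {x} p \<notin> Q b" using L by (auto simp: nonzero_at_def)
    define q where "q = r (e {x} p)"
    have q: "q \<in> P b" "e {y} q \<notin> Q b"
      using p inj rs by (auto simp: q_def intro: E_P E_Q)
    have 1: "nonzero_at b y" using q by (auto simp: nonzero_at_def)
    have 2: "entry_injsurj Idx_m b x y r"
      unfolding entry_injsurj_def using inj rs by (auto intro: E_Q)
    have "e {y} w \<in> Q b" if w: "w \<in> P b" "e {z} (s (e {y} w)) \<in> Q b" for w
      using xyz(2) q(1) w(1)
    proof (cases rule: uniserial_cases)
      case (1 a)
      have "cong b (e {z} (s (e {y} (q \<star> a)))) (e {z} (s (e {y} w)))"
        by (rule cong_E[OF cong_E[OF 1(2) rs(2)] e_E])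
      then have "e {z} (s (e {y} (q \<star> a))) \<in> Q b" using w cong_Q by blast
      moreover have qa: "q \<star> a = r (e {x} (p \<star> a))"
        using 1 rs P_sub[OF p(1)] by (simp add: q_def E_smult)
      ultimately have "e {x} (p \<star> a) \<in> Q b" using inj p 1 by (simp add: P_smult)
      then have "e {y} (q \<star> a) \<in> Q b" using qa rs by (simp add: E_Q)
      then show ?thesis using 1 cong_Q by blast
    next
      case (2 a)
      have "cong b (e {z} (s (e {y} (w \<star> a)))) (e {z} (s (e {y} q)))"
        by (rule cong_E[OF cong_E[OF 2(2) rs(2)] e_E])
      moreover have "e {z} (s (e {y} (w \<star> a))) \<in> Q b"
        using 2 rs w P_sub[OF w(1)] by (simp add: E_smult Q_smult)
      ultimately have "e {z} (s (e {y} q)) \<in> Q b" using cong_Q by blast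
      then show ?thesis using inj p by (simp add: q_def)
    qed
    then show ?R using L 1 2 by (auto simp: entry_injsurj_def)
  qed
  show ?L if R: ?R
  proof -
    have "e {x} p \<in> Q b" if "p \<in> P b" "e {z} ((s \<otimes>\<^bsub>E\<^esub> (e {y} \<otimes>\<^bsub>E\<^esub> r)) (e {x} p)) \<in> Q b" for p
      using R that prod[OF that(1)] rs E_P[of r "e {x} p" b] E_P[of "e {x}" p b]
      by (auto simp: entry_injsurj_def)
    then show ?L using R by (auto simp: entry_injsurj_def)
  qed
qed

text \<open>Dually, a surjective product forces the first factor to be onto. If \<open>r\<close>
  misses \<open>w\<close>, subtract from \<open>w\<close> a value of \<open>r\<close> with the same
  image under \<open>s\<close>; the difference \<open>d\<close> is killed by \<open>s\<close>. No
  value of \<open>r\<close> can have \<open>d\<close> as a multiple, since then \<open>w\<close>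
  would be a value, so all values of \<open>r\<close> are multiples of \<open>d\<close> and are
  killed by \<open>s\<close>. The product would be zero.\<close>

lemma entry_e_mult:
  assumes rs: "r \<in> carrier E" "s \<in> carrier E" and xyz: "x \<in> X" "y \<in> X" "z \<in> X"
  shows "nonzero_at b x \<and> nonzero_at b z \<and> entry_injsurj Idx_e b x z (s \<otimes>\<^bsub>E\<^esub> (e {y} \<otimes>\<^bsub>E\<^esub> r)) \<longleftrightarrow>
    (nonzero_at b x \<and> nonzero_at b y \<and> entry_injsurj Idx_e b x y r) \<and>
    (nonzero_at b y \<and> nonzero_at b z \<and> entry_injsurj Idx_e b y z s)" (is "?L \<longleftrightarrow> ?R")
proof
  have prod: "(s \<otimes>\<^bsub>E\<^esub> (e {y} \<otimes>\<^bsub>E\<^esub> r)) (e {x} p) = s (e {y} (r (e {x} p)))" if "p \<in> P b" for p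
    using that rs P_sub[OF that] by simp
  show ?R if L: ?L
  proof -
    have sur: "\<exists>p\<in>P b. cong b (e {z} (s (e {y} (r (e {x} p))))) (e {z} w)" if "w \<in> P b" for w
      using L that prod by (fastforce simp: entry_injsurj_def)
    obtain v where v: "v \<in> P b" "e {z} v \<notin> Q b" using L by (auto simp: nonzero_at_def)
    have rP: "r (e {x} p) \<in> P b" if "p \<in> P b" for p using that rs by (simp add: E_P)
    have 1: "nonzero_at b y"
    proof -
      obtain p where p: "p \<in> P b" "cong b (e {z} (s (e {y} (r (e {x} p))))) (e {z} v)"
        using sur v by blast
      then have "e {y} (r (e {x} p)) \<notin> Q b" using v rs cong_Q E_Q by blast
      then show ?thesis using rP p by (auto simp: nonzero_at_def)
    qed
    have 2: "entry_injsurj Idx_e b y z s"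
      unfolding entry_injsurj_def using sur rP by auto
    have "\<exists>p\<in>P b. cong b (e {y} (r (e {x} p))) (e {y} w)" if w: "w \<in> P b" for w
    proof (rule ccontr)
      assume nim: "\<not> ?thesis"
      obtain p0 where p0: "p0 \<in> P b" "cong b (e {z} (s (e {y} (r (e {x} p0))))) (e {z} (s (e {y} w)))"
        using sur[of "s (e {y} w)"] w rs by (auto simp: E_P)
      define d where "d = w \<ominus> r (e {x} p0)"
      have c: "w \<in> carrier Z" "p0 \<in> carrier Z" using w p0 by (auto simp: P_sub)
      have d: "d \<in> P b" using w rP[OF p0(1)] by (simp add: d_def P_minus)
      have "e {z} (s (e {y} d)) = e {z} (s (e {y} w)) \<ominus> e {z} (s (e {y} (r (e {x} p0))))"
        using rs c by (simp add: d_def E_minus)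
      then have sd: "e {z} (s (e {y} d)) \<in> Q b"
        using cong_sym[OF p0(2)] by (simp add: cong_def)
      have "e {z} (s (e {y} (r (e {x} p)))) \<in> Q b" if p: "p \<in> P b" for p
        using xyz(2) rP[OF p] d
      proof (cases rule: uniserial_cases)
        case (1 a)
        have cp: "p \<in> carrier Z" using p by (rule P_sub)
        have "cong b (e {y} (r (e {x} p) \<star> a) \<oplus> e {y} (r (e {x} p0)))
            (e {y} d \<oplus> e {y} (r (e {x} p0)))"
          using 1 rP[OF p0(1)] by (intro cong_add cong_refl) (auto intro: E_P)
        moreover have "e {y} d \<oplus> e {y} (r (e {x} p0)) = e {y} w"
          using rs c by (simp add: d_def E_add E_neg a_minus_def M.a_assoc M.l_neg)
        moreover have "e {y} (r (e {x} p) \<star> a) \<oplus> e {y} (r (e {x} p0)) =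
            e {y} (r (e {x} (p \<star> a \<oplus> p0)))"
          using rs c cp 1 by (simp add: E_add E_smult)
        ultimately have "cong b (e {y} (r (e {x} (p \<star> a \<oplus> p0)))) (e {y} w)" by simp
        moreover have "p \<star> a \<oplus> p0 \<in> P b" using p p0 1 by (simp add: P_add P_smult)
        ultimately show ?thesis using nim by blast
      next
        case (2 a)
        have "cong b (e {z} (s (e {y} (d \<star> a)))) (e {z} (s (e {y} (r (e {x} p)))))"
          by (rule cong_E[OF cong_E[OF 2(2) rs(2)] e_E])
        moreover have "e {z} (s (e {y} (d \<star> a))) \<in> Q b"
          using 2 rs sd P_sub[OF d] by (simp add: E_smult Q_smult)
        ultimately show ?thesis using cong_Q by blast
      qed
      moreover obtain p where "p \<in> P b" "cong b (e {z} (s (e {y} (r (e {x} p))))) (e {z} v)"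
        using sur v by blast
      ultimately show False using v cong_Q by blast
    qed
    then show ?R using L 1 2 by (auto simp: entry_injsurj_def)
  qed
  show ?L if R: ?R
  proof -
    have "\<exists>p\<in>P b. cong b (e {z} ((s \<otimes>\<^bsub>E\<^esub> (e {y} \<otimes>\<^bsub>E\<^esub> r)) (e {x} p))) (e {z} w)" if w: "w \<in> P b" for w
    proof -
      obtain v where v: "v \<in> P b" "cong b (e {z} (s (e {y} v))) (e {z} w)"
        using R w by (auto simp: entry_injsurj_def)
      obtain p where p: "p \<in> P b" "cong b (e {y} (r (e {x} p))) (e {y} v)"
        using R v by (auto simp: entry_injsurj_def)
      have "cong b (e {z} (s (e {y} (r (e {x} p))))) (e {z} (s (e {y} v)))"
        by (rule cong_E[OF cong_E[OF p(2) rs(2)] e_E])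
      then show ?thesis using v p prod cong_trans by (intro bexI[of _ p]) auto
    qed
    then show ?L using R by (auto simp: entry_injsurj_def)
  qed
qed

text \<open>The five lemma for the filtration \<open>0 \<subseteq> F \<subseteq> Z\<close>.\<close>

lemma entry_unit:
  assumes r: "r \<in> carrier E" and x: "x \<in> X"
    and good: "\<And>a b. nonzero_at b x \<Longrightarrow> entry_injsurj a b x x r"
  shows "\<exists>u\<in>carrier E. e {x} \<otimes>\<^bsub>E\<^esub> (u \<otimes>\<^bsub>E\<^esub> e {x}) = u \<and> u \<otimes>\<^bsub>E\<^esub> (r \<otimes>\<^bsub>E\<^esub> e {x}) = e {x}"
proof -
  define k where "k = (\<lambda>z. e {x} (r (e {x} z)))"
  have idem: "e {x} (e {x} z) = e {x} z" if "z \<in> carrier Z" for z using e_e[OF that] by simp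
  have kZ: "k z \<in> carrier Z" if "z \<in> carrier Z" for z using that r by (simp add: k_def)
  have inj: "e {x} z \<in> Q b" if "z \<in> P b" "k z \<in> Q b" for z b
    using that good[of b Idx_m] by (auto simp: entry_injsurj_def nonzero_at_def k_def)
  have sur: "\<exists>z\<in>P b. cong b (k z) (e {x} w)" if w: "w \<in> P b" for w b
  proof (cases "nonzero_at b x")
    case True
    then show ?thesis using w good[of b Idx_e] by (auto simp: entry_injsurj_def k_def)
  next
    case False
    have "k \<zero> = \<zero>" using r by (simp add: k_def E_zero)
    moreover have "cong b (e {x} w) \<zero>"
      using False w cong_zero by (auto simp: nonzero_at_def)
    ultimately have "cong b (k \<zero>) (e {x} w)" using cong_sym by simp
    then show ?thesis using P_zero by blast
  qed
  \<comment> \<open>Injectivity on the quotient by \<open>F\<close> moves the kernel into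
    \<open>F\<close>, where injectivity on \<open>F\<close> applies.\<close>
  have k0: "e {x} z = \<zero>" if z: "z \<in> carrier Z" "k z = \<zero>" for z
  proof -
    have "e {x} z \<in> F" using inj[of z Idx_u] z F_zero by simp
    moreover have "k (e {x} z) = \<zero>" using z idem by (simp add: k_def)
    ultimately show ?thesis using inj[of "e {x} z" Idx_l] z idem by simp
  qed
  have ksum: "k (z \<oplus> w) = k z \<oplus> k w" "k (z \<ominus> w) = k z \<ominus> k w"
    if "z \<in> carrier Z" "w \<in> carrier Z" for z w
    using that r by (simp_all add: k_def E_add E_minus)
  have ex: "\<exists>z\<in>carrier Z. k z = e {x} w \<and> e {x} z = z" if w: "w \<in> carrier Z" for w
  proof -
    obtain z where z: "z \<in> carrier Z" "cong Idx_u (k z) (e {x} w)" using sur[of w Idx_u] w by auto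
    \<comment> \<open>The error of a preimage that is correct only modulo \<open>F\<close>. It lies
      in \<open>F\<close>, so it has a preimage there, which corrects \<open>z\<close>.\<close>
    define d where "d = e {x} w \<ominus> k z"
    have d: "d \<in> F" "d \<in> carrier Z" using cong_sym[OF z(2)] by (auto simp: cong_def d_def F_sub)
    have ed: "e {x} d = d"
      using w z r idem by (simp add: d_def k_def E_minus)
    obtain v where v: "v \<in> F" "cong Idx_l (k v) (e {x} d)" using sur[of d Idx_l] d by auto
    have vZ: "v \<in> carrier Z" using v by (simp add: F_sub)
    have "k v \<ominus> d = \<zero>" using v ed by (simp add: cong_def)
    then have "k v = d" using kZ[OF vZ] d M.minus_eq_zero_iff by blast
    then have "k (z \<oplus> v) = e {x} w"
      using z vZ kZ w by (simp add: ksum d_def a_minus_def M.a_ac M.r_neg M.r_neg1 M.r_neg2)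
    moreover have "k (e {x} (z \<oplus> v)) = k (z \<oplus> v)" using z vZ idem by (simp add: k_def)
    ultimately show ?thesis using z vZ idem by (intro bexI[of _ "e {x} (z \<oplus> v)"]) auto
  qed
  have uniq: "z = z'" if "z \<in> carrier Z" "z' \<in> carrier Z" "k z = k z'" "e {x} z = z" "e {x} z' = z'" for z z'
  proof -
    have "k (z \<ominus> z') = \<zero>" using that kZ by (simp only: ksum) (simp add: a_minus_def M.r_neg)
    then have "e {x} (z \<ominus> z') = \<zero>" using k0 that by simp
    then have "z \<ominus> z' = \<zero>" using that by (simp add: E_minus)
    then show ?thesis using that M.minus_eq_zero_iff by blast
  qed
  have "\<exists>u. \<forall>w\<in>carrier Z. u w \<in> carrier Z \<and> k (u w) = e {x} w \<and> e {x} (u w) = u w"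
    using ex by (intro bchoice) blast
  then obtain u0 where "\<forall>w\<in>carrier Z. u0 w \<in> carrier Z \<and> k (u0 w) = e {x} w \<and> e {x} (u0 w) = u0 w"
    by (rule exE)
  then have u0: "u0 w \<in> carrier Z" "k (u0 w) = e {x} w" "e {x} (u0 w) = u0 w"
    if "w \<in> carrier Z" for w
    using that by simp_all
  define u where "u = (\<lambda>w\<in>carrier Z. u0 w)"
  have u: "u \<in> carrier E"
  proof (rule EI)
    fix z w assume zw: "z \<in> carrier Z" "w \<in> carrier Z"
    have "u0 (z \<oplus> w) = u0 z \<oplus> u0 w"
    proof (rule uniq)
      have "k (u0 (z \<oplus> w)) = e {x} z \<oplus> e {x} w"
        using u0(2)[of "z \<oplus> w"] zw by (simp add: E_add)
      also have "\<dots> = k (u0 z \<oplus> u0 w)" using u0(1,2) zw by (simp add: ksum)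
      finally show "k (u0 (z \<oplus> w)) = k (u0 z \<oplus> u0 w)" .
    qed (use u0(1,3) zw in \<open>simp_all add: E_add\<close>)
    then show "u (z \<oplus> w) = u z \<oplus> u w" using zw by (simp add: u_def)
  next
    fix z a assume za: "z \<in> carrier Z" "a \<in> carrier R"
    have "u0 (z \<star> a) = u0 z \<star> a"
    proof (rule uniq)
      have "k (u0 (z \<star> a)) = e {x} z \<star> a"
        using u0(2)[of "z \<star> a"] za by (simp add: E_smult)
      also have "\<dots> = k (u0 z) \<star> a" using u0(2) za by simp
      also have "\<dots> = k (u0 z \<star> a)" using u0(1) za r by (simp add: k_def E_smult)
      finally show "k (u0 (z \<star> a)) = k (u0 z \<star> a)" .
    qed (use u0(1,3) za in \<open>simp_all add: E_smult\<close>)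
    then show "u (z \<star> a) = u z \<star> a" using za by (simp add: u_def)
  next
    fix w assume w: "w \<in> F"
    have wZ: "w \<in> carrier Z" using w by (rule F_sub)
    \<comment> \<open>The inverse respects the filtration because \<open>k\<close> is injective
      modulo \<open>F\<close>; bijectivity on the middle term alone would not give this.\<close>
    have "k (u0 w) \<in> F" using w wZ u0 by (simp add: E_F)
    then show "u w \<in> F" using inj[of "u0 w" Idx_u] u0[OF wZ] wZ by (simp add: u_def)
  qed (auto simp: u_def u0)
  have "u (r (e {x} z)) = e {x} z" if z: "z \<in> carrier Z" for z
  proof -
    have rz: "r (e {x} z) \<in> carrier Z" using z r by simp
    have "k (u0 (r (e {x} z))) = k (e {x} z)" using u0(2)[OF rz] z idem by (simp add: k_def)
    then show ?thesis using uniq[OF u0(1)[OF rz] _ _ u0(3)[OF rz]] z idem rz by (simp add: u_def)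
  qed
  moreover have "e {x} (u (e {x} z)) = u z" if z: "z \<in> carrier Z" for z
  proof -
    have ez: "e {x} z \<in> carrier Z" using z by simp
    have "k (u0 (e {x} z)) = k (u0 z)" by (simp only: u0(2)[OF z] u0(2)[OF ez] idem[OF z])
    then have "u0 (e {x} z) = u0 z"
      by (rule uniq[OF u0(1)[OF ez] u0(1)[OF z] _ u0(3)[OF ez] u0(3)[OF z]])
    then show ?thesis using z ez u0(3)[OF z] by (simp add: u_def)
  qed
  ultimately show ?thesis using u r
    by (intro bexI[of _ u] conjI E_eqI) (auto intro!: E_mult_closed)
qed

sublocale good_maps E e X type_supp type_good
proof unfold_locales
  have "(UNIV :: me_index set) = {Idx_m, Idx_e}" "(UNIV :: lu_index set) = {Idx_l, Idx_u}"
    using me_index.exhaust lu_index.exhaust by auto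
  then have "finite (UNIV :: me_index set)" "finite (UNIV :: lu_index set)"
    by (metis finite.emptyI finite.insertI)+
  then show "finite (UNIV :: (me_index \<times> lu_index) set)" by (simp add: finite_prod)
  show "type_good t x y r \<Longrightarrow> type_supp t x \<and> type_supp t y" for t x y r
    by (simp add: type_good_def type_supp_def)
  show "type_good t x y (e {y} \<otimes>\<^bsub>E\<^esub> (r \<otimes>\<^bsub>E\<^esub> e {x})) \<longleftrightarrow> type_good t x y r"
    if r: "r \<in> carrier E" for t x y r
  proof -
    have "e {y} ((e {y} \<otimes>\<^bsub>E\<^esub> (r \<otimes>\<^bsub>E\<^esub> e {x})) (e {x} z)) = e {y} (r (e {x} z))"
      if "z \<in> P (snd t)" for z
      using r P_sub[OF that] by (simp add: e_e)
    then show ?thesis by (simp add: type_good_def entry_injsurj_def split: me_index.split)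
  qed
  show "type_good t x y r \<or> type_good t x y s"
    if "type_good t x y (r \<oplus>\<^bsub>E\<^esub> s)" "r \<in> carrier E" "s \<in> carrier E" "x \<in> X" "y \<in> X" for t x y r s
    using that entry_m_add[of r s x y "snd t"] entry_e_add[of r s y "snd t" x]
    by (cases "fst t") (auto simp: type_good_def)
  show "type_good t x z (s \<otimes>\<^bsub>E\<^esub> (e {y} \<otimes>\<^bsub>E\<^esub> r)) \<longleftrightarrow> type_good t x y r \<and> type_good t y z s"
    if "r \<in> carrier E" "s \<in> carrier E" "x \<in> X" "y \<in> X" "z \<in> X" for t x y z r s
    using entry_m_mult[OF that, of "snd t"] entry_e_mult[OF that, of "snd t"]
    by (cases "fst t") (auto simp: type_good_def)
  show "\<not> type_good t x y \<zero>\<^bsub>E\<^esub>" for t x y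
  proof
    assume g: "type_good t x y \<zero>\<^bsub>E\<^esub>"
    let ?b = "snd t"
    have zero: "e {y} (\<zero>\<^bsub>E\<^esub> (e {x} z)) = \<zero>" if "z \<in> P ?b" for z
      using P_sub[OF that] by (simp add: E_zero)
    obtain z w where "z \<in> P ?b" "e {x} z \<notin> Q ?b" "w \<in> P ?b" "e {y} w \<notin> Q ?b"
      using g by (auto simp: type_good_def nonzero_at_def)
    then show False
      using g zero Q_zero cong_sym cong_zero
      by (cases "fst t") (fastforce simp: type_good_def entry_injsurj_def)+
  qed
  show "type_good t x x \<one>\<^bsub>E\<^esub>" if "type_supp t x" for t x
  proof -
    have one: "e {x} (\<one>\<^bsub>E\<^esub> (e {x} z)) = e {x} z" if "z \<in> P (snd t)" for z
      using P_sub[OF that] by (simp add: e_e)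
    then have "\<exists>z\<in>P (snd t). cong (snd t) (e {x} (\<one>\<^bsub>E\<^esub> (e {x} z))) (e {x} w)"
      if "w \<in> P (snd t)" for w
      using that cong_refl[OF E_P[OF e_E that]] by (intro bexI[of _ w]) auto
    then show ?thesis
      using that one by (auto simp: type_good_def type_supp_def entry_injsurj_def split: me_index.split)
  qed
  show "\<exists>u\<in>carrier E. e {x} \<otimes>\<^bsub>E\<^esub> (u \<otimes>\<^bsub>E\<^esub> e {x}) = u \<and> u \<otimes>\<^bsub>E\<^esub> (r \<otimes>\<^bsub>E\<^esub> e {x}) = e {x}"
    if "r \<in> carrier E" "x \<in> X" "\<And>t. type_supp t x \<Longrightarrow> type_good t x x r" for r x
  proof (rule entry_unit[OF that(1,2)])
    show "entry_injsurj a b x x r" if "nonzero_at b x" for a b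
      using \<open>\<And>t. type_supp t x \<Longrightarrow> type_good t x x r\<close>[of "(a, b)"] that
      by (simp add: type_supp_def type_good_def)
  qed
qed

end

section \<open>Counting classes\<close>

context split_module
begin

text \<open>By the correspondence theorem these represent the submodules of the subquotient for
  \<open>b\<close>.\<close>

definition sub_between :: "lu_index \<Rightarrow> 'z set \<Rightarrow> bool" where
  "sub_between b N \<longleftrightarrow> Q b \<subseteq> N \<and> N \<subseteq> P b \<and> (\<forall>z\<in>N. \<forall>w\<in>N. z \<oplus> w \<in> N) \<and>
     (\<forall>z\<in>N. \<ominus> z \<in> N) \<and> (\<forall>z\<in>N. \<forall>a\<in>carrier R. z \<star> a \<in> N)"

definition sub_sum :: "'z set \<Rightarrow> 'z set \<Rightarrow> 'z set" where
  "sub_sum N M = {z \<oplus> w |z w. z \<in> N \<and> w \<in> M}"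

lemma sub_betweenD:
  assumes "sub_between b N"
  shows "z \<in> Q b \<Longrightarrow> z \<in> N" "z \<in> N \<Longrightarrow> z \<in> P b" "z \<in> N \<Longrightarrow> z \<in> carrier Z"
    "z \<in> N \<Longrightarrow> w \<in> N \<Longrightarrow> z \<oplus> w \<in> N" "z \<in> N \<Longrightarrow> \<ominus> z \<in> N"
    "z \<in> N \<Longrightarrow> a \<in> carrier R \<Longrightarrow> z \<star> a \<in> N"
  using assms P_sub by (auto simp: sub_between_def)

lemma sub_between_cong:
  assumes N: "sub_between b N" and "z \<in> N" "cong b z w"
  shows "w \<in> N"
proof -
  have c: "z \<in> carrier Z" "w \<in> carrier Z" using assms(3) by (auto simp: cong_def P_sub)
  have "w \<ominus> z \<in> N" using cong_sym[OF assms(3)] sub_betweenD(1)[OF N] by (simp add: cong_def)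
  then have "(w \<ominus> z) \<oplus> z \<in> N" using sub_betweenD(4)[OF N] assms by blast
  then show ?thesis using c by (simp add: a_minus_def M.a_assoc M.l_neg)
qed

lemma sub_between_Q: "sub_between b (Q b)" and sub_between_P: "sub_between b (P b)"
  by (auto simp: sub_between_def Q_P Q_add Q_neg Q_smult P_add P_neg P_smult)

lemma sub_between_Int: "\<lbrakk>sub_between b N; sub_between b M\<rbrakk> \<Longrightarrow> sub_between b (N \<inter> M)"
  by (auto simp: sub_between_def)

lemma sub_sum_upper:
  assumes "sub_between b N" "sub_between b M"
  shows "N \<subseteq> sub_sum N M" "M \<subseteq> sub_sum N M"
proof -
  show "N \<subseteq> sub_sum N M"
  proof
    fix z assume z: "z \<in> N"
    then have "z = z \<oplus> \<zero>" using sub_betweenD(3)[OF assms(1)] by simp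
    then show "z \<in> sub_sum N M" using z sub_betweenD(1)[OF assms(2) Q_zero] unfolding sub_sum_def by blast
  qed
  show "M \<subseteq> sub_sum N M"
  proof
    fix z assume z: "z \<in> M"
    then have "z = \<zero> \<oplus> z" using sub_betweenD(3)[OF assms(2)] by simp
    then show "z \<in> sub_sum N M" using z sub_betweenD(1)[OF assms(1) Q_zero] unfolding sub_sum_def by blast
  qed
qed

lemma sub_sum_least: "\<lbrakk>N \<subseteq> U; M \<subseteq> U; sub_between b U\<rbrakk> \<Longrightarrow> sub_sum N M \<subseteq> U"
  using sub_betweenD(4) by (fastforce simp: sub_sum_def)

lemma sub_between_sum:
  assumes N: "sub_between b N" and M: "sub_between b M"
  shows "sub_between b (sub_sum N M)"
  unfolding sub_between_def
proof (intro conjI ballI)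
  show "Q b \<subseteq> sub_sum N M" using sub_sum_upper[OF N M] sub_betweenD(1)[OF N] by blast
  show "sub_sum N M \<subseteq> P b"
    using sub_sum_least[OF _ _ sub_between_P] sub_betweenD(2)[OF N] sub_betweenD(2)[OF M] by blast
next
  fix p q assume "p \<in> sub_sum N M" "q \<in> sub_sum N M"
  then obtain z w z' w' where pq: "p = z \<oplus> w" "q = z' \<oplus> w'" "z \<in> N" "z' \<in> N" "w \<in> M" "w' \<in> M"
    by (auto simp: sub_sum_def)
  then have "z \<in> carrier Z" "z' \<in> carrier Z" "w \<in> carrier Z" "w' \<in> carrier Z"
    using sub_betweenD(3)[OF N] sub_betweenD(3)[OF M] by auto
  then have "p \<oplus> q = (z \<oplus> z') \<oplus> (w \<oplus> w')" using pq by (simp add: M.a_ac)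
  then show "p \<oplus> q \<in> sub_sum N M"
    using pq sub_betweenD(4)[OF N] sub_betweenD(4)[OF M] unfolding sub_sum_def by blast
next
  fix p assume "p \<in> sub_sum N M"
  then obtain z w where p: "p = z \<oplus> w" "z \<in> N" "w \<in> M" by (auto simp: sub_sum_def)
  then have c: "z \<in> carrier Z" "w \<in> carrier Z"
    using sub_betweenD(3)[OF N] sub_betweenD(3)[OF M] by auto
  then have "\<ominus> p = (\<ominus> z) \<oplus> (\<ominus> w)" using p by (simp add: M.minus_add)
  then show "\<ominus> p \<in> sub_sum N M"
    using p sub_betweenD(5)[OF N] sub_betweenD(5)[OF M] unfolding sub_sum_def by blast
  fix a assume a: "a \<in> carrier R"
  have "p \<star> a = z \<star> a \<oplus> w \<star> a" using p c a by (simp add: rsmult_l_distr)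
  then show "p \<star> a \<in> sub_sum N M"
    using p a sub_betweenD(6)[OF N] sub_betweenD(6)[OF M] unfolding sub_sum_def by blast
qed

lemma modular_law:
  assumes A: "sub_between b A" and B: "sub_between b B" and C: "sub_between b C" and "A \<subseteq> C"
  shows "sub_sum A (B \<inter> C) = sub_sum A B \<inter> C"
proof
  show "sub_sum A (B \<inter> C) \<subseteq> sub_sum A B \<inter> C"
    using assms(4) sub_betweenD(4)[OF C] by (auto simp: sub_sum_def)
  show "sub_sum A B \<inter> C \<subseteq> sub_sum A (B \<inter> C)"
  proof
    fix p assume p: "p \<in> sub_sum A B \<inter> C"
    then obtain z w where zw: "p = z \<oplus> w" "z \<in> A" "w \<in> B" by (auto simp: sub_sum_def)
    have c: "z \<in> carrier Z" "w \<in> carrier Z" using zw sub_betweenD(3)[OF A] sub_betweenD(3)[OF B] by auto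
    have "w = \<ominus> z \<oplus> p" using zw c by (simp add: M.r_neg1)
    moreover have "\<ominus> z \<oplus> p \<in> C"
      using p zw assms(4) sub_betweenD(4,5)[OF C] by blast
    ultimately have "w \<in> C" by simp
    then show "p \<in> sub_sum A (B \<inter> C)" using zw by (auto simp: sub_sum_def)
  qed
qed

lemma sub_sum_commute:
  assumes "sub_between b N" "sub_between b M"
  shows "sub_sum N M = sub_sum M N"
proof -
  have "sub_sum N M \<subseteq> sub_sum M N" if "sub_between b N" "sub_between b M" for N M
    using sub_sum_least[OF sub_sum_upper(2,1)[OF that(2,1)] sub_between_sum[OF that(2,1)]] .
  then show ?thesis using assms by blast
qed

lemma lattice_between:
  "modular_lattice {N. sub_between b N} (\<subseteq>) (\<inter>) sub_sum (Q b)"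
proof
  fix A B C assume "A \<subseteq> C" "A \<in> {N. sub_between b N}" "B \<in> {N. sub_between b N}" "C \<in> {N. sub_between b N}"
  then show "sub_sum A B \<inter> C \<subseteq> sub_sum A (B \<inter> C)" using modular_law by simp
qed (auto simp: sub_between_Int sub_between_sum sub_between_Q dest: sub_sum_upper
      sub_betweenD(1) sub_sum_least[THEN subsetD, rotated 2])

text \<open>Modularity is a self-dual law. Reversing the order lets
  \<open>card_independent_le\<close> bound dual uniform dimension, as surjectivity requires.\<close>

lemma lattice_between_dual:
  "modular_lattice {N. sub_between b N} (\<lambda>N M. M \<subseteq> N) sub_sum (\<inter>) (P b)"
proof
  fix A B C assume a: "C \<subseteq> A" "A \<in> {N. sub_between b N}" "B \<in> {N. sub_between b N}" "C \<in> {N. sub_between b N}"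
  have "sub_sum C (B \<inter> A) \<subseteq> sub_sum (A \<inter> B) C"
    using a sub_sum_commute[of b C "B \<inter> A"] sub_between_Int by (simp add: Int_commute)
  moreover have "sub_sum C (B \<inter> A) = sub_sum C B \<inter> A" using modular_law a by simp
  moreover have "sub_sum C B = sub_sum B C" using a sub_sum_commute[of b C B] by simp
  ultimately show "A \<inter> sub_sum B C \<subseteq> sub_sum (A \<inter> B) C" by blast
qed (auto simp: sub_between_Int sub_between_sum sub_between_P dest: sub_sum_upper
      sub_betweenD(2) sub_sum_least[THEN subsetD, rotated 2])

lemma sub_between_preimage:
  assumes "h \<in> carrier E"
  shows "sub_between b {z \<in> P b. h z \<in> Q b}"
  using assms by (auto simp: sub_between_def E_Q Q_P E_add E_neg E_smult P_sub Q_add Q_neg Q_smult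
      P_add P_neg P_smult)

text \<open>The preimage under \<open>k\<close> of the image of \<open>h\<close>, modulo
  \<open>Q b\<close>. In \<open>card_le_e\<close> the map \<open>k\<close> is a coordinate
  projection for one family and the identity for the others.\<close>

lemma sub_between_image:
  assumes h: "h \<in> carrier E" and k: "k \<in> carrier E"
  shows "sub_between b {z \<in> P b. \<exists>p\<in>P b. cong b (h p) (k z)}"
  unfolding sub_between_def
proof (intro conjI ballI subsetI)
  fix z assume "z \<in> Q b"
  then show "z \<in> {z \<in> P b. \<exists>p\<in>P b. cong b (h p) (k z)}"
    using k h E_Q[OF k] cong_zero cong_sym P_zero Q_P by (auto intro!: bexI[of _ "\<zero>"] simp: E_zero)
next
  fix z w
  assume "z \<in> {z \<in> P b. \<exists>p\<in>P b. cong b (h p) (k z)}" "w \<in> {z \<in> P b. \<exists>p\<in>P b. cong b (h p) (k z)}"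
  then obtain p q where "z \<in> P b" "w \<in> P b" "p \<in> P b" "q \<in> P b" "cong b (h p) (k z)" "cong b (h q) (k w)"
    by blast
  then show "z \<oplus> w \<in> {z \<in> P b. \<exists>p\<in>P b. cong b (h p) (k z)}"
    using cong_add[of b "h p" "k z" "h q" "k w"] h k
    by (auto intro!: bexI[of _ "p \<oplus> q"] simp: P_add E_add P_sub)
next
  fix z assume "z \<in> {z \<in> P b. \<exists>p\<in>P b. cong b (h p) (k z)}"
  then obtain p where p: "z \<in> P b" "p \<in> P b" "cong b (h p) (k z)" by blast
  then show "\<ominus> z \<in> {z \<in> P b. \<exists>p\<in>P b. cong b (h p) (k z)}"
    using cong_neg[of b "h p" "k z"] h k
    by (auto intro!: bexI[of _ "\<ominus> p"] simp: P_neg E_neg P_sub)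
  fix a assume "a \<in> carrier R"
  then show "z \<star> a \<in> {z \<in> P b. \<exists>p\<in>P b. cong b (h p) (k z)}"
    using p cong_smult[of b "h p" "k z" a] h k
    by (auto intro!: bexI[of _ "p \<star> a"] simp: P_smult E_smult P_sub)
qed simp

section \<open>Counting objects by common kernels and, dually, by images\<close>

lemma e_insert: "\<lbrakk>x \<notin> S; z \<in> carrier Z\<rbrakk> \<Longrightarrow> e (insert x S) z = e {x} z \<oplus> e S z"
  using e_un[of "{x}" S z] by simp

lemma e_none: "z \<in> carrier Z \<Longrightarrow> e {} z = \<zero>"
  using arg_cong[OF e_empty, of "\<lambda>h. h z"] by simp

lemma sum_in_Q:
  assumes "finite S" "h \<in> carrier E" "z \<in> carrier Z" "\<And>x. x \<in> S \<Longrightarrow> h (e {x} z) \<in> Q b"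
  shows "h (e S z) \<in> Q b"
  using assms
proof (induction S rule: finite_induct)
  case empty
  then show ?case by (simp add: e_none E_zero Q_zero)
next
  case (insert x S)
  have "h (e (insert x S) z) = h (e {x} z) \<oplus> h (e S z)"
    using insert.prems by (simp only: e_insert[OF insert.hyps(2)] E_add E_closed e_E)
  then show ?case using insert by (simp add: Q_add)
qed

lemma sum_in_Q_left:
  assumes "finite S" "z \<in> carrier Z" "\<And>x. x \<in> S \<Longrightarrow> e {x} z \<in> Q b"
  shows "e S z \<in> Q b"
  using sum_in_Q[of S "\<one>\<^bsub>E\<^esub>" z b] assms by simp


text \<open>The intersection with \<open>P b\<close> takes care of an empty index set.\<close>

lemma sub_between_INT:
  "(\<And>k. k \<in> T \<Longrightarrow> sub_between b (N k)) \<Longrightarrow> sub_between b (P b \<inter> (\<Inter>k\<in>T. N k))"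
  by (simp add: sub_between_def Q_P P_add P_neg P_smult subset_iff)

lemma e_split:
  assumes "T \<subseteq> S" "z \<in> carrier Z"
  shows "e S z = e T z \<oplus> e (S - T) z"
  using e_un[of T "S - T" z] assms by (simp add: Un_absorb1)

lemma e_idem: "z \<in> carrier Z \<Longrightarrow> e S (e S z) = e S z"
  using e_e[of z S S] by simp

text \<open>Nonzero submodules of a uniserial module form a chain, so finitely many nonzero kernels
  have a nonzero element in common: of two witnesses, the one that is a multiple of the other serves
  for both.\<close>

lemma common_kernel:
  assumes x: "x \<in> X" and h: "\<And>k. k \<in> S \<Longrightarrow> h k \<in> carrier E" and S: "finite S"
    and nz: "nonzero_at b x"
    and ker: "\<And>k. k \<in> S \<Longrightarrow> \<exists>z\<in>P b. e {x} z \<notin> Q b \<and> h k (e {x} z) \<in> Q b"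
  shows "\<exists>z\<in>P b. e {x} z \<notin> Q b \<and> (\<forall>k\<in>S. h k (e {x} z) \<in> Q b)"
  using S h ker
proof (induction S rule: finite_induct)
  case empty
  then show ?case using nz by (auto simp: nonzero_at_def)
next
  case (insert j S)
  have step: "q (e {x} v) \<in> Q b"
    if "a \<in> carrier R" "cong b (e {x} (u \<star> a)) (e {x} v)" "u \<in> P b" "q (e {x} u) \<in> Q b"
      "q \<in> carrier E" for a u v q
  proof -
    have c: "u \<in> carrier Z" using that by (simp add: P_sub)
    have "q (e {x} (u \<star> a)) \<in> Q b" using that c by (simp add: E_smult Q_smult)
    then show ?thesis using cong_Q[OF cong_E[OF that(2,5)]] by blast
  qed
  have "\<exists>z\<in>P b. e {x} z \<notin> Q b \<and> (\<forall>k\<in>S. h k (e {x} z) \<in> Q b)"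
    by (rule insert.IH; rule insert.prems; simp)
  then obtain z where z: "z \<in> P b" "e {x} z \<notin> Q b" "\<forall>k\<in>S. h k (e {x} z) \<in> Q b" by blast
  obtain w where w: "w \<in> P b" "e {x} w \<notin> Q b" "h j (e {x} w) \<in> Q b"
    using insert.prems(2)[of j] by blast
  show ?case
    using x z(1) w(1)
  proof (cases rule: uniserial_cases)
    case (1 a)
    have "\<forall>k\<in>insert j S. h k (e {x} w) \<in> Q b"
      using step[OF 1 z(1)] z(3) w(3) insert.prems(1) by blast
    then show ?thesis using w by blast
  next
    case (2 a)
    have "\<forall>k\<in>insert j S. h k (e {x} z) \<in> Q b"
      using step[OF 2 w(1), of "h j"] z(3) w(3) insert.prems(1) by blast
    then show ?thesis using z by blast
  qed
qed

text \<open>On the block \<open>K\<close> the identity is a map through \<open>K'\<close> plus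
  \<open>n\<close>, none of whose entries is injective. By \<open>common_kernel\<close> every object
  of \<open>K\<close> has a nonzero part killed by all these entries. On the independent family of
  these parts only the map through \<open>K'\<close> survives, so a member whose coordinates in
  \<open>K'\<close> all vanish is zero.\<close>

lemma card_le_m:
  assumes K: "K \<subseteq> X" and K': "K' \<subseteq> X"
    and E: "f \<in> carrier E" "g \<in> carrier E" "n \<in> carrier E"
    and eq: "\<And>z. z \<in> carrier Z \<Longrightarrow> e K z = g (e K' (f (e K z))) \<oplus> n (e K z)"
    and nz: "\<And>x. x \<in> K \<Longrightarrow> nonzero_at b x"
    and bad: "\<And>x k. \<lbrakk>x \<in> K; k \<in> K\<rbrakk> \<Longrightarrow> \<not> entry_injsurj Idx_m b x k n"
  shows "card K \<le> card K'"
proof -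
  interpret L: modular_lattice "{N. sub_between b N}" "(\<subseteq>)" "(\<inter>)" sub_sum "Q b"
    by (rule lattice_between)
  have fin: "finite K" "finite K'" using K K' finite_X finite_subset by auto
  define B where "B = P b \<inter> (\<Inter>k\<in>K. P b \<inter> (\<Inter>x\<in>K. {z \<in> P b. (e {k} \<otimes>\<^bsub>E\<^esub> (n \<otimes>\<^bsub>E\<^esub> e {x})) z \<in> Q b}))"
  have B_sub: "sub_between b B"
    unfolding B_def using E by (intro sub_between_INT sub_between_preimage m_closed) auto
  have B_iff: "z \<in> B \<longleftrightarrow> z \<in> P b \<and> (\<forall>k\<in>K. \<forall>x\<in>K. e {k} (n (e {x} z)) \<in> Q b)" for z
    using P_sub[of z b] by (auto simp: B_def)
  \<comment> \<open>Modulo \<open>Q b\<close>, the elements supported on \<open>T\<close> that are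
    killed by all entries of \<open>n\<close> between objects of \<open>K\<close>.\<close>
  define J where "J = (\<lambda>T. {z \<in> P b. e (X - T) z \<in> Q b} \<inter> B)"
  \<comment> \<open>The kernel of the coordinate \<open>j\<close> of \<open>f\<close>. The
    submodules above it form a chain, since the quotient by it embeds into the uniserial subquotient
    at \<open>j\<close>.\<close>
  define N where "N = (\<lambda>j. {z \<in> P b. (e {j} \<otimes>\<^bsub>E\<^esub> f) z \<in> Q b})"
  define M where "M = (\<lambda>T. {z \<in> P b. (e T \<otimes>\<^bsub>E\<^esub> f) z \<in> Q b})"
  have N_iff: "z \<in> N j \<longleftrightarrow> z \<in> P b \<and> e {j} (f z) \<in> Q b" for z j
    using P_sub[of z b] by (auto simp: N_def)
  have M_iff: "z \<in> M T \<longleftrightarrow> z \<in> P b \<and> e T (f z) \<in> Q b" for z T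
    using P_sub[of z b] by (auto simp: M_def)
  have N_sub: "sub_between b (N j)" and M_sub: "sub_between b (M T)" for j T
    using E by (auto simp: N_def M_def intro!: sub_between_preimage m_closed)
  have J_sub: "sub_between b (J T)" for T
    unfolding J_def by (intro sub_between_Int sub_between_preimage B_sub) auto
  have ind: "L.independent J K"
    unfolding L.independent_def
  proof (intro conjI allI impI ballI)
    show "J T \<in> {N. sub_between b N}" for T using J_sub by simp
    show "J T \<inter> J U = J (T \<inter> U)" for T U
    proof -
      have "e (X - T) z \<in> Q b \<and> e (X - U) z \<in> Q b \<longleftrightarrow> e (X - T \<inter> U) z \<in> Q b" if z: "z \<in> P b" for z
      proof (intro iffI conjI)
        have c: "z \<in> carrier Z" using z by (rule P_sub)
        have sub: "(X - T) \<inter> (X - T \<inter> U) = X - T" "(X - U) \<inter> (X - T \<inter> U) = X - U" by auto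
        assume a: "e (X - T \<inter> U) z \<in> Q b"
        show "e (X - T) z \<in> Q b" using E_Q[OF e_E a, of "X - T"] c by (simp add: e_e sub)
        show "e (X - U) z \<in> Q b" using E_Q[OF e_E a, of "X - U"] c by (simp add: e_e sub)
      next
        have c: "z \<in> carrier Z" using z by (rule P_sub)
        assume a: "e (X - T) z \<in> Q b \<and> e (X - U) z \<in> Q b"
        show "e (X - T \<inter> U) z \<in> Q b"
        proof (rule sum_in_Q_left[OF _ c])
          fix x assume "x \<in> X - T \<inter> U"
          then consider "{x} \<inter> (X - T) = {x}" | "{x} \<inter> (X - U) = {x}" by auto
          then show "e {x} z \<in> Q b"
          proof cases
            case 1
            then show ?thesis using a E_Q[OF e_E, of "e (X - T) z" b "{x}"] c by (simp add: e_e)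
          next
            case 2
            then show ?thesis using a E_Q[OF e_E, of "e (X - U) z" b "{x}"] c by (simp add: e_e)
          qed
        qed (use finite_X in auto)
      qed
      then show ?thesis by (auto simp: J_def)
    qed
    have "e X z = z" if "z \<in> P b" for z using e_X[OF P_sub[OF that]] .
    moreover have "z \<in> P b" if "z \<in> Q b" for z using Q_P[OF that] .
    ultimately show "J {} = Q b"
      using sub_betweenD(1)[OF B_sub] by (auto simp: J_def)
  next
    fix x assume x: "x \<in> K"
    have "\<exists>z\<in>P b. e {x} z \<notin> Q b \<and> (\<forall>k\<in>K. (e {k} \<otimes>\<^bsub>E\<^esub> n) (e {x} z) \<in> Q b)"
    proof (rule common_kernel)
      fix k assume "k \<in> K"
      then obtain z where "z \<in> P b" "e {k} (n (e {x} z)) \<in> Q b" "e {x} z \<notin> Q b"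
        using bad[OF x] by (auto simp: entry_injsurj_def)
      then show "\<exists>z\<in>P b. e {x} z \<notin> Q b \<and> (e {k} \<otimes>\<^bsub>E\<^esub> n) (e {x} z) \<in> Q b"
        using P_sub by (intro bexI[of _ z]) auto
    qed (use K x fin nz E in auto)
    then obtain z where z: "z \<in> P b" "e {x} z \<notin> Q b" "\<And>k. k \<in> K \<Longrightarrow> e {k} (n (e {x} z)) \<in> Q b"
      using P_sub by fastforce
    have c: "z \<in> carrier Z" using z by (simp add: P_sub)
    have "e {x} z \<in> J {x}"
    proof -
      have "e (X - {x}) (e {x} z) = \<zero>" using c by (simp add: e_e e_none)
      moreover have "e {k} (n (e {y} (e {x} z))) \<in> Q b" if "k \<in> K" for k y
        using z(3)[OF that] c E by (cases "y = x") (simp_all add: e_e e_none E_zero Q_zero)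
      ultimately show ?thesis using E_P[OF e_E z(1)] by (simp add: J_def B_iff Q_zero)
    qed
    then show "J {x} \<noteq> Q b" using z by blast
  qed
  show ?thesis
  proof (rule L.card_independent_le[OF fin(2,1) ind, of M N])
    show "M T \<in> {N. sub_between b N}" "N j \<in> {N. sub_between b N}" for T j using N_sub M_sub by auto
  next
    fix j A C
    assume j: "j \<in> K'" and A: "A \<in> {N. sub_between b N}" and C: "C \<in> {N. sub_between b N}"
      and le: "N j \<subseteq> A" "N j \<subseteq> C"
    \<comment> \<open>Since \<open>D\<close> contains \<open>N j\<close>, membership in
      \<open>D\<close> depends only on the coordinate \<open>j\<close> of the value under
      \<open>f\<close>, and multiples of coordinates of members are again coordinates of
      members.\<close>
    have move: "v \<in> D" if "sub_between b D" "N j \<subseteq> D" "u \<in> D" "v \<in> P b" "a \<in> carrier R"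
      "cong b (e {j} (f u \<star> a)) (e {j} (f v))" for D u v a
    proof -
      have u: "u \<in> P b" using that sub_betweenD(2) by blast
      have c: "u \<in> carrier Z" "v \<in> carrier Z" using u that by (simp_all add: P_sub)
      have ua: "u \<star> a \<in> P b" using u that by (simp add: P_smult)
      have "cong b (e {j} (f v)) (e {j} (f (u \<star> a)))"
        using cong_sym[OF that(6)] that c E by (simp add: E_smult)
      then have "e {j} (f (v \<ominus> u \<star> a)) \<in> Q b"
        using c that E by (simp add: cong_def E_minus)
      then have "v \<ominus> u \<star> a \<in> N j" using that ua by (simp add: N_iff P_minus)
      then have "(v \<ominus> u \<star> a) \<oplus> u \<star> a \<in> D"
        using that sub_betweenD(4,6)[OF that(1)] by blast
      then show ?thesis using c that by (simp add: a_minus_def M.a_assoc M.l_neg)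
    qed
    show "A \<subseteq> C \<or> C \<subseteq> A"
    proof (rule ccontr)
      assume "\<not> ?thesis"
      then obtain u v where u: "u \<in> A" "u \<notin> C" and v: "v \<in> C" "v \<notin> A" by blast
      have uv: "u \<in> P b" "v \<in> P b" using A C u v sub_betweenD(2) by auto
      have fuv: "f u \<in> P b" "f v \<in> P b" using uv E by (simp_all add: E_P)
      have jX: "j \<in> X" using j K' by auto
      show False
        using jX fuv
      proof (cases rule: uniserial_cases)
        case (1 a)
        then show False using move[of A u v a] A le u v uv by auto
      next
        case (2 a)
        then show False using move[of C v u a] C le u v uv by auto
      qed
    qed
  next
    fix j T assume "j \<in> K'" "T \<subseteq> K'"
    show "M T \<inter> N j \<subseteq> M (insert j T)"
    proof
      fix z assume z: "z \<in> M T \<inter> N j"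
      have c: "f z \<in> carrier Z" using z E P_sub[of z b] by (simp add: M_iff)
      show "z \<in> M (insert j T)"
      proof (cases "j \<in> T")
        case True
        then show ?thesis using z by (simp add: insert_absorb)
      next
        case False
        then show ?thesis using z e_insert[OF False c] by (simp add: M_iff N_iff Q_add)
      qed
    qed
  next
    show "J K \<subseteq> M {}" using P_sub E by (auto simp: J_def M_iff e_none Q_zero)
  next
    have "z \<in> Q b" if z: "z \<in> J K \<inter> M K'" for z
    proof -
      have zP: "z \<in> P b" using z by (simp add: M_iff)
      then have c: "z \<in> carrier Z" by (rule P_sub)
      have eKP: "e K z \<in> P b" using zP by (simp add: E_P)
      have "z = e K z \<oplus> e (X - K) z" using e_split[OF K c] c by (simp add: e_X)
      moreover have "e (X - K) z \<in> Q b" using z by (simp add: J_def)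
      ultimately have "z \<ominus> e K z \<in> Q b"
        using c by (metis E_closed M.a_comm M.a_assoc M.r_neg M.r_zero a_minus_def e_E M.a_inv_closed)
      then have zK: "cong b z (e K z)" using zP eKP by (simp add: cong_def)
      have "cong b (e K' (f z)) (e K' (f (e K z)))" by (rule cong_E[OF cong_E[OF zK E(1)] e_E])
      then have "e K' (f (e K z)) \<in> Q b" using z cong_Q by (simp add: M_iff)
      then have g0: "e K (g (e K' (f (e K z)))) \<in> Q b" using E by (simp add: E_Q)
      have "e {k} (n (e K z)) \<in> Q b" if "k \<in> K" for k
        using sum_in_Q[OF fin(1), of "e {k} \<otimes>\<^bsub>E\<^esub> n" z b] z that c E by (simp add: J_def B_iff)
      then have n0: "e K (n (e K z)) \<in> Q b"
        using sum_in_Q_left[OF fin(1), of "n (e K z)" b] c E by simp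
      have "e K z = e K (g (e K' (f (e K z)))) \<oplus> e K (n (e K z))"
        using arg_cong[OF eq[OF c], of "e K"] c E by (simp add: e_idem E_add)
      then have "e K z \<in> Q b" using g0 n0 by (metis Q_add)
      then show ?thesis using zK cong_Q by blast
    qed
    then show "J K \<inter> M K' = Q b"
      using sub_betweenD(1)[OF J_sub] sub_betweenD(1)[OF M_sub] by blast
  qed
qed

text \<open>Dual to \<open>common_kernel\<close>: proper submodules of a uniserial module do not add
  up to the whole, which is the finite form of \<open>onto_add\<close>.\<close>

lemma onto_e_ex:
  assumes "finite S" "n \<in> carrier E" "k \<in> X" "nonzero_at b k" "onto b k (n \<otimes>\<^bsub>E\<^esub> e S)"
  shows "\<exists>x\<in>S. onto b k (n \<otimes>\<^bsub>E\<^esub> e {x})"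
  using assms(1,5)
proof (induction S rule: finite_induct)
  case empty
  have "e {k} w \<in> Q b" if w: "w \<in> P b" for w
  proof -
    obtain z where "z \<in> P b" "cong b (e {k} ((n \<otimes>\<^bsub>E\<^esub> e {}) z)) (e {k} w)"
      using empty w by (auto simp: onto_def)
    then show ?thesis using assms(2) P_sub cong_sym cong_zero by (fastforce simp: e_none E_zero)
  qed
  then show ?case using assms(4) by (auto simp: nonzero_at_def)
next
  case (insert x S)
  have "onto b k ((n \<otimes>\<^bsub>E\<^esub> e {x}) \<oplus>\<^bsub>E\<^esub> (n \<otimes>\<^bsub>E\<^esub> e S))"
    using insert.prems onto_cong[of "n \<otimes>\<^bsub>E\<^esub> e (insert x S)" "(n \<otimes>\<^bsub>E\<^esub> e {x}) \<oplus>\<^bsub>E\<^esub> (n \<otimes>\<^bsub>E\<^esub> e S)" b k]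
      e_insert[OF insert.hyps(2)] assms(2) by (simp add: E_add)
  then have "onto b k (n \<otimes>\<^bsub>E\<^esub> e {x}) \<or> onto b k (n \<otimes>\<^bsub>E\<^esub> e S)"
    using assms by (intro onto_add) auto
  then show ?case using insert.IH by blast
qed

text \<open>The dual count. As no entry of \<open>n\<close> is onto, \<open>onto_e_ex\<close> shows
  that the image of the block \<open>K\<close> under \<open>n\<close> is proper at each object of
  \<open>K\<close>; quotients by these images replace the kernels of \<open>card_le_m\<close>. In
  the reversed order sums are meets and \<open>P b\<close> is the bottom, so the last two conditions
  become \<open>M {} \<subseteq> J K\<close> and the equality of \<open>P b\<close> with the sum of
  \<open>J K\<close> and \<open>M K'\<close>.\<close>

lemma card_le_e:
  assumes K: "K \<subseteq> X" and K': "K' \<subseteq> X"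
    and E: "f \<in> carrier E" "g \<in> carrier E" "n \<in> carrier E"
    and eq: "\<And>z. z \<in> carrier Z \<Longrightarrow> e K z = g (e K' (f (e K z))) \<oplus> n (e K z)"
    and nz: "\<And>x. x \<in> K \<Longrightarrow> nonzero_at b x"
    and bad: "\<And>x k. \<lbrakk>x \<in> K; k \<in> K\<rbrakk> \<Longrightarrow> \<not> entry_injsurj Idx_e b x k n"
  shows "card K \<le> card K'"
proof -
  interpret L: modular_lattice "{N. sub_between b N}" "\<lambda>N M. M \<subseteq> N" sub_sum "(\<inter>)" "P b"
    by (rule lattice_between_dual)
  have fin: "finite K" "finite K'" using K K' finite_X finite_subset by auto
  \<comment> \<open>Each coordinate in \<open>T\<close> has to come from \<open>n\<close> on the
    block \<open>K\<close>. A larger \<open>T\<close> gives a smaller submodule, which is a larger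
    element in the reversed order.\<close>
  define J where "J = (\<lambda>T. P b \<inter> (\<Inter>k\<in>T. {z \<in> P b. \<exists>p\<in>P b.
      cong b ((e {k} \<otimes>\<^bsub>E\<^esub> (n \<otimes>\<^bsub>E\<^esub> e K)) p) (e {k} z)}))"
  \<comment> \<open>The image of the object \<open>j\<close> under \<open>g\<close>. The submodules
    below it form a chain, being contained in an image of a uniserial module.\<close>
  define N where "N = (\<lambda>j. {z \<in> P b. \<exists>p\<in>P b. cong b ((g \<otimes>\<^bsub>E\<^esub> e {j}) p) (\<one>\<^bsub>E\<^esub> z)})"
  define M where "M = (\<lambda>T. {z \<in> P b. \<exists>p\<in>P b. cong b ((g \<otimes>\<^bsub>E\<^esub> e T) p) (\<one>\<^bsub>E\<^esub> z)})"
  have J_iff: "z \<in> J T \<longleftrightarrow> z \<in> P b \<and> (\<forall>k\<in>T. \<exists>p\<in>P b. cong b (e {k} (n (e K p))) (e {k} z))" for z T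
    by (auto simp: J_def P_sub)
  have N_iff: "z \<in> N j \<longleftrightarrow> z \<in> P b \<and> (\<exists>p\<in>P b. cong b (g (e {j} p)) z)" for z j
    by (auto simp: N_def P_sub)
  have M_iff: "z \<in> M T \<longleftrightarrow> z \<in> P b \<and> (\<exists>p\<in>P b. cong b (g (e T p)) z)" for z T
    by (auto simp: M_def P_sub)
  have N_sub: "sub_between b (N j)" and M_sub: "sub_between b (M T)" for j T
    unfolding N_def M_def using E by (auto intro!: sub_between_image m_closed)
  have J_sub: "sub_between b (J T)" for T
    unfolding J_def using E by (intro sub_between_INT sub_between_image m_closed) auto
  have zero_ok: "\<exists>p\<in>P b. cong b (e {k} (n (e K p))) \<zero>" for k
    using E by (intro bexI[of _ "\<zero>"]) (simp_all add: E_zero P_zero cong_refl)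
  have ind: "L.independent J K"
    unfolding L.independent_def
  proof (intro conjI allI impI ballI)
    show "J T \<in> {N. sub_between b N}" for T using J_sub by simp
    show "sub_sum (J T) (J U) = J (T \<inter> U)" for T U
    proof
      show "sub_sum (J T) (J U) \<subseteq> J (T \<inter> U)"
        by (intro sub_sum_least[OF _ _ J_sub]) (auto simp: J_iff)
      show "J (T \<inter> U) \<subseteq> sub_sum (J T) (J U)"
      proof
        fix z assume z: "z \<in> J (T \<inter> U)"
        have zP: "z \<in> P b" using z by (simp add: J_iff)
        then have c: "z \<in> carrier Z" by (rule P_sub)
        \<comment> \<open>The first summand has zero coordinates in \<open>T\<close>. The second has
          zero coordinates outside \<open>T\<close>, and in \<open>T \<inter> U\<close> it has those
          of \<open>z\<close>, where the hypothesis applies.\<close>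
        have "z \<ominus> e T z \<in> J T"
        proof -
          have "e {k} (z \<ominus> e T z) = \<zero>" if "k \<in> T" for k
            using that c by (simp add: E_minus e_e) (simp add: a_minus_def M.r_neg)
          then show ?thesis using zP zero_ok by (simp add: J_iff P_minus E_P)
        qed
        moreover have "e T z \<in> J U"
        proof -
          have "\<exists>p\<in>P b. cong b (e {k} (n (e K p))) (e {k} (e T z))" if "k \<in> U" for k
          proof (cases "k \<in> T")
            case True
            then show ?thesis using z that c by (simp add: J_iff e_e)
          next
            case False
            then show ?thesis using zero_ok c by (simp add: e_e e_none)
          qed
          then show ?thesis using zP by (simp add: J_iff E_P)
        qed
        moreover have "z = (z \<ominus> e T z) \<oplus> e T z"
          using c by (simp add: a_minus_def M.a_assoc M.l_neg)
        ultimately show "z \<in> sub_sum (J T) (J U)" unfolding sub_sum_def by blast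
      qed
    qed
    show "J {} = P b" by (auto simp: J_iff)
  next
    fix k assume k: "k \<in> K"
    have "\<not> onto b k (n \<otimes>\<^bsub>E\<^esub> e K)"
      using onto_e_ex[OF fin(1) E(3), of k b] bad k K nz entry_e_iff_onto by blast
    then obtain w where "w \<in> P b" "w \<notin> J {k}" by (auto simp: onto_def J_iff P_sub)
    then show "J {k} \<noteq> P b" by blast
  qed
  show ?thesis
  proof (rule L.card_independent_le[OF fin(2,1) ind, of M N])
    show "M T \<in> {N. sub_between b N}" "N j \<in> {N. sub_between b N}" for T j using N_sub M_sub by auto
  next
    fix j A C
    assume j: "j \<in> K'" and A: "A \<in> {N. sub_between b N}" and C: "C \<in> {N. sub_between b N}"
      and le: "A \<subseteq> N j" "C \<subseteq> N j"
    have move: "v \<in> D" if "sub_between b D" "u \<in> D" "a \<in> carrier R" "p \<in> P b" "q \<in> P b"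
      "cong b (g (e {j} p)) u" "cong b (g (e {j} q)) v" "cong b (e {j} (p \<star> a)) (e {j} q)" for D u v a p q
    proof -
      have c: "p \<in> carrier Z" using that by (simp add: P_sub)
      have "cong b (g (e {j} (p \<star> a))) (g (e {j} q))" by (rule cong_E[OF that(8) E(2)])
      then have "cong b (g (e {j} p) \<star> a) v" using that c E cong_trans by (simp add: E_smult)
      then have "cong b (u \<star> a) v"
        using cong_trans[OF cong_sym[OF cong_smult[OF that(6,3)]]] by blast
      moreover have "u \<star> a \<in> D" using that sub_betweenD(6) by blast
      ultimately show ?thesis using sub_between_cong[OF that(1)] by blast
    qed
    show "C \<subseteq> A \<or> A \<subseteq> C"
    proof (rule ccontr)
      assume "\<not> ?thesis"
      then obtain u v where u: "u \<in> A" "u \<notin> C" and v: "v \<in> C" "v \<notin> A" by blast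
      have "u \<in> N j" "v \<in> N j" using u v le by auto
      obtain p q where pq: "p \<in> P b" "q \<in> P b" "cong b (g (e {j} p)) u" "cong b (g (e {j} q)) v"
        using \<open>u \<in> N j\<close> \<open>v \<in> N j\<close> unfolding N_iff by blast
      have jX: "j \<in> X" using j K' by auto
      show False
        using jX pq(1,2)
      proof (cases rule: uniserial_cases)
        case (1 a)
        then show False using move[of A u a p q v] A u v pq by auto
      next
        case (2 a)
        then show False using move[of C v a q p u] C u v pq by auto
      qed
    qed
  next
    fix j T assume "j \<in> K'" "T \<subseteq> K'"
    show "M (insert j T) \<subseteq> sub_sum (M T) (N j)"
    proof (cases "j \<in> T")
      case True
      then show ?thesis using sub_sum_upper(1)[OF M_sub N_sub] by (simp add: insert_absorb)
    next
      case False
      show ?thesis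
      proof
        fix z assume "z \<in> M (insert j T)"
        then obtain p where p: "p \<in> P b" "cong b (g (e (insert j T) p)) z" by (auto simp: M_iff)
        have c: "p \<in> carrier Z" using p by (simp add: P_sub)
        have gP: "g (e S p) \<in> P b" for S using p E by (simp add: E_P)
        have "g (e T p) \<in> M T" "g (e {j} p) \<in> N j"
          using p(1) gP cong_refl by (auto simp: M_iff N_iff)
        then have "g (e T p) \<oplus> g (e {j} p) \<in> sub_sum (M T) (N j)" unfolding sub_sum_def by blast
        moreover have "g (e (insert j T) p) = g (e T p) \<oplus> g (e {j} p)"
          using E c by (simp only: e_insert[OF False c] E_add E_closed e_E M.a_comm)
        ultimately show "z \<in> sub_sum (M T) (N j)"
          using p sub_between_cong[OF sub_between_sum[OF M_sub N_sub]] by metis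
      qed
    qed
  next
    have "z \<in> J K" if z: "z \<in> M {}" for z
    proof -
      obtain p where p: "p \<in> P b" "cong b (g (e {} p)) z" using z by (auto simp: M_iff)
      then have "g (e {} p) = \<zero>" using E P_sub by (simp add: e_none E_zero)
      then have "z \<in> Q b" using p cong_zero cong_sym by simp
      then show ?thesis using sub_betweenD(1)[OF J_sub] by blast
    qed
    then show "M {} \<subseteq> J K" by blast
  next
    have "z \<in> sub_sum (J K) (M K')" if z: "z \<in> P b" for z
    proof -
      have c: "z \<in> carrier Z" using z by (rule P_sub)
      \<comment> \<open>The part of \<open>z\<close> recovered through \<open>K'\<close>. What is
        missing has, on \<open>K\<close>, the coordinates of \<open>n (e K z)\<close>.\<close>
      define w where "w = g (e K' (f (e K z)))"
      have w: "w \<in> P b" "w \<in> carrier Z" "n (e K z) \<in> carrier Z" "n (e K z) \<in> P b"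
        using z c E by (simp_all add: w_def E_P)
      have "f (e K z) \<in> P b" using z E by (simp add: E_P)
      then have "w \<in> M K'" using w(1) cong_refl[OF w(1)] unfolding M_iff w_def by blast
      moreover have "z \<ominus> w \<in> J K"
      proof -
        have "e {k} (z \<ominus> w) = e {k} (n (e K z))" if "k \<in> K" for k
        proof -
          have "e {k} z = e {k} (e K z)" using that c by (simp add: e_e)
          also have "\<dots> = e {k} w \<oplus> e {k} (n (e K z))"
            using arg_cong[OF eq[OF c], of "e {k}"] w by (simp only: w_def[symmetric] E_add e_E)
          finally have "e {k} (z \<ominus> w) = (e {k} w \<oplus> e {k} (n (e K z))) \<ominus> e {k} w"
            using c w by (simp only: E_minus e_E)
          also have "\<dots> = e {k} (n (e K z))"
            using w by (simp add: a_minus_def M.a_ac M.r_neg1 M.r_neg2)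
          finally show ?thesis .
        qed
        then have "cong b (e {k} (n (e K z))) (e {k} (z \<ominus> w))" if "k \<in> K" for k
          using that cong_refl[OF E_P[OF e_E w(4)]] by simp
        then show ?thesis using z P_minus[OF z w(1)] unfolding J_iff by blast
      qed
      moreover have "z = (z \<ominus> w) \<oplus> w" using c w by (simp add: a_minus_def M.a_assoc M.l_neg)
      ultimately show ?thesis unfolding sub_sum_def by blast
    qed
    then show "sub_sum (J K) (M K') = P b"
      using sub_betweenD(2)[OF sub_between_sum[OF J_sub M_sub]] by blast
  qed
qed

end

text \<open>Greedy matching: an \<open>a\<close> and an equivalent \<open>b\<close> are removed
  together, which lowers both counts of their common class and changes no other class. Counting also
  at the elements of \<open>B\<close> ensures that none of them is left over.\<close>

lemma ex_class_bijection:
  assumes "finite A" "finite B"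
    and R: "equivp R"
    and cards: "\<And>x. x \<in> A \<union> B \<Longrightarrow> card {a \<in> A. R x a} = card {b \<in> B. R x b}"
  shows "\<exists>\<phi>. bij_betw \<phi> A B \<and> (\<forall>a\<in>A. R a (\<phi> a))"
  using assms(1,2,4)
proof (induction A arbitrary: B rule: finite_induct)
  case empty
  have "B = {}"
  proof (rule ccontr)
    assume "B \<noteq> {}"
    then obtain x where x: "x \<in> B" by blast
    then have "card {b \<in> B. R x b} = 0" using empty.prems(2)[of x] by simp
    then have "{b \<in> B. R x b} = {}" using empty.prems(1) by simp
    then show False using x equivp_reflp[OF R, of x] by blast
  qed
  then show ?case by (simp add: bij_betw_def)
next
  case (insert a A)
  have "{a' \<in> insert a A. R a a'} \<noteq> {}" using equivp_reflp[OF R, of a] by blast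
  then have "card {a' \<in> insert a A. R a a'} \<noteq> 0" using insert.hyps by simp
  then have "card {b \<in> B. R a b} \<noteq> 0" using insert.prems(2)[of a] by simp
  then have "{b \<in> B. R a b} \<noteq> {}" by force
  then obtain b where b: "b \<in> B" "R a b" by blast
  have Rab: "R x a \<longleftrightarrow> R x b" for x
    using b(2) equivp_symp[OF R] equivp_transp[OF R] by blast
  have "card {a' \<in> A. R x a'} = card {b' \<in> B - {b}. R x b'}" if "x \<in> A \<union> (B - {b})" for x
  proof -
    have eq: "card {a' \<in> insert a A. R x a'} = card {b' \<in> B. R x b'}"
      using insert.prems(2) that by auto
    show ?thesis
    proof (cases "R x a")
      case True
      have "{a' \<in> insert a A. R x a'} = insert a {a' \<in> A. R x a'}"
        "{b' \<in> B. R x b'} = insert b {b' \<in> B - {b}. R x b'}"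
        using True Rab b by auto
      then show ?thesis using eq insert.hyps insert.prems(1) by simp
    next
      case False
      have "{a' \<in> insert a A. R x a'} = {a' \<in> A. R x a'}"
        "{b' \<in> B. R x b'} = {b' \<in> B - {b}. R x b'}"
        using False Rab b by auto
      then show ?thesis using eq by simp
    qed
  qed
  then obtain \<phi> where \<phi>: "bij_betw \<phi> A (B - {b})" "\<forall>a\<in>A. R a (\<phi> a)"
    using insert.IH[of "B - {b}"] insert.prems(1) by auto
  have "bij_betw (\<phi>(a := b)) A (B - {b})"
    using \<phi>(1) insert.hyps by (subst bij_betw_cong[of A _ \<phi>]) auto
  then have "bij_betw (\<phi>(a := b)) (insert a A) (insert b (B - {b}))"
    using notIn_Un_bij_betw[of a A "\<phi>(a := b)" "B - {b}"] insert.hyps by simp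
  then have "bij_betw (\<phi>(a := b)) (insert a A) B" using b by (simp add: insert_absorb)
  moreover have "\<forall>a'\<in>insert a A. R a' ((\<phi>(a := b)) a')" using \<phi>(2) b by simp
  ultimately show ?case by blast
qed

section \<open>Isomorphism of two blocks and bijections between their classes\<close>

context split_module
begin

text \<open>On the class in \<open>I\<close> the identity \<open>g f\<close> splits into the paths
  through the same class in \<open>J\<close> and a remainder \<open>n\<close>. A good entry of
  \<open>n\<close> would be a good path that leaves the class and comes back, which
  \<open>sim_back\<close> forbids; so the counting lemmas apply.\<close>

lemma card_class_le:
  assumes IJ: "I \<inter> J = {}" "I \<union> J = X" and c: "c \<in> X"
    and E: "f \<in> carrier E" "g \<in> carrier E"
    and f: "e J \<otimes>\<^bsub>E\<^esub> (f \<otimes>\<^bsub>E\<^esub> e I) = f" and gf: "g \<otimes>\<^bsub>E\<^esub> f = e I"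
  shows "card {x \<in> I. sim t c x} \<le> card {y \<in> J. sim t c y}"
proof -
  define K where "K = {x \<in> I. sim t c x}"
  define K' where "K' = {y \<in> J. sim t c y}"
  define n where "n = g \<otimes>\<^bsub>E\<^esub> (e (J - K') \<otimes>\<^bsub>E\<^esub> f)"
  have sub: "K \<subseteq> X" "K' \<subseteq> X" "K' \<subseteq> J" "J - K' \<subseteq> X" "K \<subseteq> I" using IJ by (auto simp: K_def K'_def)
  have nE: "n \<in> carrier E" using E by (simp add: n_def)
  have eq: "e K z = g (e K' (f (e K z))) \<oplus> n (e K z)" if z: "z \<in> carrier Z" for z
  proof -
    have fz: "f (e K z) \<in> carrier Z" using z E by simp
    have "f (e K z) = e J (f (e I (e K z)))"
      using arg_cong[OF f, of "\<lambda>h. h (e K z)"] z E by simp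
    then have "e J (f (e K z)) = f (e K z)" using z E by (metis E_closed e_E e_idem)
    then have "f (e K z) = e K' (f (e K z)) \<oplus> e (J - K') (f (e K z))"
      using e_split[OF sub(3) fz] by simp
    then have "g (f (e K z)) = g (e K' (f (e K z)) \<oplus> e (J - K') (f (e K z)))" by simp
    also have "\<dots> = g (e K' (f (e K z))) \<oplus> n (e K z)"
      using fz z E by (simp add: E_add n_def)
    also have "g (f (e K z)) = e I (e K z)"
      using arg_cong[OF gf, of "\<lambda>h. h (e K z)"] z by simp
    also have "\<dots> = e K z" using z sub(5) by (simp add: e_e Int_absorb1)
    finally show ?thesis .
  qed
  have nz: "nonzero_at (snd t) x" if "x \<in> K" for x
    using that sim_supp[of t c x] by (simp add: K_def type_supp_def)
  have bad: "\<not> entry_injsurj (fst t) (snd t) x k n" if "x \<in> K" "k \<in> K" for x k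
  proof
    assume "entry_injsurj (fst t) (snd t) x k n"
    then have "type_good t x k n" using nz that by (simp add: type_good_def)
    moreover have xk: "x \<in> X" "k \<in> X" using that sub by auto
    ultimately obtain y where y: "y \<in> J - K'" "type_good t x y f" "type_good t y k g"
      using good_mult_ex[OF E xk sub(4), of t] unfolding n_def by blast
    have yX: "y \<in> X" using y sub by auto
    have "sim t x k" using that sim_trans[OF sim_sym _ xk(1) c xk(2)] by (simp add: K_def)
    then have "sim t x y" using sim_back[OF y(2,3) _ E xk(1) yX xk(2)] by blast
    then have "sim t c y" using that sim_trans[OF _ _ c xk(1) yX] by (simp add: K_def)
    then show False using y by (simp add: K'_def)
  qed
  have "card K \<le> card K'"
    using card_le_m[OF sub(1,2) E nE eq nz] card_le_e[OF sub(1,2) E nE eq nz] bad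
    by (cases "fst t") auto
  then show ?thesis by (simp add: K_def K'_def)
qed

theorem isomorphic_iff_bijections:
  assumes IJ: "I \<inter> J = {}" "I \<union> J = X"
  shows "(\<exists>f\<in>carrier E. \<exists>g\<in>carrier E. e J \<otimes>\<^bsub>E\<^esub> (f \<otimes>\<^bsub>E\<^esub> e I) = f \<and> e I \<otimes>\<^bsub>E\<^esub> (g \<otimes>\<^bsub>E\<^esub> e J) = g \<and>
      g \<otimes>\<^bsub>E\<^esub> f = e I \<and> f \<otimes>\<^bsub>E\<^esub> g = e J) \<longleftrightarrow>
    (\<exists>\<phi>. \<forall>t. bij_betw (\<phi> t) {i \<in> I. type_supp t i} {j \<in> J. type_supp t j} \<and>
      (\<forall>i\<in>{i \<in> I. type_supp t i}. sim t i (\<phi> t i)))" (is "?iso \<longleftrightarrow> ?bij")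
proof
  assume ?iso
  then obtain f g where fg: "f \<in> carrier E" "g \<in> carrier E" "e J \<otimes>\<^bsub>E\<^esub> (f \<otimes>\<^bsub>E\<^esub> e I) = f"
    "e I \<otimes>\<^bsub>E\<^esub> (g \<otimes>\<^bsub>E\<^esub> e J) = g" "g \<otimes>\<^bsub>E\<^esub> f = e I" "f \<otimes>\<^bsub>E\<^esub> g = e J"
    by blast
  have JI: "J \<inter> I = {}" "J \<union> I = X" using IJ by auto
  have "\<exists>\<phi>. bij_betw \<phi> {i \<in> I. type_supp t i} {j \<in> J. type_supp t j} \<and>
      (\<forall>i\<in>{i \<in> I. type_supp t i}. sim t i (\<phi> i))" for t
  proof -
    define A where "A = {i \<in> I. type_supp t i}"
    define B where "B = {j \<in> J. type_supp t j}"
    \<comment> \<open>\<open>sim\<close> is reflexive only at supported objects and transitive only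
      within \<open>X\<close>; adding equality gives an equivalence relation on the whole
      type.\<close>
    define R where "R = (\<lambda>x y. x = y \<or> (x \<in> A \<union> B \<and> y \<in> A \<union> B \<and> sim t x y))"
    have AB: "A \<subseteq> X" "B \<subseteq> X" using IJ by (auto simp: A_def B_def)
    have supp: "type_supp t x" if "x \<in> A \<union> B" for x using that by (auto simp: A_def B_def)
    have "equivp R"
    proof (rule equivpI)
      show "reflp R" by (auto simp: R_def reflp_def)
      show "symp R" using sim_sym by (auto simp: R_def symp_def)
      show "transp R" using sim_trans AB unfolding R_def transp_def by blast
    qed
    moreover have "card {a \<in> A. R x a} = card {b \<in> B. R x b}" if x: "x \<in> A \<union> B" for x
    proof -
      have xX: "x \<in> X" using x AB by auto
      have R_iff: "R x y \<longleftrightarrow> sim t x y" if "y \<in> A \<union> B" for y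
        using that x sim_refl[OF supp[OF x] xX] by (auto simp: R_def)
      have "{a \<in> A. R x a} = {i \<in> I. sim t x i}" "{b \<in> B. R x b} = {j \<in> J. sim t x j}"
        using R_iff sim_supp[of t x] by (auto simp: A_def B_def)
      then show ?thesis
        using card_class_le[OF IJ xX fg(1,2,3,5), of t] card_class_le[OF JI xX fg(2,1,4,6), of t]
        by simp
    qed
    ultimately obtain \<phi> where \<phi>: "bij_betw \<phi> A B" "\<forall>a\<in>A. R a (\<phi> a)"
      using ex_class_bijection[of A B R] finite_X AB finite_subset by metis
    have "sim t i (\<phi> i)" if i: "i \<in> A" for i
    proof -
      have "\<phi> i \<in> B" using \<phi>(1) i by (auto simp: bij_betw_def)
      \<comment> \<open>The two sides are disjoint, so the added equality can never be the reason
        for a match.\<close>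
      then have "\<phi> i \<noteq> i" using i IJ by (auto simp: A_def B_def)
      then show ?thesis using \<phi>(2) i by (auto simp: R_def)
    qed
    then show ?thesis using \<phi>(1) unfolding A_def B_def by blast
  qed
  then show ?bij by metis
next
  assume ?bij
  then obtain \<phi> where bij: "\<And>t. bij_betw (\<phi> t) {i \<in> I. type_supp t i} {j \<in> J. type_supp t j}"
    and sim: "\<And>t i. \<lbrakk>i \<in> I; type_supp t i\<rbrakk> \<Longrightarrow> sim t i (\<phi> t i)"
    by blast
  define \<psi> where "\<psi> = (\<lambda>t. inv_into {i \<in> I. type_supp t i} (\<phi> t))"
  \<comment> \<open>A bijection together with its inverse is an involution of the supported objects
    that exchanges the two sides.\<close>
  define \<pi> where "\<pi> = (\<lambda>t x. if x \<in> I then \<phi> t x else \<psi> t x)"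
  have \<phi>: "\<phi> t i \<in> J" "\<psi> t (\<phi> t i) = i" if "i \<in> I" "type_supp t i" for t i
    using bij[of t] that by (auto simp: bij_betw_def \<psi>_def)
  have \<psi>: "\<psi> t j \<in> I" "type_supp t (\<psi> t j)" "\<phi> t (\<psi> t j) = j" if "j \<in> J" "type_supp t j" for t j
  proof -
    have j: "j \<in> \<phi> t ` {i \<in> I. type_supp t i}" using bij[of t] that by (auto simp: bij_betw_def)
    show "\<psi> t j \<in> I" "type_supp t (\<psi> t j)" using inv_into_into[OF j] by (auto simp: \<psi>_def)
    show "\<phi> t (\<psi> t j) = j" using f_inv_into_f[OF j] by (simp add: \<psi>_def)
  qed
  have dis: "x \<in> J \<longleftrightarrow> x \<notin> I" if "x \<in> X" for x using that IJ by auto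
  show ?iso
  proof (rule ex_isomorphism[OF IJ, of \<pi>])
    fix t x assume x: "x \<in> X" "type_supp t x"
    show "\<pi> t x \<in> X \<and> sim t x (\<pi> t x) \<and> \<pi> t (\<pi> t x) = x"
    proof (cases "x \<in> I")
      case True
      have "\<phi> t x \<in> X" "\<phi> t x \<notin> I" using \<phi>[OF True x(2)] IJ by auto
      then show ?thesis using True \<phi>[OF True x(2)] sim[OF True x(2)] by (simp add: \<pi>_def)
    next
      case False
      then have j: "x \<in> J" using x dis by blast
      have "\<psi> t x \<in> X" using \<psi>[OF j x(2)] IJ by auto
      moreover have "sim t x (\<psi> t x)"
        using sim_sym[OF sim[OF \<psi>(1,2)[OF j x(2)]]] \<psi>(3)[OF j x(2)] by simp
      ultimately show ?thesis using False \<psi>[OF j x(2)] by (simp add: \<pi>_def)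
    qed
    show "\<pi> t x \<in> I \<longleftrightarrow> x \<in> J"
      using x dis[OF x(1)] \<phi>(1)[of x t] \<psi>(1)[of x t] IJ by (auto simp: \<pi>_def)
  qed
qed

end

section \<open>Short exact sequences\<close>

lemma rmod_hom_zero:
  assumes "right_module R M" "right_module R N" "f \<in> rmod_hom R M N"
  shows "f \<zero>\<^bsub>M\<^esub> = \<zero>\<^bsub>N\<^esub>"
  using rmod_hom_group_hom[OF assms] by (rule abelian_group_hom.hom_zero)

lemma rmod_hom_minus:
  assumes "right_module R M" "right_module R N" "f \<in> rmod_hom R M N" "x \<in> carrier M" "y \<in> carrier M"
  shows "f (x \<ominus>\<^bsub>M\<^esub> y) = f x \<ominus>\<^bsub>N\<^esub> f y"
proof -
  interpret f: abelian_group_hom M N f using rmod_hom_group_hom[OF assms(1-3)] .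
  show ?thesis using assms(4,5) by (simp add: a_minus_def)
qed

text \<open>The cyclic submodules generated by \<open>x\<close> and \<open>y\<close> are comparable,
  and each contains its generator because the modules are unitary.\<close>

lemma uniserial_elements:
  assumes M: "right_module R M" and u: "uniserial R M" and xy: "x \<in> carrier M" "y \<in> carrier M"
  shows "(\<exists>r\<in>carrier R. x \<star>\<^bsub>M\<^esub> r = y) \<or> (\<exists>r\<in>carrier R. y \<star>\<^bsub>M\<^esub> r = x)"
proof -
  interpret right_module R M by fact
  have cyclic: "rsubmodule ((\<lambda>r. z \<star>\<^bsub>M\<^esub> r) ` carrier R) R M" (is "rsubmodule ?N R M")
    if z: "z \<in> carrier M" for z
    unfolding rsubmodule_def
  proof (intro conjI ballI additive_subgroup.intro subgroup.intro)
    show "?N \<subseteq> carrier (add_monoid M)" using z by auto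
    have zz: "z \<star>\<^bsub>M\<^esub> \<zero>\<^bsub>R\<^esub> = \<zero>\<^bsub>M\<^esub>"
      using rsmult_r_distr[of z "\<zero>\<^bsub>R\<^esub>" "\<zero>\<^bsub>R\<^esub>"] z by (simp add: M.add.r_cancel_one')
    then show "\<one>\<^bsub>add_monoid M\<^esub> \<in> ?N" by (auto intro!: image_eqI[of _ _ "\<zero>\<^bsub>R\<^esub>"])
  next
    fix v w assume "v \<in> ?N" "w \<in> ?N"
    then obtain r s where rs: "r \<in> carrier R" "s \<in> carrier R" "v = z \<star>\<^bsub>M\<^esub> r" "w = z \<star>\<^bsub>M\<^esub> s" by auto
    then have "v \<oplus>\<^bsub>M\<^esub> w = z \<star>\<^bsub>M\<^esub> (r \<oplus>\<^bsub>R\<^esub> s)" using z by (simp add: rsmult_r_distr)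
    then show "v \<otimes>\<^bsub>add_monoid M\<^esub> w \<in> ?N" using rs by auto
  next
    fix v assume "v \<in> ?N"
    then obtain r where r: "r \<in> carrier R" "v = z \<star>\<^bsub>M\<^esub> r" by auto
    have "z \<star>\<^bsub>M\<^esub> (\<ominus>\<^bsub>R\<^esub> r) \<oplus>\<^bsub>M\<^esub> v = z \<star>\<^bsub>M\<^esub> (\<ominus>\<^bsub>R\<^esub> r \<oplus>\<^bsub>R\<^esub> r)"
      using r z by (subst rsmult_r_distr) auto
    also have "\<dots> = \<zero>\<^bsub>M\<^esub>"
      using rsmult_r_distr[of z "\<zero>\<^bsub>R\<^esub>" "\<zero>\<^bsub>R\<^esub>"] z r by (simp add: R.l_neg M.add.r_cancel_one')
    finally have "\<ominus>\<^bsub>M\<^esub> v = z \<star>\<^bsub>M\<^esub> (\<ominus>\<^bsub>R\<^esub> r)" using r z by (intro M.minus_equality) auto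
    then show "inv\<^bsub>add_monoid M\<^esub> v \<in> ?N" using r by (auto simp: a_inv_def[symmetric])
  next
    fix v s assume "v \<in> ?N" and s: "s \<in> carrier R"
    then obtain r where r: "r \<in> carrier R" "v = z \<star>\<^bsub>M\<^esub> r" by auto
    then have "v \<star>\<^bsub>M\<^esub> s = z \<star>\<^bsub>M\<^esub> (r \<otimes>\<^bsub>R\<^esub> s)" using z s by (simp add: rsmult_assoc)
    then show "v \<star>\<^bsub>M\<^esub> s \<in> ?N" using r s by auto
  qed
  have self: "z \<in> (\<lambda>r. z \<star>\<^bsub>M\<^esub> r) ` carrier R" if "z \<in> carrier M" for z
    using that by (auto intro!: image_eqI[of _ _ "\<one>\<^bsub>R\<^esub>"])
  have "(\<lambda>r. x \<star>\<^bsub>M\<^esub> r) ` carrier R \<subseteq> (\<lambda>r. y \<star>\<^bsub>M\<^esub> r) ` carrier R \<or>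
      (\<lambda>r. y \<star>\<^bsub>M\<^esub> r) ` carrier R \<subseteq> (\<lambda>r. x \<star>\<^bsub>M\<^esub> r) ` carrier R"
    using u cyclic xy unfolding uniserial_def by blast
  then show ?thesis using self[OF xy(1)] self[OF xy(2)] by (auto simp: subset_iff)
qed

text \<open>The copy of \<open>A\<close> inside the middle term. By exactness it is the kernel of
  \<open>ses_beta\<close>, so the quotient by it is a copy of \<open>C\<close>.\<close>

definition ses_image :: "('r, 'a, 'b, 'c) ses \<Rightarrow> 'b set" where
  "ses_image S = ses_alpha S ` carrier (ses_A S)"

lemma ses_objD:
  assumes "ses_obj R S"
  shows "right_module R (ses_A S)" "right_module R (ses_B S)" "right_module R (ses_C S)"
    "ses_alpha S \<in> rmod_hom R (ses_A S) (ses_B S)" "ses_beta S \<in> rmod_hom R (ses_B S) (ses_C S)"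
    "inj_on (ses_alpha S) (carrier (ses_A S))"
    "ses_image S = {b \<in> carrier (ses_B S). ses_beta S b = \<zero>\<^bsub>ses_C S\<^esub>}"
    "ses_beta S ` carrier (ses_B S) = carrier (ses_C S)"
  using assms by (auto simp: ses_obj_def ses_image_def)

lemma ses_image_iff_beta:
  assumes S: "ses_obj R S" and "x \<in> carrier (ses_B S)" "y \<in> carrier (ses_B S)"
  shows "x \<ominus>\<^bsub>ses_B S\<^esub> y \<in> ses_image S \<longleftrightarrow> ses_beta S x = ses_beta S y"
proof -
  interpret B: right_module R "ses_B S" using S by (rule ses_objD)
  interpret C: right_module R "ses_C S" using S by (rule ses_objD)
  have "ses_beta S (x \<ominus>\<^bsub>ses_B S\<^esub> y) = ses_beta S x \<ominus>\<^bsub>ses_C S\<^esub> ses_beta S y"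
    using assms ses_objD[OF S] by (intro rmod_hom_minus) auto
  moreover have "ses_beta S x \<in> carrier (ses_C S)" "ses_beta S y \<in> carrier (ses_C S)"
    using assms rmod_hom_closed[OF ses_objD(5)[OF S]] by auto
  ultimately show ?thesis
    using assms by (simp add: ses_objD(7)[OF S] C.M.minus_eq_zero_iff)
qed

lemma ses_homD:
  assumes "f \<in> ses_hom R S S'"
  shows "f \<in> rmod_hom R (ses_B S) (ses_B S')" "b \<in> ses_image S \<Longrightarrow> f b \<in> ses_image S'"
  using assms by (auto simp: ses_hom_def ses_image_def)

text \<open>The four conditions in terms of the middle terms alone, with \<open>C\<close> replaced
  by congruence modulo \<open>ses_image\<close>. The entries of a filtered endomorphism have this
  form.\<close>

fun middle_injsurj :: "me_index \<Rightarrow> lu_index \<Rightarrow> ('r, 'a, 'b, 'c) ses \<Rightarrow> ('r, 'd, 'e, 'f) ses \<Rightarrow>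
    ('b \<Rightarrow> 'e) \<Rightarrow> bool" where
  "middle_injsurj Idx_m Idx_l S S' f \<longleftrightarrow>
     (\<forall>x\<in>ses_image S. f x = \<zero>\<^bsub>ses_B S'\<^esub> \<longrightarrow> x = \<zero>\<^bsub>ses_B S\<^esub>)"
| "middle_injsurj Idx_e Idx_l S S' f \<longleftrightarrow> (\<forall>y\<in>ses_image S'. \<exists>x\<in>ses_image S. f x = y)"
| "middle_injsurj Idx_m Idx_u S S' f \<longleftrightarrow>
     (\<forall>x\<in>carrier (ses_B S). f x \<in> ses_image S' \<longrightarrow> x \<in> ses_image S)"
| "middle_injsurj Idx_e Idx_u S S' f \<longleftrightarrow>
     (\<forall>y\<in>carrier (ses_B S'). \<exists>x\<in>carrier (ses_B S). f x \<ominus>\<^bsub>ses_B S'\<^esub> y \<in> ses_image S')"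

text \<open>The commuting squares carry the conditions over: on the lower side because
  \<open>ses_alpha\<close> is injective, on the upper side because \<open>ses_beta\<close> is onto
  and two of its values agree exactly if the arguments differ by an element of
  \<open>ses_image\<close>.\<close>

lemma induced_injsurj_iff_middle:
  assumes S: "ses_obj R S" and S': "ses_obj R S'" and f: "f \<in> ses_hom R S S'"
  shows "induced_injsurj a b S S' f \<longleftrightarrow> middle_injsurj a b S S' f"
proof -
  interpret A: right_module R "ses_A S" using S by (rule ses_objD)
  interpret A': right_module R "ses_A S'" using S' by (rule ses_objD)
  interpret B: right_module R "ses_B S" using S by (rule ses_objD)
  interpret B': right_module R "ses_B S'" using S' by (rule ses_objD)
  note fh = ses_homD(1)[OF f]
  note al = ses_objD(4)[OF S] and be = ses_objD(5)[OF S]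
  note inj = ses_objD(6)[OF S] and inj' = ses_objD(6)[OF S']
  have alB: "ses_alpha S u \<in> carrier (ses_B S)" if "u \<in> carrier (ses_A S)" for u
    using rmod_hom_closed[OF al that] .
  have al0: "ses_alpha S \<zero>\<^bsub>ses_A S\<^esub> = \<zero>\<^bsub>ses_B S\<^esub>"
    using ses_objD(1,2)[OF S] al by (rule rmod_hom_zero)
  have f0: "f \<zero>\<^bsub>ses_B S\<^esub> = \<zero>\<^bsub>ses_B S'\<^esub>"
    using ses_objD(2)[OF S] ses_objD(2)[OF S'] fh by (rule rmod_hom_zero)
  have fB: "f x \<in> carrier (ses_B S')" if "x \<in> carrier (ses_B S)" for x using rmod_hom_closed[OF fh that] .
  note low = lower_map_commutes[OF f] and up = upper_map_commutes[OF S S' f]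
  have alpha_minus: "ses_alpha S (u \<ominus>\<^bsub>ses_A S\<^esub> v) = ses_alpha S u \<ominus>\<^bsub>ses_B S\<^esub> ses_alpha S v"
    if "u \<in> carrier (ses_A S)" "v \<in> carrier (ses_A S)" for u v
    using ses_objD(1,2)[OF S] al that by (rule rmod_hom_minus)
  have f_minus: "f (x \<ominus>\<^bsub>ses_B S\<^esub> y) = f x \<ominus>\<^bsub>ses_B S'\<^esub> f y"
    if "x \<in> carrier (ses_B S)" "y \<in> carrier (ses_B S)" for x y
    using ses_objD(2)[OF S] ses_objD(2)[OF S'] fh that by (rule rmod_hom_minus)
  have "inj_on (lower_map S S' f) (carrier (ses_A S)) \<longleftrightarrow> middle_injsurj Idx_m Idx_l S S' f"
  proof
    assume i: "inj_on (lower_map S S' f) (carrier (ses_A S))"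
    have "x = \<zero>\<^bsub>ses_B S\<^esub>" if "x \<in> ses_image S" "f x = \<zero>\<^bsub>ses_B S'\<^esub>" for x
    proof -
      obtain u where u: "u \<in> carrier (ses_A S)" "x = ses_alpha S u"
        using \<open>x \<in> ses_image S\<close> by (auto simp: ses_image_def)
      have "ses_alpha S' (lower_map S S' f u) = ses_alpha S' (lower_map S S' f \<zero>\<^bsub>ses_A S\<^esub>)"
        using that u low(2) al0 f0 by simp
      then have "lower_map S S' f u = lower_map S S' f \<zero>\<^bsub>ses_A S\<^esub>"
        using inj_onD[OF inj'] low(1) u by simp
      then have "u = \<zero>\<^bsub>ses_A S\<^esub>" using inj_onD[OF i] u by simp
      then show ?thesis using u al0 by simp
    qed
    then show "middle_injsurj Idx_m Idx_l S S' f" by simp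
  next
    assume m: "middle_injsurj Idx_m Idx_l S S' f"
    show "inj_on (lower_map S S' f) (carrier (ses_A S))"
    proof (rule inj_onI)
      fix u v assume uv: "u \<in> carrier (ses_A S)" "v \<in> carrier (ses_A S)"
        and eq: "lower_map S S' f u = lower_map S S' f v"
      have "f (ses_alpha S u) = f (ses_alpha S v)" using low(2)[OF uv(1)] low(2)[OF uv(2)] eq by simp
      then have "f (ses_alpha S (u \<ominus>\<^bsub>ses_A S\<^esub> v)) = \<zero>\<^bsub>ses_B S'\<^esub>"
        using uv alB fB by (simp only: alpha_minus f_minus B'.M.minus_eq_zero_iff)
      then have "ses_alpha S (u \<ominus>\<^bsub>ses_A S\<^esub> v) = \<zero>\<^bsub>ses_B S\<^esub>"
        using m uv by (simp add: ses_image_def)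
      then have "ses_alpha S u = ses_alpha S v"
        using uv alB by (simp only: alpha_minus B.M.minus_eq_zero_iff)
      then show "u = v" using inj_onD[OF inj] uv by simp
    qed
  qed
  moreover have "lower_map S S' f ` carrier (ses_A S) = carrier (ses_A S') \<longleftrightarrow>
      middle_injsurj Idx_e Idx_l S S' f"
  proof
    assume i: "lower_map S S' f ` carrier (ses_A S) = carrier (ses_A S')"
    have "\<exists>x\<in>ses_image S. f x = y" if y: "y \<in> ses_image S'" for y
    proof -
      obtain v where v: "v \<in> carrier (ses_A S')" "y = ses_alpha S' v" using y by (auto simp: ses_image_def)
      obtain u where u: "u \<in> carrier (ses_A S)" "v = lower_map S S' f u" using v i by blast
      then show ?thesis using v low(2)[OF u(1)] by (auto simp: ses_image_def)
    qed
    then show "middle_injsurj Idx_e Idx_l S S' f" by simp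
  next
    assume m: "middle_injsurj Idx_e Idx_l S S' f"
    show "lower_map S S' f ` carrier (ses_A S) = carrier (ses_A S')"
    proof
      show "lower_map S S' f ` carrier (ses_A S) \<subseteq> carrier (ses_A S')" using low(1) by auto
      show "carrier (ses_A S') \<subseteq> lower_map S S' f ` carrier (ses_A S)"
      proof
        fix v assume v: "v \<in> carrier (ses_A S')"
        then obtain u where u: "u \<in> carrier (ses_A S)" "f (ses_alpha S u) = ses_alpha S' v"
          using m by (auto simp: ses_image_def)
        then have "lower_map S S' f u = v" using low[OF u(1)] v inj_onD[OF inj'] by simp
        then show "v \<in> lower_map S S' f ` carrier (ses_A S)" using u by blast
      qed
    qed
  qed
  moreover have "inj_on (upper_map S S' f) (carrier (ses_C S)) \<longleftrightarrow> middle_injsurj Idx_m Idx_u S S' f"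
  proof -
    have z: "\<zero>\<^bsub>ses_B S\<^esub> \<in> carrier (ses_B S)" by simp
    have "inj_on (upper_map S S' f) (carrier (ses_C S)) \<longleftrightarrow>
        (\<forall>x\<in>carrier (ses_B S). \<forall>y\<in>carrier (ses_B S).
          f x \<ominus>\<^bsub>ses_B S'\<^esub> f y \<in> ses_image S' \<longrightarrow> x \<ominus>\<^bsub>ses_B S\<^esub> y \<in> ses_image S)"
      unfolding ses_objD(8)[OF S, symmetric] inj_on_def
      by (simp add: up ses_image_iff_beta[OF S] ses_image_iff_beta[OF S'] fB)
    also have "\<dots> \<longleftrightarrow> middle_injsurj Idx_m Idx_u S S' f"
    proof
      assume "middle_injsurj Idx_m Idx_u S S' f"
      then show "\<forall>x\<in>carrier (ses_B S). \<forall>y\<in>carrier (ses_B S).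
          f x \<ominus>\<^bsub>ses_B S'\<^esub> f y \<in> ses_image S' \<longrightarrow> x \<ominus>\<^bsub>ses_B S\<^esub> y \<in> ses_image S"
        by (simp add: f_minus[symmetric])
    next
      assume a: "\<forall>x\<in>carrier (ses_B S). \<forall>y\<in>carrier (ses_B S).
          f x \<ominus>\<^bsub>ses_B S'\<^esub> f y \<in> ses_image S' \<longrightarrow> x \<ominus>\<^bsub>ses_B S\<^esub> y \<in> ses_image S"
      \<comment> \<open>Taking the second element to be zero turns the condition on pairs into one
        on the kernel.\<close>
      have zero: "x \<ominus>\<^bsub>ses_B S\<^esub> \<zero>\<^bsub>ses_B S\<^esub> = x" if "x \<in> carrier (ses_B S)" for x
        using that B.M.minus_equality[of "\<zero>\<^bsub>ses_B S\<^esub>" "\<zero>\<^bsub>ses_B S\<^esub>"] by (simp add: a_minus_def)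
      have "x \<in> ses_image S" if x: "x \<in> carrier (ses_B S)" "f x \<in> ses_image S'" for x
        using a[rule_format, OF x(1) z] x f_minus[OF x(1) z] zero[OF x(1)] by simp
      then show "middle_injsurj Idx_m Idx_u S S' f" by simp
    qed
    finally show ?thesis .
  qed
  moreover have "upper_map S S' f ` carrier (ses_C S) = carrier (ses_C S') \<longleftrightarrow>
      middle_injsurj Idx_e Idx_u S S' f"
  proof -
    have "upper_map S S' f ` carrier (ses_C S) = (\<lambda>x. ses_beta S' (f x)) ` carrier (ses_B S)"
      unfolding ses_objD(8)[OF S, symmetric] by (auto simp: up image_image)
    moreover have "(\<lambda>x. ses_beta S' (f x)) ` carrier (ses_B S) \<subseteq> ses_beta S' ` carrier (ses_B S')"
      using fB by auto
    ultimately have "upper_map S S' f ` carrier (ses_C S) = carrier (ses_C S') \<longleftrightarrow>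
        (\<forall>y\<in>carrier (ses_B S'). \<exists>x\<in>carrier (ses_B S). ses_beta S' (f x) = ses_beta S' y)"
      unfolding ses_objD(8)[OF S', symmetric] by (fastforce simp: image_iff)
    then show ?thesis using ses_image_iff_beta[OF S'] fB by simp
  qed
  ultimately show ?thesis
    by (cases a; cases b) (simp_all add: induced_injsurj_def injsurj_def)
qed

section \<open>Short exact sequences as summands of a filtered module\<close>

context filtered_module
begin

lemma right_module_Z: "right_module R Z"
  by (rule right_module_axioms)

text \<open>A retract of the filtered module, with idempotent \<open>h\<close>. Its element types
  are unrelated to that of \<open>Z\<close>, which allows sequences over different types to be
  compared inside one ring.\<close>

definition summand :: "('r, 'a, 'b, 'c) ses \<Rightarrow> ('z \<Rightarrow> 'z) \<Rightarrow> ('b \<Rightarrow> 'z) \<Rightarrow> ('z \<Rightarrow> 'b) \<Rightarrow> bool" where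
  "summand S h inn out \<longleftrightarrow> ses_obj R S \<and>
     inn \<in> rmod_hom R (ses_B S) Z \<and> out \<in> rmod_hom R Z (ses_B S) \<and>
     (\<forall>x\<in>carrier (ses_B S). out (inn x) = x) \<and> (\<forall>z\<in>carrier Z. inn (out z) = h z) \<and>
     inn ` ses_image S \<subseteq> F \<and> out ` F \<subseteq> ses_image S"

lemma summandD:
  assumes "summand S h inn out"
  shows "ses_obj R S" "inn \<in> rmod_hom R (ses_B S) Z" "out \<in> rmod_hom R Z (ses_B S)"
    "x \<in> carrier (ses_B S) \<Longrightarrow> out (inn x) = x" "z \<in> carrier Z \<Longrightarrow> inn (out z) = h z"
    "x \<in> carrier (ses_B S) \<Longrightarrow> inn x \<in> carrier Z" "z \<in> carrier Z \<Longrightarrow> out z \<in> carrier (ses_B S)"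
    "x \<in> ses_image S \<Longrightarrow> inn x \<in> F" "z \<in> F \<Longrightarrow> out z \<in> ses_image S"
    "x \<in> carrier (ses_B S) \<Longrightarrow> inn x \<in> F \<longleftrightarrow> x \<in> ses_image S"
proof -
  show "ses_obj R S" and i: "inn \<in> rmod_hom R (ses_B S) Z" and o: "out \<in> rmod_hom R Z (ses_B S)"
    using assms by (auto simp: summand_def)
  show "x \<in> carrier (ses_B S) \<Longrightarrow> out (inn x) = x" "z \<in> carrier Z \<Longrightarrow> inn (out z) = h z"
    using assms by (auto simp: summand_def)
  show "x \<in> carrier (ses_B S) \<Longrightarrow> inn x \<in> carrier Z" "z \<in> carrier Z \<Longrightarrow> out z \<in> carrier (ses_B S)"
    using rmod_hom_closed[OF i] rmod_hom_closed[OF o] by auto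
  show "x \<in> ses_image S \<Longrightarrow> inn x \<in> F" "z \<in> F \<Longrightarrow> out z \<in> ses_image S"
    using assms by (auto simp: summand_def)
  show "inn x \<in> F \<longleftrightarrow> x \<in> ses_image S" if "x \<in> carrier (ses_B S)"
  proof
    assume "inn x \<in> F"
    then have "out (inn x) \<in> ses_image S" using assms by (auto simp: summand_def)
    then show "x \<in> ses_image S" using assms that by (simp add: summand_def)
  qed (use assms in \<open>auto simp: summand_def\<close>)
qed

text \<open>Comparability is read off from representatives: for \<open>F\<close> in the module
  \<open>A\<close> through \<open>ses_alpha\<close>, for the quotient by \<open>F\<close> in the
  module \<open>C\<close> through \<open>ses_beta\<close>.\<close>

lemma summand_uniserial:
  assumes s: "summand S h inn out" and u: "uniserial R (ses_A S)" "uniserial R (ses_C S)"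
    and zw: "z \<in> P b" "w \<in> P b"
  shows "(\<exists>a\<in>carrier R. cong b (h z \<star> a) (h w)) \<or> (\<exists>a\<in>carrier R. cong b (h w \<star> a) (h z))"
proof -
  note S = summandD(1)[OF s]
  interpret B: right_module R "ses_B S" using S by (rule ses_objD)
  have c: "z \<in> carrier Z" "w \<in> carrier Z" using zw by (auto simp: P_sub)
  have hc: "h v \<in> carrier Z" if "v \<in> carrier Z" for v
    using summandD(5,6,7)[OF s] that by metis
  have inn_minus: "inn (x \<ominus>\<^bsub>ses_B S\<^esub> y) = inn x \<ominus> inn y"
    if "x \<in> carrier (ses_B S)" "y \<in> carrier (ses_B S)" for x y
    using ses_objD(2)[OF S] right_module_Z summandD(2)[OF s] that by (rule rmod_hom_minus)
  have inn_smult: "inn (x \<star>\<^bsub>ses_B S\<^esub> a) = inn x \<star> a" if "x \<in> carrier (ses_B S)" "a \<in> carrier R" for x a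
    using rmod_hom_rsmult[OF summandD(2)[OF s] that] .
  show ?thesis
  proof (cases b)
    case Idx_l
    then have F: "z \<in> F" "w \<in> F" using zw by auto
    have hF: "h v \<in> F" if "v \<in> F" for v
      using summandD(5)[OF s F_sub[OF that]] summandD(8)[OF s summandD(9)[OF s that]] by simp
    obtain p q where pq: "p \<in> carrier (ses_A S)" "q \<in> carrier (ses_A S)"
      "out z = ses_alpha S p" "out w = ses_alpha S q"
      using summandD(9)[OF s F(1)] summandD(9)[OF s F(2)] by (auto simp: ses_image_def)
    have key: "cong b (h v \<star> a) (h v')"
      if "v \<in> F" "v' \<in> F" "a \<in> carrier R" "p' \<in> carrier (ses_A S)"
        "out v = ses_alpha S p'" "out v' = ses_alpha S (p' \<star>\<^bsub>ses_A S\<^esub> a)" for v v' a p'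
    proof -
      have "out v' = out v \<star>\<^bsub>ses_B S\<^esub> a"
        using rmod_hom_rsmult[OF ses_objD(4)[OF S] that(4,3)] that by simp
      then have "inn (out v') = inn (out v) \<star> a"
        using inn_smult[OF summandD(7)[OF s F_sub[OF that(1)]] that(3)] by simp
      then have "h v' = h v \<star> a" 
        by (simp only: summandD(5)[OF s F_sub[OF that(1)]] summandD(5)[OF s F_sub[OF that(2)]])
      then show ?thesis using hF[OF that(2)] cong_refl[of "h v'" b] Idx_l by simp
    qed
    show ?thesis
      using uniserial_elements[OF ses_objD(1)[OF S] u(1) pq(1,2)] key[OF F _ pq(1,3)] key[OF F(2,1) _ pq(2,4)] pq
      by metis
  next
    case Idx_u
    have oc: "out z \<in> carrier (ses_B S)" "out w \<in> carrier (ses_B S)" using summandD(7)[OF s] c by auto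
    have key: "cong b (h v \<star> a) (h v')"
      if "v \<in> carrier Z" "v' \<in> carrier Z" "a \<in> carrier R"
        "ses_beta S (out v) \<star>\<^bsub>ses_C S\<^esub> a = ses_beta S (out v')" for v v' a
    proof -
      have oc: "out v \<in> carrier (ses_B S)" "out v' \<in> carrier (ses_B S)" using summandD(7)[OF s] that by auto
      have "ses_beta S (out v \<star>\<^bsub>ses_B S\<^esub> a) = ses_beta S (out v')"
        using rmod_hom_rsmult[OF ses_objD(5)[OF S] oc(1) that(3)] that by simp
      then have "out v \<star>\<^bsub>ses_B S\<^esub> a \<ominus>\<^bsub>ses_B S\<^esub> out v' \<in> ses_image S"
        using ses_image_iff_beta[OF S] oc that by simp
      then have "inn (out v \<star>\<^bsub>ses_B S\<^esub> a \<ominus>\<^bsub>ses_B S\<^esub> out v') \<in> F" by (rule summandD(8)[OF s])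
      then have "h v \<star> a \<ominus> h v' \<in> F"
        using oc that summandD(5)[OF s] by (simp add: inn_minus inn_smult)
      then show ?thesis using Idx_u hc that by (simp add: cong_def)
    qed
    have "ses_beta S (out v) \<in> carrier (ses_C S)" if "out v \<in> carrier (ses_B S)" for v
      using rmod_hom_closed[OF ses_objD(5)[OF S] that] .
    then show ?thesis
      using uniserial_elements[OF ses_objD(3)[OF S] u(2)] oc key c by metis
  qed
qed

lemma summand_nonzero_iff:
  assumes s: "summand S h inn out"
  shows "(\<exists>z\<in>P b. h z \<notin> Q b) \<longleftrightarrow> end_nonzero b S"
proof -
  note S = summandD(1)[OF s]
  interpret A: right_module R "ses_A S" using S by (rule ses_objD)
  interpret B: right_module R "ses_B S" using S by (rule ses_objD)
  interpret C: right_module R "ses_C S" using S by (rule ses_objD)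
  have inn0: "inn \<zero>\<^bsub>ses_B S\<^esub> = \<zero>"
    using ses_objD(2)[OF S] right_module_Z summandD(2)[OF s] by (rule rmod_hom_zero)
  have out0: "out \<zero> = \<zero>\<^bsub>ses_B S\<^esub>"
    using right_module_Z ses_objD(2)[OF S] summandD(3)[OF s] by (rule rmod_hom_zero)
  have al0: "ses_alpha S \<zero>\<^bsub>ses_A S\<^esub> = \<zero>\<^bsub>ses_B S\<^esub>"
    using ses_objD(1,2,4)[OF S] by (rule rmod_hom_zero)
  show ?thesis
  proof (cases b)
    case Idx_l
    have "(\<exists>z\<in>F. h z \<noteq> \<zero>) \<longleftrightarrow> (\<exists>x\<in>ses_image S. x \<noteq> \<zero>\<^bsub>ses_B S\<^esub>)"
    proof
      assume "\<exists>z\<in>F. h z \<noteq> \<zero>"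
      then obtain z where z: "z \<in> F" "h z \<noteq> \<zero>" by blast
      then have "out z \<noteq> \<zero>\<^bsub>ses_B S\<^esub>" using summandD(5)[OF s F_sub[OF z(1)]] inn0 by auto
      then show "\<exists>x\<in>ses_image S. x \<noteq> \<zero>\<^bsub>ses_B S\<^esub>" using summandD(9)[OF s z(1)] by blast
    next
      assume "\<exists>x\<in>ses_image S. x \<noteq> \<zero>\<^bsub>ses_B S\<^esub>"
      then obtain x where x: "x \<in> ses_image S" "x \<noteq> \<zero>\<^bsub>ses_B S\<^esub>" by blast
      have xB: "x \<in> carrier (ses_B S)" using x ses_objD(7)[OF S] by auto
      have "h (inn x) = inn x"
        using summandD(5)[OF s summandD(6)[OF s xB]] summandD(4)[OF s xB] by simp
      moreover have "inn x \<noteq> \<zero>" using summandD(4)[OF s xB] out0 x by auto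
      ultimately show "\<exists>z\<in>F. h z \<noteq> \<zero>" using summandD(8)[OF s x(1)] by (intro bexI[of _ "inn x"]) auto
    qed
    also have "\<dots> \<longleftrightarrow> (\<exists>u\<in>carrier (ses_A S). u \<noteq> \<zero>\<^bsub>ses_A S\<^esub>)"
    proof -
      have "ses_alpha S u = \<zero>\<^bsub>ses_B S\<^esub> \<longleftrightarrow> u = \<zero>\<^bsub>ses_A S\<^esub>" if "u \<in> carrier (ses_A S)" for u
        using inj_onD[OF ses_objD(6)[OF S], of u "\<zero>\<^bsub>ses_A S\<^esub>"] al0 that by auto
      then show ?thesis by (auto simp: ses_image_def)
    qed
    also have "\<dots> \<longleftrightarrow> end_nonzero b S" using Idx_l by (auto simp: end_nonzero_def zero_module_def)
    finally show ?thesis using Idx_l by simp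
  next
    case Idx_u
    have "(\<exists>z\<in>carrier Z. h z \<notin> F) \<longleftrightarrow> (\<exists>x\<in>carrier (ses_B S). x \<notin> ses_image S)"
    proof
      assume "\<exists>z\<in>carrier Z. h z \<notin> F"
      then obtain z where z: "z \<in> carrier Z" "h z \<notin> F" by blast
      then have "out z \<notin> ses_image S" using summandD(5,8)[OF s] by metis
      then show "\<exists>x\<in>carrier (ses_B S). x \<notin> ses_image S" using summandD(7)[OF s z(1)] by blast
    next
      assume "\<exists>x\<in>carrier (ses_B S). x \<notin> ses_image S"
      then obtain x where x: "x \<in> carrier (ses_B S)" "x \<notin> ses_image S" by blast
      have "h (inn x) = inn x"
        using summandD(5)[OF s summandD(6)[OF s x(1)]] summandD(4)[OF s x(1)] by simp
      then show "\<exists>z\<in>carrier Z. h z \<notin> F"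
        using x summandD(6,10)[OF s x(1)] by (intro bexI[of _ "inn x"]) auto
    qed
    also have "\<dots> \<longleftrightarrow> (\<exists>c\<in>carrier (ses_C S). c \<noteq> \<zero>\<^bsub>ses_C S\<^esub>)"
      using ses_objD(7)[OF S] unfolding ses_objD(8)[OF S, symmetric] by auto
    also have "\<dots> \<longleftrightarrow> end_nonzero b S" using Idx_u by (auto simp: end_nonzero_def zero_module_def)
    finally show ?thesis using Idx_u by simp
  qed
qed

lemma summand_to_end:
  assumes s: "summand S h inn out" and s': "summand S' h' inn' out'" and f: "f \<in> ses_hom R S S'"
  shows "(\<lambda>z\<in>carrier Z. inn' (f (out z))) \<in> carrier E"
proof (rule EI)
  note o = summandD(3)[OF s] and i = summandD(2)[OF s'] and fh = ses_homD(1)[OF f]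
  note oc = summandD(7)[OF s] and fc = rmod_hom_closed[OF fh]
  fix z assume z: "z \<in> carrier Z"
  show "(\<lambda>z\<in>carrier Z. inn' (f (out z))) z \<in> carrier Z"
    using z oc fc summandD(6)[OF s'] by simp
  show "(\<lambda>z\<in>carrier Z. inn' (f (out z))) (z \<star> a) = (\<lambda>z\<in>carrier Z. inn' (f (out z))) z \<star> a"
    if "a \<in> carrier R" for a
    using z oc fc that
    by (simp add: rmod_hom_rsmult[OF o] rmod_hom_rsmult[OF fh] rmod_hom_rsmult[OF i])
  show "(\<lambda>z\<in>carrier Z. inn' (f (out z))) (z \<oplus> w) =
      (\<lambda>z\<in>carrier Z. inn' (f (out z))) z \<oplus> (\<lambda>z\<in>carrier Z. inn' (f (out z))) w"
    if "w \<in> carrier Z" for w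
    using z oc fc that by (simp add: rmod_hom_add[OF o] rmod_hom_add[OF fh] rmod_hom_add[OF i])
next
  fix z assume "z \<in> F"
  then show "(\<lambda>z\<in>carrier Z. inn' (f (out z))) z \<in> F"
    using summandD(9)[OF s] ses_homD(2)[OF f] summandD(8)[OF s'] by (simp add: F_sub)
qed simp

lemma end_to_summand:
  assumes s: "summand S h inn out" and s': "summand S' h' inn' out'" and r: "r \<in> carrier E"
  shows "(\<lambda>x. out' (r (inn x))) \<in> ses_hom R S S'"
proof -
  note i = summandD(2)[OF s] and o = summandD(3)[OF s']
  note ic = summandD(6)[OF s]
  have "(\<lambda>x. out' (r (inn x))) \<in> rmod_hom R (ses_B S) (ses_B S')"
  proof (rule rmod_homI)
    fix x y assume "x \<in> carrier (ses_B S)" "y \<in> carrier (ses_B S)"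
    then show "out' (r (inn (x \<oplus>\<^bsub>ses_B S\<^esub> y))) = out' (r (inn x)) \<oplus>\<^bsub>ses_B S'\<^esub> out' (r (inn y))"
      using ic r by (simp add: rmod_hom_add[OF i] E_add rmod_hom_add[OF o])
  next
    fix x a assume "x \<in> carrier (ses_B S)" "a \<in> carrier R"
    then show "out' (r (inn (x \<star>\<^bsub>ses_B S\<^esub> a))) = out' (r (inn x)) \<star>\<^bsub>ses_B S'\<^esub> a"
      using ic r by (simp add: rmod_hom_rsmult[OF i] E_smult rmod_hom_rsmult[OF o])
  qed (use ic r summandD(7)[OF s'] in auto)
  moreover have "out' (r (inn x)) \<in> ses_image S'" if "x \<in> ses_image S" for x
    using summandD(8)[OF s that] E_F[OF r] summandD(9)[OF s'] by blast
  ultimately show ?thesis by (auto simp: ses_hom_def ses_image_def)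
qed

end

section \<open>Matrix entries and morphisms between short exact sequences\<close>

context split_module
begin

text \<open>The hypothesis \<open>key\<close> fits both passages between \<open>f\<close> and
  \<open>r\<close>: compressing an endomorphism to a morphism of summands, and extending a morphism
  by zero to an endomorphism.\<close>

lemma entry_iff_middle:
  assumes s: "summand S (e {x}) inn out" and s': "summand S' (e {y}) inn' out'"
    and f: "f \<in> ses_hom R S S'"
    and key: "\<And>z. z \<in> carrier Z \<Longrightarrow> e {y} (r (e {x} z)) = inn' (f (out z))"
  shows "entry_injsurj a b x y r \<longleftrightarrow> middle_injsurj a b S S' f"
proof -
  note S = summandD(1)[OF s] and S' = summandD(1)[OF s']
  interpret B: right_module R "ses_B S" using S by (rule ses_objD)
  interpret B': right_module R "ses_B S'" using S' by (rule ses_objD)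
  have inn0: "inn \<zero>\<^bsub>ses_B S\<^esub> = \<zero>"
    using ses_objD(2)[OF S] right_module_Z summandD(2)[OF s] by (rule rmod_hom_zero)
  have inn0': "inn' \<zero>\<^bsub>ses_B S'\<^esub> = \<zero>"
    using ses_objD(2)[OF S'] right_module_Z summandD(2)[OF s'] by (rule rmod_hom_zero)
  have out0: "out \<zero> = \<zero>\<^bsub>ses_B S\<^esub>"
    using right_module_Z ses_objD(2)[OF S] summandD(3)[OF s] by (rule rmod_hom_zero)
  have imB: "v \<in> carrier (ses_B S)" if "v \<in> ses_image S" for v using that ses_objD(7)[OF S] by auto
  have imB': "v \<in> carrier (ses_B S')" if "v \<in> ses_image S'" for v using that ses_objD(7)[OF S'] by auto
  have fB: "f v \<in> carrier (ses_B S')" if "v \<in> carrier (ses_B S)" for v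
    using rmod_hom_closed[OF ses_homD(1)[OF f] that] .
  have inn_eq: "inn v = inn w \<longleftrightarrow> v = w" if "v \<in> carrier (ses_B S)" "w \<in> carrier (ses_B S)" for v w
    using summandD(4)[OF s that(1)] summandD(4)[OF s that(2)] by metis
  have inn_eq': "inn' v = inn' w \<longleftrightarrow> v = w" if "v \<in> carrier (ses_B S')" "w \<in> carrier (ses_B S')" for v w
    using summandD(4)[OF s' that(1)] summandD(4)[OF s' that(2)] by metis
  have ex: "e {x} z = inn (out z)" and ey: "e {y} z = inn' (out' z)" if "z \<in> carrier Z" for z
    using summandD(5)[OF s that] summandD(5)[OF s' that] by auto
  have key2: "e {y} (r (inn (out z))) = inn' (f (out z))" if "z \<in> carrier Z" for z
    using key[OF that] ex[OF that] by simp
  have Fc: "z \<in> carrier Z" if "z \<in> F" for z using that by (rule F_sub)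
  have outB: "out z \<in> carrier (ses_B S)" "out' z \<in> carrier (ses_B S')" if "z \<in> carrier Z" for z
    using summandD(7)[OF s that] summandD(7)[OF s' that] by auto
  show ?thesis
  proof (cases a; cases b)
    assume ab: "a = Idx_m" "b = Idx_l"
    have "entry_injsurj a b x y r \<longleftrightarrow> (\<forall>z\<in>F. f (out z) = \<zero>\<^bsub>ses_B S'\<^esub> \<longrightarrow> out z = \<zero>\<^bsub>ses_B S\<^esub>)"
    proof -
      have "inn' (f (out z)) = \<zero> \<longleftrightarrow> f (out z) = \<zero>\<^bsub>ses_B S'\<^esub>"
        "inn (out z) = \<zero> \<longleftrightarrow> out z = \<zero>\<^bsub>ses_B S\<^esub>" if "z \<in> F" for z
        using inn_eq'[OF fB[OF outB(1)[OF Fc[OF that]]], of "\<zero>\<^bsub>ses_B S'\<^esub>"]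
          inn_eq[OF outB(1)[OF Fc[OF that]], of "\<zero>\<^bsub>ses_B S\<^esub>"] inn0 inn0' by auto
      then show ?thesis using ab by (simp add: entry_injsurj_def key2 Fc ex)
    qed
    also have "\<dots> \<longleftrightarrow> middle_injsurj a b S S' f"
    proof
      assume a: "\<forall>z\<in>F. f (out z) = \<zero>\<^bsub>ses_B S'\<^esub> \<longrightarrow> out z = \<zero>\<^bsub>ses_B S\<^esub>"
      have "v = \<zero>\<^bsub>ses_B S\<^esub>" if "v \<in> ses_image S" "f v = \<zero>\<^bsub>ses_B S'\<^esub>" for v
        using a[rule_format, OF summandD(8)[OF s that(1)]] that summandD(4)[OF s imB[OF that(1)]] by simp
      then show "middle_injsurj a b S S' f" using ab by simp
    next
      assume "middle_injsurj a b S S' f"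
      then show "\<forall>z\<in>F. f (out z) = \<zero>\<^bsub>ses_B S'\<^esub> \<longrightarrow> out z = \<zero>\<^bsub>ses_B S\<^esub>"
        using ab summandD(9)[OF s] by simp
    qed
    finally show ?thesis .
  next
    assume ab: "a = Idx_m" "b = Idx_u"
    have "entry_injsurj a b x y r \<longleftrightarrow>
        (\<forall>z\<in>carrier Z. f (out z) \<in> ses_image S' \<longrightarrow> out z \<in> ses_image S)"
      using ab by (simp add: entry_injsurj_def key2 ex fB outB summandD(10)[OF s] summandD(10)[OF s'])
    also have "\<dots> \<longleftrightarrow> middle_injsurj a b S S' f"
    proof
      assume a: "\<forall>z\<in>carrier Z. f (out z) \<in> ses_image S' \<longrightarrow> out z \<in> ses_image S"
      have "v \<in> ses_image S" if "v \<in> carrier (ses_B S)" "f v \<in> ses_image S'" for v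
        using a[rule_format, OF summandD(6)[OF s that(1)]] that summandD(4)[OF s that(1)] by simp
      then show "middle_injsurj a b S S' f" using ab by simp
    qed (use ab outB in simp)
    finally show ?thesis .
  next
    assume ab: "a = Idx_e" "b = Idx_l"
    have "entry_injsurj a b x y r \<longleftrightarrow> (\<forall>w\<in>F. \<exists>z\<in>F. f (out z) = out' w)"
    proof -
      have "cong Idx_l (inn' (f (out z))) (inn' (out' w)) \<longleftrightarrow> f (out z) = out' w" if "z \<in> F" "w \<in> F" for z w
      proof -
        have i: "inn' (f (out z)) \<in> F" "inn' (out' w) \<in> F"
          using summandD(8,9)[OF s'] summandD(9)[OF s] ses_homD(2)[OF f] that by auto
        then have "cong Idx_l (inn' (f (out z))) (inn' (out' w)) \<longleftrightarrow> inn' (f (out z)) = inn' (out' w)"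
          using Fc by (simp add: cong_def M.minus_eq_zero_iff)
        then show ?thesis using inn_eq' fB outB Fc that by simp
      qed
      then show ?thesis using ab by (simp add: entry_injsurj_def key Fc ey)
    qed
    also have "\<dots> \<longleftrightarrow> middle_injsurj a b S S' f"
    proof
      assume a: "\<forall>w\<in>F. \<exists>z\<in>F. f (out z) = out' w"
      have "\<exists>u\<in>ses_image S. f u = v" if v: "v \<in> ses_image S'" for v
      proof -
        obtain z where "z \<in> F" "f (out z) = out' (inn' v)" using a summandD(8)[OF s' v] by blast
        then show ?thesis
          using summandD(9)[OF s] summandD(4)[OF s' imB'[OF v]] by auto
      qed
      then show "middle_injsurj a b S S' f" using ab by simp
    next
      assume m: "middle_injsurj a b S S' f"
      have "\<exists>z\<in>F. f (out z) = out' w" if w: "w \<in> F" for w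
      proof -
        obtain u where "u \<in> ses_image S" "f u = out' w" using m ab summandD(9)[OF s' w] by auto
        then show ?thesis using summandD(8)[OF s] summandD(4)[OF s imB] by (intro bexI[of _ "inn u"]) auto
      qed
      then show "\<forall>w\<in>F. \<exists>z\<in>F. f (out z) = out' w" by blast
    qed
    finally show ?thesis .
  next
    assume ab: "a = Idx_e" "b = Idx_u"
    have "entry_injsurj a b x y r \<longleftrightarrow>
        (\<forall>w\<in>carrier Z. \<exists>z\<in>carrier Z. f (out z) \<ominus>\<^bsub>ses_B S'\<^esub> out' w \<in> ses_image S')"
    proof -
      have "cong Idx_u (inn' (f (out z))) (inn' (out' w)) \<longleftrightarrow>
          f (out z) \<ominus>\<^bsub>ses_B S'\<^esub> out' w \<in> ses_image S'" if "z \<in> carrier Z" "w \<in> carrier Z" for z w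
      proof -
        have c: "f (out z) \<in> carrier (ses_B S')" "out' w \<in> carrier (ses_B S')" using fB outB that by auto
        have "inn' (f (out z) \<ominus>\<^bsub>ses_B S'\<^esub> out' w) = inn' (f (out z)) \<ominus> inn' (out' w)"
          using ses_objD(2)[OF S'] right_module_Z summandD(2)[OF s'] c by (rule rmod_hom_minus)
        then show ?thesis
          using summandD(10)[OF s', of "f (out z) \<ominus>\<^bsub>ses_B S'\<^esub> out' w"] summandD(6)[OF s'] c
          by (simp add: cong_def)
      qed
      then show ?thesis using ab by (simp add: entry_injsurj_def key ey)
    qed
    also have "\<dots> \<longleftrightarrow> middle_injsurj a b S S' f"
    proof
      assume a: "\<forall>w\<in>carrier Z. \<exists>z\<in>carrier Z. f (out z) \<ominus>\<^bsub>ses_B S'\<^esub> out' w \<in> ses_image S'"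
      have "\<exists>u\<in>carrier (ses_B S). f u \<ominus>\<^bsub>ses_B S'\<^esub> v \<in> ses_image S'" if v: "v \<in> carrier (ses_B S')" for v
      proof -
        obtain z where "z \<in> carrier Z" "f (out z) \<ominus>\<^bsub>ses_B S'\<^esub> out' (inn' v) \<in> ses_image S'"
          using a summandD(6)[OF s' v] by blast
        then show ?thesis using outB summandD(4)[OF s' v] by auto
      qed
      then show "middle_injsurj a b S S' f" using ab by simp
    next
      assume m: "middle_injsurj a b S S' f"
      have "\<exists>z\<in>carrier Z. f (out z) \<ominus>\<^bsub>ses_B S'\<^esub> out' w \<in> ses_image S'" if w: "w \<in> carrier Z" for w
      proof -
        obtain u where "u \<in> carrier (ses_B S)" "f u \<ominus>\<^bsub>ses_B S'\<^esub> out' w \<in> ses_image S'"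
          using m ab outB(2)[OF w] by auto
        then show ?thesis using summandD(4,6)[OF s] by (intro bexI[of _ "inn u"]) auto
      qed
      then show "\<forall>w\<in>carrier Z. \<exists>z\<in>carrier Z. f (out z) \<ominus>\<^bsub>ses_B S'\<^esub> out' w \<in> ses_image S'" by blast
    qed
    finally show ?thesis .
  qed
qed

lemma entry_to_induced:
  assumes s: "summand S (e {x}) inn out" and s': "summand S' (e {y}) inn' out'"
    and r: "r \<in> carrier E" "entry_injsurj a b x y r"
  shows "\<exists>f\<in>ses_hom R S S'. induced_injsurj a b S S' f"
proof -
  define f where "f = (\<lambda>v. out' (r (inn v)))"
  have f: "f \<in> ses_hom R S S'" unfolding f_def using s s' r(1) by (rule end_to_summand)
  have "e {y} (r (e {x} z)) = inn' (f (out z))" if "z \<in> carrier Z" for z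
    using summandD(5)[OF s that] summandD(5)[OF s', of "r (e {x} z)"] r that by (simp add: f_def)
  then have "middle_injsurj a b S S' f" using entry_iff_middle[OF s s' f, of r] r by simp
  then show ?thesis
    using f induced_injsurj_iff_middle[OF summandD(1)[OF s] summandD(1)[OF s'] f] by blast
qed

lemma induced_to_entry:
  assumes s: "summand S (e {x}) inn out" and s': "summand S' (e {y}) inn' out'"
    and f: "f \<in> ses_hom R S S'" "induced_injsurj a b S S' f"
  shows "\<exists>r\<in>carrier E. entry_injsurj a b x y r"
proof -
  define r where "r = (\<lambda>z\<in>carrier Z. inn' (f (out z)))"
  have r: "r \<in> carrier E" unfolding r_def using s s' f(1) by (rule summand_to_end)
  have "e {y} (r (e {x} z)) = inn' (f (out z))" if z: "z \<in> carrier Z" for z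
  proof -
    have o: "out z \<in> carrier (ses_B S)" using summandD(7)[OF s z] .
    have "r (e {x} z) = inn' (f (out (inn (out z))))" using summandD(5)[OF s z] z by (simp add: r_def)
    also have "\<dots> = inn' (f (out z))" using summandD(4)[OF s o] by simp
    finally have re: "r (e {x} z) = inn' (f (out z))" .
    have "f (out z) \<in> carrier (ses_B S')" using rmod_hom_closed[OF ses_homD(1)[OF f(1)] o] .
    then show ?thesis
      using re summandD(4,6)[OF s'] summandD(5)[OF s', of "inn' (f (out z))"] by simp
  qed
  then have "entry_injsurj a b x y r"
    using entry_iff_middle[OF s s' f(1), of r] f
      induced_injsurj_iff_middle[OF summandD(1)[OF s] summandD(1)[OF s'] f(1)] by simp
  then show ?thesis using r by blast
qed

lemma sim_iff_same_class:
  assumes s: "summand S (e {x}) inn out" and s': "summand S' (e {y}) inn' out'"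
    and nz: "nonzero_at b x" "nonzero_at b y"
  shows "sim (a, b) x y \<longleftrightarrow> same_class R a b S S'"
proof -
  have "sim (a, b) x y \<longleftrightarrow>
      (\<exists>r\<in>carrier E. entry_injsurj a b x y r) \<and> (\<exists>r\<in>carrier E. entry_injsurj a b y x r)"
    using nz by (auto simp: sim_def type_good_def)
  moreover have "same_class R a b S S' \<longleftrightarrow>
      (\<exists>f\<in>ses_hom R S S'. induced_injsurj a b S S' f) \<and> (\<exists>f\<in>ses_hom R S' S. induced_injsurj a b S' S f)"
    by (auto simp: same_class_def)
  ultimately show ?thesis
    using entry_to_induced[OF s s', where a = a and b = b] entry_to_induced[OF s' s, where a = a and b = b]
      induced_to_entry[OF s s', where a = a and b = b] induced_to_entry[OF s' s, where a = a and b = b] by blast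
qed

lemma ses_iso_iff:
  assumes s: "summand S (e I) inn out" and s': "summand S' (e J) inn' out'"
  shows "ses_iso R S S' \<longleftrightarrow>
    (\<exists>f\<in>carrier E. \<exists>g\<in>carrier E. e J \<otimes>\<^bsub>E\<^esub> (f \<otimes>\<^bsub>E\<^esub> e I) = f \<and> e I \<otimes>\<^bsub>E\<^esub> (g \<otimes>\<^bsub>E\<^esub> e J) = g \<and>
      g \<otimes>\<^bsub>E\<^esub> f = e I \<and> f \<otimes>\<^bsub>E\<^esub> g = e J)"
proof
  \<comment> \<open>This fact and the next are stated for arbitrary summands over arbitrary types,
    because each is applied a second time with the two sequences exchanged.\<close>
  have lift: "e J \<otimes>\<^bsub>E\<^esub> ((\<lambda>z\<in>carrier Z. inn' (f (out z))) \<otimes>\<^bsub>E\<^esub> e I) = (\<lambda>z\<in>carrier Z. inn' (f (out z)))"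
    if s: "summand S (e I) inn out" and s': "summand S' (e J) inn' out'" and f: "f \<in> ses_hom R S S'"
    for S :: "('r, 'a1, 'b1, 'c1) ses" and S' :: "('r, 'a2, 'b2, 'c2) ses" and I J inn out inn' out' f
  proof -
    have r: "(\<lambda>z\<in>carrier Z. inn' (f (out z))) \<in> carrier E" using s s' f by (rule summand_to_end)
    show ?thesis
    proof (rule E_eqI)
      fix z assume z: "z \<in> carrier Z"
      have o: "out z \<in> carrier (ses_B S)" using summandD(7)[OF s z] .
      have fo: "f (out z) \<in> carrier (ses_B S')" using rmod_hom_closed[OF ses_homD(1)[OF f] o] .
      have "out (e I z) = out z" using summandD(5)[OF s z] summandD(4)[OF s o] by metis
      moreover have "e J (inn' (f (out z))) = inn' (f (out z))"
        using summandD(5)[OF s' summandD(6)[OF s' fo]] summandD(4)[OF s' fo] by simp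
      ultimately show "(e J \<otimes>\<^bsub>E\<^esub> ((\<lambda>z\<in>carrier Z. inn' (f (out z))) \<otimes>\<^bsub>E\<^esub> e I)) z =
          (\<lambda>z\<in>carrier Z. inn' (f (out z))) z" using z by simp
    qed (use r in \<open>auto intro: E_mult_closed\<close>)
  qed
  have comp: "(\<lambda>z\<in>carrier Z. inn (g (out' z))) \<otimes>\<^bsub>E\<^esub> (\<lambda>z\<in>carrier Z. inn' (f (out z))) = e I"
    if s: "summand S (e I) inn out" and s': "summand S' (e J) inn' out'" and f: "f \<in> ses_hom R S S'"
      and g: "g \<in> ses_hom R S' S" and gf: "\<forall>x\<in>carrier (ses_B S). g (f x) = x"
    for S :: "('r, 'a1, 'b1, 'c1) ses" and S' :: "('r, 'a2, 'b2, 'c2) ses" and I J inn out inn' out' f g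
  proof (rule E_eqI)
    have "(\<lambda>z\<in>carrier Z. inn' (f (out z))) \<in> carrier E" using s s' f by (rule summand_to_end)
    moreover have "(\<lambda>z\<in>carrier Z. inn (g (out' z))) \<in> carrier E" using s' s g by (rule summand_to_end)
    ultimately show "(\<lambda>z\<in>carrier Z. inn (g (out' z))) \<otimes>\<^bsub>E\<^esub> (\<lambda>z\<in>carrier Z. inn' (f (out z))) \<in> carrier E"
      by (intro E_mult_closed)
    fix z assume z: "z \<in> carrier Z"
    have o: "out z \<in> carrier (ses_B S)" using summandD(7)[OF s z] .
    have fo: "f (out z) \<in> carrier (ses_B S')" using rmod_hom_closed[OF ses_homD(1)[OF f] o] .
    then show "((\<lambda>z\<in>carrier Z. inn (g (out' z))) \<otimes>\<^bsub>E\<^esub> (\<lambda>z\<in>carrier Z. inn' (f (out z)))) z = e I z"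
      using z o gf summandD(6)[OF s' fo] summandD(4)[OF s' fo] summandD(5)[OF s z] by simp
  qed auto
  assume "ses_iso R S S'"
  then obtain f g where fg: "f \<in> ses_hom R S S'" "g \<in> ses_hom R S' S"
    "\<forall>x\<in>carrier (ses_B S). g (f x) = x" "\<forall>y\<in>carrier (ses_B S'). f (g y) = y"
    by (auto simp: ses_iso_def)
  show "\<exists>f\<in>carrier E. \<exists>g\<in>carrier E. e J \<otimes>\<^bsub>E\<^esub> (f \<otimes>\<^bsub>E\<^esub> e I) = f \<and> e I \<otimes>\<^bsub>E\<^esub> (g \<otimes>\<^bsub>E\<^esub> e J) = g \<and>
      g \<otimes>\<^bsub>E\<^esub> f = e I \<and> f \<otimes>\<^bsub>E\<^esub> g = e J"
    using lift[OF s s' fg(1)] lift[OF s' s fg(2)] comp[OF s s' fg(1,2,3)] comp[OF s' s fg(2,1,4)]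
      summand_to_end[OF s s' fg(1)] summand_to_end[OF s' s fg(2)] by blast
next
  have retract: "out (g (inn' (out' (f (inn x))))) = x"
    if s: "summand S (e I) inn out" and s': "summand S' (e J) inn' out'"
      and f: "f \<in> carrier E" "e J \<otimes>\<^bsub>E\<^esub> (f \<otimes>\<^bsub>E\<^esub> e I) = f" and g: "g \<in> carrier E" "g \<otimes>\<^bsub>E\<^esub> f = e I"
      and x: "x \<in> carrier (ses_B S)"
    for S :: "('r, 'a1, 'b1, 'c1) ses" and S' :: "('r, 'a2, 'b2, 'c2) ses" and I J inn out inn' out' f g x
  proof -
    have ix: "inn x \<in> carrier Z" using summandD(6)[OF s x] .
    have "f (inn x) = e J (f (e I (inn x)))" using arg_cong[OF f(2), of "\<lambda>h. h (inn x)"] ix by simp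
    then have "e J (f (inn x)) = f (inn x)" using f ix by (metis E_closed e_E e_idem)
    then have "inn' (out' (f (inn x))) = f (inn x)" using summandD(5)[OF s', of "f (inn x)"] f ix by simp
    then have "out (g (inn' (out' (f (inn x))))) = out (e I (inn x))"
      using arg_cong[OF g(2), of "\<lambda>h. h (inn x)"] ix by simp
    also have "\<dots> = x" using summandD(5)[OF s ix] summandD(4)[OF s x] by metis
    finally show ?thesis .
  qed
  assume "\<exists>f\<in>carrier E. \<exists>g\<in>carrier E. e J \<otimes>\<^bsub>E\<^esub> (f \<otimes>\<^bsub>E\<^esub> e I) = f \<and> e I \<otimes>\<^bsub>E\<^esub> (g \<otimes>\<^bsub>E\<^esub> e J) = g \<and>
      g \<otimes>\<^bsub>E\<^esub> f = e I \<and> f \<otimes>\<^bsub>E\<^esub> g = e J"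
  then obtain f g where fg: "f \<in> carrier E" "g \<in> carrier E" "e J \<otimes>\<^bsub>E\<^esub> (f \<otimes>\<^bsub>E\<^esub> e I) = f"
    "e I \<otimes>\<^bsub>E\<^esub> (g \<otimes>\<^bsub>E\<^esub> e J) = g" "g \<otimes>\<^bsub>E\<^esub> f = e I" "f \<otimes>\<^bsub>E\<^esub> g = e J"
    by (elim bexE conjE)
  show "ses_iso R S S'"
    unfolding ses_iso_def
  proof (intro bexI conjI ballI)
    show "(\<lambda>x. out' (f (inn x))) \<in> ses_hom R S S'" using s s' fg(1) by (rule end_to_summand)
    show "(\<lambda>x. out (g (inn' x))) \<in> ses_hom R S' S" using s' s fg(2) by (rule end_to_summand)
    show "out (g (inn' (out' (f (inn x))))) = x" if "x \<in> carrier (ses_B S)" for x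
      using s s' fg(1,3,2,5) that by (rule retract)
    show "out' (f (inn (out (g (inn' x))))) = x" if "x \<in> carrier (ses_B S')" for x
      using s' s fg(2,4,1,6) that by (rule retract)
  qed
qed

end

section \<open>Products and direct sums\<close>

text \<open>The two families may have different element types, so the common module is a binary
  product of the two sums and not a sum over one index set.\<close>

definition rmod_prod :: "('r, 'm) rmodule \<Rightarrow> ('r, 'n) rmodule \<Rightarrow> ('r, 'm \<times> 'n) rmodule" where
  "rmod_prod M N =
     \<lparr>carrier = carrier M \<times> carrier N,
      monoid.mult = (\<lambda>x y. undefined),
      monoid.one = undefined,
      ring.zero = (\<zero>\<^bsub>M\<^esub>, \<zero>\<^bsub>N\<^esub>),
      ring.add = (\<lambda>x y. (fst x \<oplus>\<^bsub>M\<^esub> fst y, snd x \<oplus>\<^bsub>N\<^esub> snd y)),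
      rsmult = (\<lambda>x r. (fst x \<star>\<^bsub>M\<^esub> r, snd x \<star>\<^bsub>N\<^esub> r))\<rparr>"

lemma rmod_prod_simps [simp]:
  "carrier (rmod_prod M N) = carrier M \<times> carrier N"
  "\<zero>\<^bsub>rmod_prod M N\<^esub> = (\<zero>\<^bsub>M\<^esub>, \<zero>\<^bsub>N\<^esub>)"
  "x \<oplus>\<^bsub>rmod_prod M N\<^esub> y = (fst x \<oplus>\<^bsub>M\<^esub> fst y, snd x \<oplus>\<^bsub>N\<^esub> snd y)"
  "x \<star>\<^bsub>rmod_prod M N\<^esub> r = (fst x \<star>\<^bsub>M\<^esub> r, snd x \<star>\<^bsub>N\<^esub> r)"
  by (simp_all add: rmod_prod_def)

lemma right_module_rmod_prod:
  assumes "right_module R M" "right_module R N"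
  shows "right_module R (rmod_prod M N)"
proof -
  interpret M: right_module R M by fact
  interpret N: right_module R N by fact
  have "abelian_group (rmod_prod M N)"
  proof (rule abelian_groupI)
    fix x assume "x \<in> carrier (rmod_prod M N)"
    then show "\<exists>y\<in>carrier (rmod_prod M N). y \<oplus>\<^bsub>rmod_prod M N\<^esub> x = \<zero>\<^bsub>rmod_prod M N\<^esub>"
      by (intro bexI[of _ "(\<ominus>\<^bsub>M\<^esub> fst x, \<ominus>\<^bsub>N\<^esub> snd x)"]) (auto simp: M.M.l_neg N.M.l_neg)
  qed (auto simp: M.M.a_ac N.M.a_ac)
  then show ?thesis
    by (intro right_module.intro right_module_axioms.intro M.R.ring_axioms)
      (auto simp: M.rsmult_l_distr M.rsmult_r_distr M.rsmult_assoc
        N.rsmult_l_distr N.rsmult_r_distr N.rsmult_assoc)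
qed

lemma ses_image_submodule:
  assumes "ses_obj R S"
  shows "\<zero>\<^bsub>ses_B S\<^esub> \<in> ses_image S"
    and "x \<in> ses_image S \<Longrightarrow> x \<in> carrier (ses_B S)"
    and "x \<in> ses_image S \<Longrightarrow> y \<in> ses_image S \<Longrightarrow> x \<oplus>\<^bsub>ses_B S\<^esub> y \<in> ses_image S"
    and "x \<in> ses_image S \<Longrightarrow> \<ominus>\<^bsub>ses_B S\<^esub> x \<in> ses_image S"
    and "x \<in> ses_image S \<Longrightarrow> r \<in> carrier R \<Longrightarrow> x \<star>\<^bsub>ses_B S\<^esub> r \<in> ses_image S"
proof -
  interpret A: right_module R "ses_A S" using assms by (rule ses_objD)
  interpret B: right_module R "ses_B S" using assms by (rule ses_objD)
  note al = ses_objD(4)[OF assms]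
  interpret al: abelian_group_hom "ses_A S" "ses_B S" "ses_alpha S"
    using rmod_hom_group_hom[OF ses_objD(1,2,4)[OF assms]] .
  show "\<zero>\<^bsub>ses_B S\<^esub> \<in> ses_image S" using al.hom_zero A.M.zero_closed unfolding ses_image_def by (metis imageI)
  show "x \<in> carrier (ses_B S)" if "x \<in> ses_image S" using that by (auto simp: ses_image_def)
  show "x \<oplus>\<^bsub>ses_B S\<^esub> y \<in> ses_image S" if "x \<in> ses_image S" "y \<in> ses_image S"
    using that unfolding ses_image_def by (auto simp flip: al.hom_add)
  show "\<ominus>\<^bsub>ses_B S\<^esub> x \<in> ses_image S" if "x \<in> ses_image S"
    using that unfolding ses_image_def by (auto simp flip: al.hom_a_inv)
  show "x \<star>\<^bsub>ses_B S\<^esub> r \<in> ses_image S" if "x \<in> ses_image S" "r \<in> carrier R"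
    using that unfolding ses_image_def by (auto simp flip: rmod_hom_rsmult[OF al])
qed

lemma filtered_module_rmod_prod:
  assumes S: "ses_obj R S" and S': "ses_obj R S'"
  shows "filtered_module R (rmod_prod (ses_B S) (ses_B S')) (ses_image S \<times> ses_image S')"
proof -
  interpret B: right_module R "ses_B S" using S by (rule ses_objD)
  interpret B': right_module R "ses_B S'" using S' by (rule ses_objD)
  interpret Z: right_module R "rmod_prod (ses_B S) (ses_B S')"
    using ses_objD(2)[OF S] ses_objD(2)[OF S'] by (rule right_module_rmod_prod)
  note im = ses_image_submodule[OF S] and im' = ses_image_submodule[OF S']
  have neg: "\<ominus>\<^bsub>rmod_prod (ses_B S) (ses_B S')\<^esub> z = (\<ominus>\<^bsub>ses_B S\<^esub> fst z, \<ominus>\<^bsub>ses_B S'\<^esub> snd z)"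
    if "z \<in> ses_image S \<times> ses_image S'" for z
    using that im im' by (intro Z.M.minus_equality) (auto simp: B.M.l_neg B'.M.l_neg)
  have "rsubmodule (ses_image S \<times> ses_image S') R (rmod_prod (ses_B S) (ses_B S'))"
    unfolding rsubmodule_def
  proof (intro conjI ballI additive_subgroup.intro subgroup.intro)
    fix z assume z: "z \<in> ses_image S \<times> ses_image S'"
    show "inv\<^bsub>add_monoid (rmod_prod (ses_B S) (ses_B S'))\<^esub> z \<in> ses_image S \<times> ses_image S'"
      using neg[OF z] z im(4) im'(4) by (auto simp: a_inv_def)
  qed (use im im' in auto)
  then show ?thesis by (intro filtered_module.intro filtered_module_axioms.intro Z.right_module_axioms)
qed

section \<open>Projections and injections of a direct sum of sequences\<close>

definition sum_proj :: "'i set \<Rightarrow> ('i \<Rightarrow> ('r, 'a, 'b, 'c) ses) \<Rightarrow> 'i set \<Rightarrow> ('i \<Rightarrow> 'b) \<Rightarrow> 'i \<Rightarrow> 'b" where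
  "sum_proj I S T x = (\<lambda>i\<in>I. if i \<in> T then x i else \<zero>\<^bsub>ses_B (S i)\<^esub>)"

definition sum_inj :: "'i set \<Rightarrow> ('i \<Rightarrow> ('r, 'a, 'b, 'c) ses) \<Rightarrow> 'i \<Rightarrow> 'b \<Rightarrow> 'i \<Rightarrow> 'b" where
  "sum_inj I S k b = (\<lambda>i\<in>I. if i = k then b else \<zero>\<^bsub>ses_B (S i)\<^esub>)"

lemma ses_B_sum_simps:
  "carrier (ses_B (ses_sum I S)) = (\<Pi>\<^sub>E i\<in>I. carrier (ses_B (S i)))"
  "\<zero>\<^bsub>ses_B (ses_sum I S)\<^esub> = (\<lambda>i\<in>I. \<zero>\<^bsub>ses_B (S i)\<^esub>)"
  "x \<oplus>\<^bsub>ses_B (ses_sum I S)\<^esub> y = (\<lambda>i\<in>I. x i \<oplus>\<^bsub>ses_B (S i)\<^esub> y i)"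
  "x \<star>\<^bsub>ses_B (ses_sum I S)\<^esub> r = (\<lambda>i\<in>I. x i \<star>\<^bsub>ses_B (S i)\<^esub> r)"
  by (simp_all add: ses_sum_def rmod_sum_def)

lemma ses_image_sum:
  assumes "ring R" "\<And>i. i \<in> I \<Longrightarrow> ses_obj R (S i)"
  shows "x \<in> ses_image (ses_sum I S) \<longleftrightarrow>
    x \<in> carrier (ses_B (ses_sum I S)) \<and> (\<forall>i\<in>I. x i \<in> ses_image (S i))"
proof -
  have "ses_obj R (ses_sum I S)" using assms by (rule ses_obj_ses_sum)
  note im = ses_objD(7)[OF this]
  have "x i \<in> ses_image (S i) \<longleftrightarrow> ses_beta (S i) (x i) = \<zero>\<^bsub>ses_C (S i)\<^esub>"
    if "i \<in> I" "x \<in> carrier (ses_B (ses_sum I S))" for i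
    using that ses_objD(7)[OF assms(2)[OF that(1)]] by (auto simp: ses_B_sum_simps)
  moreover have "(\<lambda>i\<in>I. ses_beta (S i) (x i)) = (\<lambda>i\<in>I. \<zero>\<^bsub>ses_C (S i)\<^esub>) \<longleftrightarrow>
      (\<forall>i\<in>I. ses_beta (S i) (x i) = \<zero>\<^bsub>ses_C (S i)\<^esub>)"
    by (auto simp: restrict_def fun_eq_iff)
  ultimately show ?thesis unfolding im by (auto simp: ses_sum_def rmod_sum_def)
qed

lemma sum_proj_proj: "sum_proj I S T (sum_proj I S U x) = sum_proj I S (T \<inter> U) x"
  by (auto simp: sum_proj_def intro!: restrict_ext)

lemma sum_proj_all:
  "\<lbrakk>I \<subseteq> T; x \<in> carrier (ses_B (ses_sum I S))\<rbrakk> \<Longrightarrow> sum_proj I S T x = x"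
  by (auto simp: sum_proj_def ses_B_sum_simps PiE_iff extensional_def fun_eq_iff)

lemma sum_proj_none: "sum_proj I S {} x = \<zero>\<^bsub>ses_B (ses_sum I S)\<^esub>"
  by (simp add: sum_proj_def ses_B_sum_simps)

lemma sum_proj_single: "sum_proj I S {k} x = sum_inj I S k (x k)"
  by (auto simp: sum_proj_def sum_inj_def intro!: restrict_ext)

context
  fixes R :: "('r, 'q) ring_scheme" and I :: "'i set" and S :: "'i \<Rightarrow> ('r, 'a, 'b, 'c) ses"
  assumes R: "ring R" and S: "\<And>i. i \<in> I \<Longrightarrow> ses_obj R (S i)"
begin

lemma rsmult_zero: "i \<in> I \<Longrightarrow> r \<in> carrier R \<Longrightarrow> \<zero>\<^bsub>ses_B (S i)\<^esub> \<star>\<^bsub>ses_B (S i)\<^esub> r = \<zero>\<^bsub>ses_B (S i)\<^esub>"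
proof -
  assume i: "i \<in> I" and r: "r \<in> carrier R"
  interpret B: right_module R "ses_B (S i)" using S[OF i] by (rule ses_objD)
  show ?thesis
    using B.rsmult_l_distr[of "\<zero>\<^bsub>ses_B (S i)\<^esub>" "\<zero>\<^bsub>ses_B (S i)\<^esub>" r] r
    by (simp add: B.M.add.r_cancel_one')
qed

lemma add_zero:
  "i \<in> I \<Longrightarrow> x \<in> carrier (ses_B (S i)) \<Longrightarrow> x \<oplus>\<^bsub>ses_B (S i)\<^esub> \<zero>\<^bsub>ses_B (S i)\<^esub> = x"
  "i \<in> I \<Longrightarrow> x \<in> carrier (ses_B (S i)) \<Longrightarrow> \<zero>\<^bsub>ses_B (S i)\<^esub> \<oplus>\<^bsub>ses_B (S i)\<^esub> x = x"
  "i \<in> I \<Longrightarrow> \<zero>\<^bsub>ses_B (S i)\<^esub> \<in> carrier (ses_B (S i))"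
proof -
  assume i: "i \<in> I"
  interpret B: right_module R "ses_B (S i)" using S[OF i] by (rule ses_objD)
  show "x \<in> carrier (ses_B (S i)) \<Longrightarrow> x \<oplus>\<^bsub>ses_B (S i)\<^esub> \<zero>\<^bsub>ses_B (S i)\<^esub> = x"
    "x \<in> carrier (ses_B (S i)) \<Longrightarrow> \<zero>\<^bsub>ses_B (S i)\<^esub> \<oplus>\<^bsub>ses_B (S i)\<^esub> x = x"
    "\<zero>\<^bsub>ses_B (S i)\<^esub> \<in> carrier (ses_B (S i))"
    by auto
qed

lemma sum_proj_hom: "sum_proj I S T \<in> ses_hom R (ses_sum I S) (ses_sum I S)"
proof -
  have "sum_proj I S T \<in> rmod_hom R (ses_B (ses_sum I S)) (ses_B (ses_sum I S))"
    by (intro rmod_homI)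
      (auto simp: sum_proj_def ses_B_sum_simps PiE_iff add_zero rsmult_zero intro!: restrict_ext)
  moreover have "sum_proj I S T x \<in> ses_image (ses_sum I S)" if "x \<in> ses_image (ses_sum I S)" for x
    using that ses_image_submodule(1)[OF S]
    by (auto simp: ses_image_sum[of R I S, OF R S] sum_proj_def ses_B_sum_simps PiE_iff add_zero)
  ultimately show ?thesis by (auto simp: ses_hom_def ses_image_def)
qed

lemma sum_proj_union:
  "\<lbrakk>T \<inter> U = {}; x \<in> carrier (ses_B (ses_sum I S))\<rbrakk> \<Longrightarrow>
    sum_proj I S (T \<union> U) x = sum_proj I S T x \<oplus>\<^bsub>ses_B (ses_sum I S)\<^esub> sum_proj I S U x"
  by (auto simp: sum_proj_def ses_B_sum_simps PiE_iff add_zero intro!: restrict_ext)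

lemma sum_inj_hom: "k \<in> I \<Longrightarrow> sum_inj I S k \<in> ses_hom R (S k) (ses_sum I S)"
proof -
  assume k: "k \<in> I"
  interpret B: right_module R "ses_B (S k)" using S[OF k] by (rule ses_objD)
  have "sum_inj I S k \<in> rmod_hom R (ses_B (S k)) (ses_B (ses_sum I S))"
    by (intro rmod_homI)
      (auto simp: sum_inj_def ses_B_sum_simps PiE_iff add_zero rsmult_zero intro!: restrict_ext)
  moreover have "sum_inj I S k x \<in> ses_image (ses_sum I S)" if "x \<in> ses_image (S k)" for x
    using that ses_image_submodule(1)[OF S] ses_image_submodule(2)[OF S[OF k]]
    by (auto simp: ses_image_sum[of R I S, OF R S] sum_inj_def ses_B_sum_simps PiE_iff add_zero)
  ultimately show ?thesis by (auto simp: ses_hom_def ses_image_def)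
qed

lemma sum_component_hom: "k \<in> I \<Longrightarrow> (\<lambda>x. x k) \<in> ses_hom R (ses_sum I S) (S k)"
proof -
  assume k: "k \<in> I"
  have "(\<lambda>x. x k) \<in> rmod_hom R (ses_B (ses_sum I S)) (ses_B (S k))"
    using k by (intro rmod_homI) (auto simp: ses_B_sum_simps PiE_iff)
  moreover have "x k \<in> ses_image (S k)" if "x \<in> ses_image (ses_sum I S)" for x
    using that k by (simp add: ses_image_sum[of R I S, OF R S])
  ultimately show ?thesis by (auto simp: ses_hom_def ses_image_def)
qed

end

lemma rmod_hom_compose:
  "f \<in> rmod_hom R M N \<Longrightarrow> g \<in> rmod_hom R N L \<Longrightarrow> (\<lambda>x. g (f x)) \<in> rmod_hom R M L"
  by (intro rmod_homI) (auto simp: rmod_hom_closed rmod_hom_add rmod_hom_rsmult)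

text \<open>Retracts compose: a component is a retract of the sum, and the sum is a retract of
  \<open>Z\<close>. The idempotent is prescribed on the carrier only, so that an extensional
  function can take its place.\<close>

lemma (in filtered_module) summand_component:
  assumes R: "ring R" and S: "\<And>i. i \<in> I \<Longrightarrow> ses_obj R (S i)"
    and s: "summand (ses_sum I S) h inn out" and k: "k \<in> I"
    and h': "\<And>z. z \<in> carrier Z \<Longrightarrow> h' z = inn (sum_proj I S {k} (out z))"
  shows "summand (S k) h' (\<lambda>x. inn (sum_inj I S k x)) (\<lambda>z. out z k)"
  unfolding summand_def
proof (intro conjI ballI)
  note i = sum_inj_hom[of R I S k, OF R S k] and c = sum_component_hom[of R I S k, OF R S k]
  show "ses_obj R (S k)" using S k by simp
  show "(\<lambda>x. inn (sum_inj I S k x)) \<in> rmod_hom R (ses_B (S k)) Z"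
    using ses_homD(1)[OF i] summandD(2)[OF s] by (rule rmod_hom_compose)
  show "(\<lambda>z. out z k) \<in> rmod_hom R Z (ses_B (S k))"
    using summandD(3)[OF s] ses_homD(1)[OF c] by (rule rmod_hom_compose)
  show "out (inn (sum_inj I S k x)) k = x" if "x \<in> carrier (ses_B (S k))" for x
    using summandD(4)[OF s rmod_hom_closed[OF ses_homD(1)[OF i] that]] k by (simp add: sum_inj_def)
  show "inn (sum_inj I S k (out z k)) = h' z" if "z \<in> carrier Z" for z
    using h'[OF that] by (simp add: sum_proj_single)
  show "(\<lambda>x. inn (sum_inj I S k x)) ` ses_image (S k) \<subseteq> F"
    using ses_homD(2)[OF i] summandD(8)[OF s] by auto
  show "(\<lambda>z. out z k) ` F \<subseteq> ses_image (S k)"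
    using ses_homD(2)[OF c] summandD(9)[OF s] by auto
qed

lemma summand_prod:
  assumes S: "ses_obj R S" and S': "ses_obj R S'"
  shows "filtered_module.summand R (rmod_prod (ses_B S) (ses_B S')) (ses_image S \<times> ses_image S')
      S (\<lambda>z. (fst z, \<zero>\<^bsub>ses_B S'\<^esub>)) (\<lambda>x. (x, \<zero>\<^bsub>ses_B S'\<^esub>)) fst"
    and "filtered_module.summand R (rmod_prod (ses_B S) (ses_B S')) (ses_image S \<times> ses_image S')
      S' (\<lambda>z. (\<zero>\<^bsub>ses_B S\<^esub>, snd z)) (\<lambda>x. (\<zero>\<^bsub>ses_B S\<^esub>, x)) snd"
proof -
  interpret filtered_module R "rmod_prod (ses_B S) (ses_B S')" "ses_image S \<times> ses_image S'"
    using S S' by (rule filtered_module_rmod_prod)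
  interpret B: right_module R "ses_B S" using S by (rule ses_objD)
  interpret B': right_module R "ses_B S'" using S' by (rule ses_objD)
  have z: "\<zero>\<^bsub>ses_B S\<^esub> \<star>\<^bsub>ses_B S\<^esub> r = \<zero>\<^bsub>ses_B S\<^esub>" "\<zero>\<^bsub>ses_B S'\<^esub> \<star>\<^bsub>ses_B S'\<^esub> r = \<zero>\<^bsub>ses_B S'\<^esub>"
    if "r \<in> carrier R" for r
    using smult_zero[OF that] by auto
  show "summand S (\<lambda>z. (fst z, \<zero>\<^bsub>ses_B S'\<^esub>)) (\<lambda>x. (x, \<zero>\<^bsub>ses_B S'\<^esub>)) fst"
    using S ses_image_submodule(1)[OF S'] z by (auto simp: summand_def intro!: rmod_homI)
  show "summand S' (\<lambda>z. (\<zero>\<^bsub>ses_B S\<^esub>, snd z)) (\<lambda>x. (\<zero>\<^bsub>ses_B S\<^esub>, x)) snd"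
    using S' ses_image_submodule(1)[OF S] z by (auto simp: summand_def intro!: rmod_homI)
qed

lemma (in filtered_module) summand_cong:
  assumes "summand S h inn out" "\<And>z. z \<in> carrier Z \<Longrightarrow> h z = h' z"
  shows "summand S h' inn out"
  using assms by (simp add: summand_def)

theorem ses_iso_sum_iff_bijections:
  fixes R :: "('r, 'q) ring_scheme" and I :: "'i set" and J :: "'j set"
    and S :: "'i \<Rightarrow> ('r, 'a, 'b, 'c) ses" and S' :: "'j \<Rightarrow> ('r, 'd, 'e, 'f) ses"
  assumes R: "ring R" and fin: "finite I" "finite J"
    and S: "\<And>i. i \<in> I \<Longrightarrow> ses_obj R (S i)" and S': "\<And>j. j \<in> J \<Longrightarrow> ses_obj R (S' j)"
    and uS: "\<And>i. i \<in> I \<Longrightarrow> uniserial R (ses_A (S i)) \<and> uniserial R (ses_C (S i))"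
    and uS': "\<And>j. j \<in> J \<Longrightarrow> uniserial R (ses_A (S' j)) \<and> uniserial R (ses_C (S' j))"
  shows "ses_iso R (ses_sum I S) (ses_sum J S') \<longleftrightarrow>
    (\<exists>\<phi>. \<forall>a b. bij_betw (\<phi> a b) {i \<in> I. end_nonzero b (S i)} {j \<in> J. end_nonzero b (S' j)} \<and>
      (\<forall>i\<in>{i \<in> I. end_nonzero b (S i)}. same_class R a b (S i) (S' (\<phi> a b i))))"
proof -
  define U where "U = ses_sum I S"
  define V where "V = ses_sum J S'"
  have U: "ses_obj R U" unfolding U_def using R S by (rule ses_obj_ses_sum)
  have V: "ses_obj R V" unfolding V_def using R S' by (rule ses_obj_ses_sum)
  define Z where "Z = rmod_prod (ses_B U) (ses_B V)"
  define F where "F = ses_image U \<times> ses_image V"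
  interpret filtered_module R Z F
    unfolding Z_def F_def using U V by (rule filtered_module_rmod_prod)
  \<comment> \<open>A set of tagged indices is split into its two halves, and each half projects the
    corresponding factor of \<open>Z\<close>.\<close>
  define l where "l = (\<lambda>T :: ('i + 'j) set. sum_proj I S {i. Inl i \<in> T})"
  define r where "r = (\<lambda>T :: ('i + 'j) set. sum_proj J S' {j. Inr j \<in> T})"
  define e where "e = (\<lambda>T. \<lambda>z\<in>carrier Z. (l T (fst z), r T (snd z)))"
  have e_apply: "e T z = (l T (fst z), r T (snd z))" if "z \<in> carrier Z" for T z
    using that by (simp add: e_def)
  have lh: "l T \<in> ses_hom R U U" and rh: "r T \<in> ses_hom R V V" for T
    unfolding l_def r_def U_def V_def
    using sum_proj_hom[of R I S, OF R S] sum_proj_hom[of R J S', OF R S'] by auto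
  note lr = ses_homD(1)[OF lh] ses_homD(1)[OF rh]
  note lr_closed = rmod_hom_closed[OF lr(1)] rmod_hom_closed[OF lr(2)]
  have Z_iff: "z \<in> carrier Z \<longleftrightarrow> fst z \<in> carrier (ses_B U) \<and> snd z \<in> carrier (ses_B V)" for z
    by (cases z) (simp add: Z_def)
  have e_E: "e T \<in> carrier E" for T
  proof (rule EI)
    fix z assume "z \<in> F"
    then show "e T z \<in> F"
      using ses_homD(2)[OF lh] ses_homD(2)[OF rh] F_sub[of z] by (auto simp: e_apply F_def)
  next
    fix z assume z: "z \<in> carrier Z"
    show "e T z \<in> carrier Z" using z lr_closed by (simp add: e_apply Z_iff)
    show "e T (z \<oplus>\<^bsub>Z\<^esub> w) = e T z \<oplus>\<^bsub>Z\<^esub> e T w" if w: "w \<in> carrier Z" for w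
    proof -
      have "z \<oplus>\<^bsub>Z\<^esub> w \<in> carrier Z" using z w by simp
      then show ?thesis
        using z w rmod_hom_add[OF lr(1)] rmod_hom_add[OF lr(2)]
        by (simp add: e_apply Z_iff) (simp add: Z_def)
    qed
    show "e T (z \<star>\<^bsub>Z\<^esub> a) = e T z \<star>\<^bsub>Z\<^esub> a" if a: "a \<in> carrier R" for a
    proof -
      have "z \<star>\<^bsub>Z\<^esub> a \<in> carrier Z" using z a by simp
      then show ?thesis
        using z a rmod_hom_rsmult[OF lr(1)] rmod_hom_rsmult[OF lr(2)]
        by (simp add: e_apply Z_iff) (simp add: Z_def)
    qed
  qed (simp add: e_def)
  have sU: "summand U (\<lambda>z. (fst z, \<zero>\<^bsub>ses_B V\<^esub>)) (\<lambda>x. (x, \<zero>\<^bsub>ses_B V\<^esub>)) fst"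
    and sV: "summand V (\<lambda>z. (\<zero>\<^bsub>ses_B U\<^esub>, snd z)) (\<lambda>x. (\<zero>\<^bsub>ses_B U\<^esub>, x)) snd"
    unfolding Z_def F_def using summand_prod[OF U V] by auto
  have r0: "r (Inl ` A) x = \<zero>\<^bsub>ses_B V\<^esub>" and l0: "l (Inr ` A') y = \<zero>\<^bsub>ses_B U\<^esub>" for A A' x y
  proof -
    have "{j. Inr j \<in> (Inl ` A :: ('i + 'j) set)} = {}" "{i. Inl i \<in> (Inr ` A' :: ('i + 'j) set)} = {}" by auto
    then show "r (Inl ` A) x = \<zero>\<^bsub>ses_B V\<^esub>" "l (Inr ` A') y = \<zero>\<^bsub>ses_B U\<^esub>"
      by (simp_all only: r_def l_def sum_proj_none U_def V_def)
  qed
  have l1: "l (Inl ` A) = sum_proj I S A" and r1: "r (Inr ` A') = sum_proj J S' A'" for A A'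
    by (simp_all add: l_def r_def inj_image_mem_iff)
  have sl: "\<exists>inn out. summand (S i) (e {Inl i}) inn out" if i: "i \<in> I" for i
    using summand_component[OF R S sU[unfolded U_def] i, of "e {Inl i}"] r0[of "{i}"] l1[of "{i}"]
    by (simp add: e_apply U_def) blast
  have sr: "\<exists>inn out. summand (S' j) (e {Inr j}) inn out" if j: "j \<in> J" for j
    using summand_component[OF R S' sV[unfolded V_def] j, of "e {Inr j}"] l0[of "{j}"] r1[of "{j}"]
    by (simp add: e_apply V_def) blast
  interpret split_module R Z F e "Inl ` I \<union> Inr ` J"
  proof
    show "finite (Inl ` I \<union> Inr ` J)" using fin by simp
    show "e T \<in> carrier E" for T by (rule e_E)
    fix z assume z: "z \<in> carrier Z"
    show "e T (e T' z) = e (T \<inter> T') z" for T T'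
      using z E_closed[OF e_E z] by (simp add: e_apply l_def r_def sum_proj_proj Collect_conj_eq)
    show "e (T \<union> T') z = e T z \<oplus>\<^bsub>Z\<^esub> e T' z" if "T \<inter> T' = {}" for T T'
    proof -
      have "{i. Inl i \<in> T} \<inter> {i. Inl i \<in> T'} = {}" "{j. Inr j \<in> T} \<inter> {j. Inr j \<in> T'} = {}"
        using that by auto
      then show ?thesis
        using z z[unfolded Z_iff] sum_proj_union[of R I S "{i. Inl i \<in> T}" "{i. Inl i \<in> T'}" "fst z", OF R S]
          sum_proj_union[of R J S' "{j. Inr j \<in> T}" "{j. Inr j \<in> T'}" "snd z", OF R S']
        by (simp add: e_apply l_def r_def Collect_disj_eq Z_def U_def V_def)
    qed
    show "e (Inl ` I \<union> Inr ` J) z = z"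
    proof -
      have "{i. Inl i \<in> Inl ` I \<union> Inr ` J} = I" "{j. Inr j \<in> Inl ` I \<union> Inr ` J} = J" by auto
      then show ?thesis
        using z sum_proj_all[of I I "fst z" S] sum_proj_all[of J J "snd z" S']
        by (simp only: e_apply l_def r_def) (simp add: Z_iff U_def V_def)
    qed
  next
    fix x b z w assume x: "x \<in> Inl ` I \<union> Inr ` J" and zw: "z \<in> P b" "w \<in> P b"
    from x show "(\<exists>a\<in>carrier R. cong b (e {x} z \<star>\<^bsub>Z\<^esub> a) (e {x} w)) \<or>
        (\<exists>a\<in>carrier R. cong b (e {x} w \<star>\<^bsub>Z\<^esub> a) (e {x} z))"
    proof
      assume "x \<in> Inl ` I"
      then obtain i where i: "i \<in> I" "x = Inl i" by blast
      then obtain inn out where "summand (S i) (e {x}) inn out" using sl by blast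
      then show ?thesis using uS[OF i(1)] zw by (intro summand_uniserial) auto
    next
      assume "x \<in> Inr ` J"
      then obtain j where j: "j \<in> J" "x = Inr j" by blast
      then obtain inn out where "summand (S' j) (e {x}) inn out" using sr by blast
      then show ?thesis using uS'[OF j(1)] zw by (intro summand_uniserial) auto
    qed
  qed
  have nz_l: "nonzero_at b (Inl i) \<longleftrightarrow> end_nonzero b (S i)" if "i \<in> I" for b i
    using sl[OF that] summand_nonzero_iff unfolding nonzero_at_def by blast
  have nz_r: "nonzero_at b (Inr j) \<longleftrightarrow> end_nonzero b (S' j)" if "j \<in> J" for b j
    using sr[OF that] summand_nonzero_iff unfolding nonzero_at_def by blast
  have "summand U (e (Inl ` I)) (\<lambda>x. (x, \<zero>\<^bsub>ses_B V\<^esub>)) fst"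
    using sum_proj_all[of I I _ S]
    by (intro summand_cong[OF sU]) (simp add: e_apply l1 r0 Z_iff U_def)
  moreover have "summand V (e (Inr ` J)) (\<lambda>x. (\<zero>\<^bsub>ses_B U\<^esub>, x)) snd"
    using sum_proj_all[of J J _ S']
    by (intro summand_cong[OF sV]) (simp add: e_apply r1 l0 Z_iff V_def)
  ultimately have "ses_iso R U V \<longleftrightarrow>
      (\<exists>f\<in>carrier E. \<exists>g\<in>carrier E. e (Inr ` J) \<otimes>\<^bsub>E\<^esub> (f \<otimes>\<^bsub>E\<^esub> e (Inl ` I)) = f \<and>
        e (Inl ` I) \<otimes>\<^bsub>E\<^esub> (g \<otimes>\<^bsub>E\<^esub> e (Inr ` J)) = g \<and>
        g \<otimes>\<^bsub>E\<^esub> f = e (Inl ` I) \<and> f \<otimes>\<^bsub>E\<^esub> g = e (Inr ` J))"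
    by (rule ses_iso_iff)
  also have "\<dots> \<longleftrightarrow> (\<exists>\<phi>. \<forall>t. bij_betw (\<phi> t) {x \<in> Inl ` I. type_supp t x} {y \<in> Inr ` J. type_supp t y} \<and>
      (\<forall>x\<in>{x \<in> Inl ` I. type_supp t x}. sim t x (\<phi> t x)))"
    by (rule isomorphic_iff_bijections) auto
  also have "\<dots> \<longleftrightarrow>
      (\<exists>\<phi>. \<forall>a b. bij_betw (\<phi> a b) {i \<in> I. end_nonzero b (S i)} {j \<in> J. end_nonzero b (S' j)} \<and>
        (\<forall>i\<in>{i \<in> I. end_nonzero b (S i)}. same_class R a b (S i) (S' (\<phi> a b i))))"
    (is "(\<exists>\<phi>. \<forall>t. ?L \<phi> t) \<longleftrightarrow> (\<exists>\<psi>. \<forall>a b. ?R \<psi> a b)")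
  proof -
    have supp_l: "{x \<in> Inl ` I. type_supp (a, b) x} = Inl ` {i \<in> I. end_nonzero b (S i)}" for a b
      using nz_l by (auto simp: type_supp_def)
    have supp_r: "{y \<in> Inr ` J. type_supp (a, b) y} = Inr ` {j \<in> J. end_nonzero b (S' j)}" for a b
      using nz_r by (auto simp: type_supp_def)
    \<comment> \<open>\<open>u\<close> acts on tagged indices and \<open>v\<close> on the original
      ones. Only values at supported indices enter, so agreement up to the tag is required just
      there.\<close>
    have transfer: "?L u (a, b) \<longleftrightarrow> ?R v a b"
      if uv: "\<And>i. i \<in> {i \<in> I. end_nonzero b (S i)} \<Longrightarrow> u (a, b) (Inl i) = Inr (v a b i)" for u v a b
    proof -
      let ?A = "{i \<in> I. end_nonzero b (S i)}" and ?B = "{j \<in> J. end_nonzero b (S' j)}"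
      have bij: "bij_betw (u (a, b)) (Inl ` ?A) (Inr ` ?B) \<longleftrightarrow> bij_betw (v a b) ?A ?B"
      proof -
        have "inj_on (u (a, b)) (Inl ` ?A) \<longleftrightarrow> inj_on (v a b) ?A"
          using uv by (auto simp: inj_on_def)
        moreover have "u (a, b) ` Inl ` ?A = Inr ` v a b ` ?A"
          using uv by (auto simp: image_image intro!: image_cong)
        ultimately show ?thesis by (simp add: bij_betw_def inj_image_eq_iff)
      qed
      have "sim (a, b) (Inl i) (Inr (v a b i)) \<longleftrightarrow> same_class R a b (S i) (S' (v a b i))"
        if "bij_betw (v a b) ?A ?B" "i \<in> ?A" for i
      proof -
        have ij: "i \<in> I" "nonzero_at b (Inl i)" using that(2) nz_l by auto
        have "v a b i \<in> ?B" using that by (auto simp: bij_betw_def)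
        then have ij': "v a b i \<in> J" "nonzero_at b (Inr (v a b i))" using nz_r by auto
        obtain inn out inn' out' where "summand (S i) (e {Inl i}) inn out"
          "summand (S' (v a b i)) (e {Inr (v a b i)}) inn' out'"
          using sl[OF ij(1)] sr[OF ij'(1)] by blast
        then show ?thesis using ij(2) ij'(2) by (rule sim_iff_same_class)
      qed
      then show ?thesis unfolding supp_l supp_r using bij uv by auto
    qed
    show ?thesis
    proof
      assume "\<exists>\<phi>. \<forall>t. ?L \<phi> t"
      then obtain \<phi> where \<phi>: "\<And>t. ?L \<phi> t" by blast
      \<comment> \<open>Removing the tag by \<open>projr\<close> is sound because the bijection
        takes supported left indices to right ones.\<close>
      have "\<phi> (a, b) (Inl i) = Inr (projr (\<phi> (a, b) (Inl i)))" if "i \<in> {i \<in> I. end_nonzero b (S i)}" for a b i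
      proof -
        have "\<phi> (a, b) (Inl i) \<in> Inr ` J"
          using \<phi>[of "(a, b)"] that unfolding supp_l by (auto simp: bij_betw_def)
        then show ?thesis by auto
      qed
      then have "?R (\<lambda>a b i. projr (\<phi> (a, b) (Inl i))) a b" for a b
        using transfer[of b \<phi> a "\<lambda>a b i. projr (\<phi> (a, b) (Inl i))"] \<phi>[of "(a, b)"] by blast
      then have "\<forall>a b. ?R (\<lambda>a b i. projr (\<phi> (a, b) (Inl i))) a b" by simp
      then show "\<exists>\<psi>. \<forall>a b. ?R \<psi> a b"
        by (rule exI[where x = "\<lambda>a b i. projr (\<phi> (a, b) (Inl i))"])
    next
      assume "\<exists>\<psi>. \<forall>a b. ?R \<psi> a b"
      then obtain \<psi> where \<psi>: "\<And>a b. ?R \<psi> a b" by blast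
      have "?L (\<lambda>t x. Inr (\<psi> (fst t) (snd t) (projl x))) (a, b)" for a b
        using transfer[of b "\<lambda>t x. Inr (\<psi> (fst t) (snd t) (projl x))" a \<psi>] \<psi>[of a b] by simp
      then have "\<forall>t. ?L (\<lambda>t x. Inr (\<psi> (fst t) (snd t) (projl x))) t" by (simp only: split_paired_All) simp
      then show "\<exists>\<phi>. \<forall>t. ?L \<phi> t"
        by (rule exI[where x = "\<lambda>t x. Inr (\<psi> (fst t) (snd t) (projl x))"])
    qed
  qed
  finally show ?thesis unfolding U_def V_def .
qed

theorem theorem6p3:
  fixes R :: "('r, 'q) ring_scheme"
    and n m :: nat
    and B :: "nat \<Rightarrow> ('r, 'a, 'b, 'c) ses"
    and B' :: "nat \<Rightarrow> ('r, 'd, 'e, 'f) ses"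
    and X X' :: "lu_index \<Rightarrow> nat set"
  assumes "ring R"
    and "\<And>i. i \<in> {1..n} \<Longrightarrow> ses_obj R (B i) \<and> \<not> ses_zero (B i)"
    and "\<And>j. j \<in> {1..m} \<Longrightarrow> ses_obj R (B' j) \<and> \<not> ses_zero (B' j)"
    and "\<And>i. i \<in> {1..n} \<Longrightarrow> uniserial R (ses_A (B i)) \<and> uniserial R (ses_C (B i))"
    and "\<And>j. j \<in> {1..m} \<Longrightarrow> uniserial R (ses_A (B' j)) \<and> uniserial R (ses_C (B' j))"
    and "\<And>b. X b = {i \<in> {1..n}. end_nonzero b (B i)}"
    and "\<And>b. X' b = {j \<in> {1..m}. end_nonzero b (B' j)}"
  shows "ses_iso R (ses_sum {1..n} B) (ses_sum {1..m} B') \<longleftrightarrow>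
    (\<exists>\<phi> :: me_index \<Rightarrow> lu_index \<Rightarrow> nat \<Rightarrow> nat. \<forall>a b.
       bij_betw (\<phi> a b) (X b) (X' b) \<and>
       (\<forall>i\<in>X b. same_class R a b (B i) (B' (\<phi> a b i))))"
  unfolding assms(6,7)
  by (rule ses_iso_sum_iff_bijections) (use assms(1-5) in auto)

end
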